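(* Suppose that the positivity condition, the stabilizability condition and the algebraic solvability condition (all defined in the context) hold. Let $p_T$ be the unique solution of the finite-horizon $p$-equation and $p$ the unique solution of the algebraic $p$-equation (see context). Then there exist constants $K,\lambda>0$, independent of $T$, such that $$\|p-p_T(t)\|_{L^2(I;\mathbb R^d)}\le Ke^{-\lambda(T-t)},\qquad\forall t\in[0,T].$$ Furthermore, with $\theta_T^*(t)(u)=-\mathcal R(P_T(t))^{-1}\Gamma(P_T(t),p_T(t))(u)$ and $\theta^*(u)=-\mathcal R(P)^{-1}\Gamma(P,p)(u)$, there exist constants $K,\lambda>0$, independent of $T$, such that $$\|\theta^*-\theta_T^*(t)\|_{L^2(I;\mathbb R^m)}\le Ke^{-\lambda(T-t)},\qquad\forall t\in[0,T].$$
   Context: **Notation.** $I=[0,1]$ with Lebesgue measure $du$; $\mathbb S^d,\mathbb S^d_+,\mathbb S^d_{++}$ are the real symmetric, symmetric positive semidefinite, symmetric positive definite $d\times d$ matrices. $L^2(I;E)$ consists of measurable $\phi=(\phi^u)_{u\in I}$ with $\int_I|\phi^u|^2du<\infty$; $L^2(I\times I;\mathbb R^{k\times l})$ has norm $\|h\|^2_{L^2(I\times I)}=\int_I\int_I\|h(u,v)\|_F^2\,dv\,du$ (Frobenius norm). **Probabilistic setup** (used in the stabilizability condition). A complete probability space carries, for each $u\in I$, a one-dimensional Brownian motion $W^u$ and an independent $\zeta^u$ uniform on $(0,1)$; the pairs $(W^u,\zeta^u)$, $u\in I$, are independent. $\mathcal F^u_t$ is generated by $(W^u_s)_{s\le t}$,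 $\zeta^u$ and the null sets. $\mathfrak L^2_0$ is the set of collections $\xi=(\xi^u)_{u\in I}$ of $\mathbb R^d$-valued random variables with $\xi^u$ $\mathcal F^u_0$-measurable, $u\mapsto\mathrm{Law}(W^u_{\cdot\wedge0},\zeta^u,\xi^u)\in\mathcal P_2(C([0,T];\mathbb R)\times(0,1)\times\mathbb R^d)$ measurable ($\mathcal P_2$: probability measures with finite second moment, with the 2-Wasserstein distance), and $\int_I\mathbb E|\xi^u|^2du<\infty$; $\bar\xi^u=\mathbb E[\xi^u]$. **Coefficients.** $b,\sigma\in\mathbb R^d$; $A,\bar A,\tilde A,C,\bar C,\tilde C\in\mathbb R^{d\times d}$; $B,D\in\mathbb R^{d\times m}$; $Q,\bar Q,\check Q\in\mathbb S^d_+$; $\tilde Q\in\mathbb R^{d\times d}$; $S\in\mathbb R^{m\times d}$; $R\in\mathbb S^m_{++}$; a graphon $G$, i.e. a measurable $G:I\times I\to\mathbb R$ in $L^2(I\times I)$. **Coefficient maps.** For $P\in\mathbb S^d_+$, $\Pi\in\mathbb S^d$, $\Lambda\in L^2(I\times I;\mathbb R^{d\times d})$, $p\in L^2(I;\mathbb R^d)$: $\mathcal Q(P)=A^\top P+PA+C^\top PC+Q$; $\hat{\mathcal Q}(P,\Pi)=(A+\bar A)^\top(P+\Pi)+(P+\Pi)(A+\bar A)+(C+\bar C)^\top P(C+\bar C)+Q+\bar Q$; $\mathcal M(P)=B^\top P+D^\top PC+S$; $\hat{\mathcal M}(P,\Pi)=B^\top(P+\Pi)+D^\top P(C+\bar C)+S$;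 $\mathcal R(P)=R+D^\top PD$; $\Upsilon(P,\Lambda)(u,v)=B^\top\Lambda(u,v)+D^\top P\tilde CG(u,v)$; $\Gamma(P,p)(u)=D^\top P\sigma+B^\top p(u)$; $$\begin{aligned}\Psi_1(P,\Pi,\Lambda)(u,v)={}&(P+\Pi)\tilde AG(u,v)+\tilde A^\top(P+\Pi)G(v,u)+(C+\bar C)^\top P\tilde CG(u,v)+\tilde C^\top P(C+\bar C)G(v,u)\\&+\int_I\tilde C^\top G(w,u)P\tilde CG(w,v)dw+(A+\bar A)^\top\Lambda(u,v)+\Lambda(v,u)^\top(A+\bar A)\\&+\int_I\Lambda(w,u)^\top\tilde AG(w,v)dw+\int_I\tilde A^\top G(w,u)\Lambda(w,v)dw+\tilde QG(u,v)+\int_IG(w,u)\check QG(w,v)dw,\end{aligned}$$ $$\begin{aligned}\Psi_2(P,\Pi,\Lambda,p)(u)={}&(A+\bar A)^\top p(u)+\tilde A^\top\int_IG(v,u)p(v)dv+(P+\Pi)b+(C+\bar C)^\top P\sigma\\&+\tilde C^\top\int_IG(v,u)P\sigma dv+\int_I\tfrac12(\Lambda(u,v)+\Lambda(v,u)^\top)b\,dv,\end{aligned}$$ $$\begin{aligned}F_{P,\Pi}(\Lambda)(u,v)={}&\Psi_1(P,\Pi,\Lambda)(u,v)-\hat{\mathcal M}(P,\Pi)^\top\mathcal R(P)^{-1}\Upsilon(P,\Lambda)(u,v)-\Upsilon(P,\Lambda)(v,u)^\top\mathcal R(P)^{-1}\hat{\mathcal M}(P,\Pi)\\&-\int_I\Upsilon(P,\Lambda)(w,u)^\top\mathcal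 R(P)^{-1}\Upsilon(P,\Lambda)(w,v)dw,\end{aligned}$$ $$\tilde F_{P,\Pi,\Lambda}(p)(u)=\Psi_2(P,\Pi,\Lambda,p)(u)-\hat{\mathcal M}(P,\Pi)^\top\mathcal R(P)^{-1}\Gamma(P,p)(u)-\int_I\Upsilon(P,\Lambda)(v,u)^\top\mathcal R(P)^{-1}\Gamma(P,p)(v)dv.$$ **Finite-horizon equations on $[0,T]$, $T>0$** (a.e. $u,v$), with $\Pi_T=\bar\Pi_T-P_T$: $\dot P_T+\mathcal Q(P_T)-\mathcal M(P_T)^\top\mathcal R(P_T)^{-1}\mathcal M(P_T)=0$, $P_T(T)=0$; $\dot{\bar\Pi}_T+\hat{\mathcal Q}(P_T,\Pi_T)-\hat{\mathcal M}(P_T,\Pi_T)^\top\mathcal R(P_T)^{-1}\hat{\mathcal M}(P_T,\Pi_T)=0$, $\bar\Pi_T(T)=0$; $\dot\Lambda_T(t)(u,v)+F_{P_T(t),\Pi_T(t)}(\Lambda_T(t))(u,v)=0$, $\Lambda_T(T)=0$; the finite-horizon $p$-equation $\dot p_T(t)(u)+\tilde F_{P_T(t),\Pi_T(t),\Lambda_T(t)}(p_T(t))(u)=0$, $p_T(T)=0$; with unique solutions $P_T,\bar\Pi_T\in C^1([0,T];\mathbb S^d_+)$, $\Lambda_T\in C^1([0,T];L^2(I\times I;\mathbb R^{d\times d}))$, $p_T\in C^1([0,T];L^2(I;\mathbb R^d))$ (they exist under the positivity condition). **Algebraic system**, with $\Pi=\bar\Pi-P$: $\mathcal Q(P)-\mathcal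 M(P)^\top\mathcal R(P)^{-1}\mathcal M(P)=0$, $\hat{\mathcal Q}(P,\Pi)-\hat{\mathcal M}(P,\Pi)^\top\mathcal R(P)^{-1}\hat{\mathcal M}(P,\Pi)=0$, whose unique solution $(P,\bar\Pi)\in\mathbb S^d_{++}\times\mathbb S^d_{++}$ exists under the positivity and stabilizability conditions; the algebraic $\Lambda$-equation $F_{P,\Pi}(\Lambda)(u,v)=0$ for a.e. $u,v\in I$, for $\Lambda\in L^2(I\times I;\mathbb R^{d\times d})$; and the algebraic $p$-equation $\tilde F_{P,\Pi,\Lambda}(p)(u)=0$ for a.e. $u\in I$, for $p\in L^2(I;\mathbb R^d)$. **Positivity condition.** $Q-S^\top R^{-1}S\in\mathbb S^d_{++}$, $Q+\bar Q-S^\top R^{-1}S\in\mathbb S^d_{++}$, $\check Q\ge0$, and $\int_I\int_I\langle\phi^u,\tilde QG(u,v)\phi^v\rangle dv\,du\ge0$ for all $\phi\in L^2(I;\mathbb R^d)$. **Stabilizability condition.** (a) There exist $\bar\Theta\in\mathbb R^{m\times d}$, $\tilde\Theta\in L^2(I\times I;\mathbb R^{m\times d})$ such that for every $\xi\in\mathfrak L^2_0$ the solution of $\frac{d}{dt}\bar X^u=(A+\bar A+B\bar\Theta)\bar X^u+\int_I(\tilde AG(u,v)+B\tilde\Theta(u,v))\bar X^vdv$, $\bar X^u(0)=\bar\xi^u$, satisfies $\int_0^\infty\int_I|\bar X^u(t)|^2du\,dt<\infty$; and (b) there exists $\Theta\in\mathbb R^{m\times d}$ such that for every $\xi\in\mathfrak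 L^2_0$ the solution of $dX^u=(A+B\Theta)X^udt+(C+D\Theta)X^udW^u$, $X^u(0)=\xi^u$, satisfies $\mathbb E[\int_I\int_0^\infty|X^u(t)|^2dt\,du]<\infty$. **Algebraic solvability condition.** The system formed by the algebraic $\Lambda$- and $p$-equations admits a unique solution with $\Lambda\in L^2(I\times I;\mathbb R^{d\times d})$ and $p\in L^2(I;\mathbb R^d)$ such that $\int_I\int_I\langle\phi^u,\Lambda(u,v)\phi^v\rangle dv\,du\ge0$ for all $\phi\in L^2(I;\mathbb R^d)$; moreover, for each fixed $t\ge0$, $\Lambda_T(t)\to\Lambda$ in $L^2(I\times I;\mathbb R^{d\times d})$ as $T\to\infty$. *)

theory Defs
  imports "HOL-Probability.Probability"
begin

section \<open>Matrices and square-integrable functions\<close>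

definition sym_mat :: "real^'n^'n \<Rightarrow> bool" where
  "sym_mat X \<longleftrightarrow> transpose X = X"

definition psd_mat :: "real^'n^'n \<Rightarrow> bool" where
  "psd_mat X \<longleftrightarrow> sym_mat X \<and> (\<forall>x. 0 \<le> x \<bullet> (X *v x))"

definition pd_mat :: "real^'n^'n \<Rightarrow> bool" where
  "pd_mat X \<longleftrightarrow> sym_mat X \<and> (\<forall>x. x \<noteq> 0 \<longrightarrow> 0 < x \<bullet> (X *v x))"

abbreviation LI :: "real measure" where
  "LI \<equiv> lebesgue_on {0..1}"

abbreviation LII :: "(real \<times> real) measure" where
  "LII \<equiv> LI \<Otimes>\<^sub>M LI"

text \<open>The Euclidean norm of \<^typ>\<open>real^'n^'m\<close> is the Frobenius norm.\<close>

definition L2 :: "'a measure \<Rightarrow> ('a \<Rightarrow> 'b::euclidean_space) set" where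
  "L2 M = {f \<in> borel_measurable M. integrable M (\<lambda>x. (norm (f x))\<^sup>2)}"

text \<open>Only meaningful on \<^const>\<open>L2\<close> (the Bochner integral of a non-integrable function is 0).\<close>

definition L2norm :: "'a measure \<Rightarrow> ('a \<Rightarrow> 'b::euclidean_space) \<Rightarrow> real" where
  "L2norm M f = sqrt (\<integral>x. (norm (f x))\<^sup>2 \<partial>M)"

text \<open>\<open>C1_L2 M S f f'\<close>: the map \<open>f\<close> from \<open>S\<close> to the Banach space \<open>L\<^sup>2(M)\<close> is continuously
  differentiable on \<open>S\<close> (one-sided at end points) with derivative \<open>f'\<close>. Elements of
  \<open>L\<^sup>2(M)\<close> are represented by functions; all limits are limits in \<open>L\<^sup>2\<close>-norm.\<close>

definition C1_L2 ::
  "'a measure \<Rightarrow> real set \<Rightarrow> (real \<Rightarrow> 'a \<Rightarrow> 'b::euclidean_space) \<Rightarrow> (real \<Rightarrow> 'a \<Rightarrow> 'b) \<Rightarrow> bool" where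
  "C1_L2 M S f f' \<longleftrightarrow> (\<forall>t\<in>S. f t \<in> L2 M \<and> f' t \<in> L2 M \<and>
     ((\<lambda>s. L2norm M (\<lambda>x. (f s x - f t x) /\<^sub>R (s - t) - f' t x)) \<longlongrightarrow> 0) (at t within S) \<and>
     ((\<lambda>s. L2norm M (\<lambda>x. f' s x - f' t x)) \<longlongrightarrow> 0) (at t within S))"

section \<open>Coefficients and coefficient maps\<close>

text \<open>The suffixes \<open>b\<close>, \<open>t\<close>, \<open>c\<close> stand for bar, tilde and check: \<open>cAb\<close> is \<open>A\<close>-bar,
  \<open>cQc\<close> is \<open>Q\<close>-check. Below, \<open>Pib\<close> is \<open>\<Pi>\<close>-bar and \<open>Pi0\<close> is \<open>\<Pi>\<close>, always
  instantiated to \<open>Pib - P\<close>.\<close>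

record ('d, 'm) lq_data =
  cb :: "real^'d"
  csigma :: "real^'d"
  cA :: "real^'d^'d"
  cAb :: "real^'d^'d"
  cAt :: "real^'d^'d"
  cC :: "real^'d^'d"
  cCb :: "real^'d^'d"
  cCt :: "real^'d^'d"
  cB :: "real^'m^'d"
  cD :: "real^'m^'d"
  cQ :: "real^'d^'d"
  cQb :: "real^'d^'d"
  cQc :: "real^'d^'d"
  cQt :: "real^'d^'d"
  cS :: "real^'d^'m"
  cR :: "real^'m^'m"
  cG :: "real \<Rightarrow> real \<Rightarrow> real"

definition admissible_data :: "('d::finite, 'm::finite) lq_data \<Rightarrow> bool" where
  "admissible_data c \<longleftrightarrow> psd_mat (cQ c) \<and> psd_mat (cQb c) \<and> psd_mat (cQc c) \<and> pd_mat (cR c) \<and>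
     case_prod (cG c) \<in> L2 LII"

definition Q_map :: "('d::finite, 'm::finite) lq_data \<Rightarrow> real^'d^'d \<Rightarrow> real^'d^'d" where
  "Q_map c P = transpose (cA c) ** P + P ** cA c + transpose (cC c) ** P ** cC c + cQ c"

definition Qhat_map :: "('d::finite, 'm::finite) lq_data \<Rightarrow> real^'d^'d \<Rightarrow> real^'d^'d \<Rightarrow> real^'d^'d" where
  "Qhat_map c P Pi0 = transpose (cA c + cAb c) ** (P + Pi0) + (P + Pi0) ** (cA c + cAb c)
     + transpose (cC c + cCb c) ** P ** (cC c + cCb c) + cQ c + cQb c"

definition M_map :: "('d::finite, 'm::finite) lq_data \<Rightarrow> real^'d^'d \<Rightarrow> real^'d^'m" where
  "M_map c P = transpose (cB c) ** P + transpose (cD c) ** P ** cC c + cS c"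

definition Mhat_map :: "('d::finite, 'm::finite) lq_data \<Rightarrow> real^'d^'d \<Rightarrow> real^'d^'d \<Rightarrow> real^'d^'m" where
  "Mhat_map c P Pi0 =
     transpose (cB c) ** (P + Pi0) + transpose (cD c) ** P ** (cC c + cCb c) + cS c"

definition R_map :: "('d::finite, 'm::finite) lq_data \<Rightarrow> real^'d^'d \<Rightarrow> real^'m^'m" where
  "R_map c P = cR c + transpose (cD c) ** P ** cD c"

definition Upsilon_map :: "('d::finite, 'm::finite) lq_data \<Rightarrow> real^'d^'d
    \<Rightarrow> (real \<Rightarrow> real \<Rightarrow> real^'d^'d) \<Rightarrow> real \<Rightarrow> real \<Rightarrow> real^'d^'m" where
  "Upsilon_map c P L u v =
     transpose (cB c) ** L u v + cG c u v *\<^sub>R (transpose (cD c) ** P ** cCt c)"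

definition Gamma_map :: "('d::finite, 'm::finite) lq_data \<Rightarrow> real^'d^'d
    \<Rightarrow> (real \<Rightarrow> real^'d) \<Rightarrow> real \<Rightarrow> real^'m" where
  "Gamma_map c P p u = (transpose (cD c) ** P) *v csigma c + transpose (cB c) *v p u"

definition Psi1_map :: "('d::finite, 'm::finite) lq_data \<Rightarrow> real^'d^'d \<Rightarrow> real^'d^'d
    \<Rightarrow> (real \<Rightarrow> real \<Rightarrow> real^'d^'d) \<Rightarrow> real \<Rightarrow> real \<Rightarrow> real^'d^'d" where
  "Psi1_map c P Pi0 L u v =
       cG c u v *\<^sub>R ((P + Pi0) ** cAt c)
     + cG c v u *\<^sub>R (transpose (cAt c) ** (P + Pi0))
     + cG c u v *\<^sub>R (transpose (cC c + cCb c) ** P ** cCt c)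
     + cG c v u *\<^sub>R (transpose (cCt c) ** P ** (cC c + cCb c))
     + (\<integral>w. (cG c w u * cG c w v) *\<^sub>R (transpose (cCt c) ** P ** cCt c) \<partial>LI)
     + transpose (cA c + cAb c) ** L u v
     + transpose (L v u) ** (cA c + cAb c)
     + (\<integral>w. cG c w v *\<^sub>R (transpose (L w u) ** cAt c) \<partial>LI)
     + (\<integral>w. cG c w u *\<^sub>R (transpose (cAt c) ** L w v) \<partial>LI)
     + cG c u v *\<^sub>R cQt c
     + (\<integral>w. (cG c w u * cG c w v) *\<^sub>R cQc c \<partial>LI)"

definition Psi2_map :: "('d::finite, 'm::finite) lq_data \<Rightarrow> real^'d^'d \<Rightarrow> real^'d^'d
    \<Rightarrow> (real \<Rightarrow> real \<Rightarrow> real^'d^'d) \<Rightarrow> (real \<Rightarrow> real^'d) \<Rightarrow> real \<Rightarrow> real^'d" where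
  "Psi2_map c P Pi0 L p u =
       transpose (cA c + cAb c) *v p u
     + transpose (cAt c) *v (\<integral>v. cG c v u *\<^sub>R p v \<partial>LI)
     + (P + Pi0) *v cb c
     + (transpose (cC c + cCb c) ** P) *v csigma c
     + transpose (cCt c) *v (\<integral>v. cG c v u *\<^sub>R (P *v csigma c) \<partial>LI)
     + (\<integral>v. ((1/2) *\<^sub>R (L u v + transpose (L v u))) *v cb c \<partial>LI)"

definition F_map :: "('d::finite, 'm::finite) lq_data \<Rightarrow> real^'d^'d \<Rightarrow> real^'d^'d
    \<Rightarrow> (real \<Rightarrow> real \<Rightarrow> real^'d^'d) \<Rightarrow> real \<Rightarrow> real \<Rightarrow> real^'d^'d" where
  "F_map c P Pi0 L u v =
       Psi1_map c P Pi0 L u v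
     - transpose (Mhat_map c P Pi0) ** matrix_inv (R_map c P) ** Upsilon_map c P L u v
     - transpose (Upsilon_map c P L v u) ** matrix_inv (R_map c P) ** Mhat_map c P Pi0
     - (\<integral>w. transpose (Upsilon_map c P L w u) ** matrix_inv (R_map c P)
              ** Upsilon_map c P L w v \<partial>LI)"

definition Ft_map :: "('d::finite, 'm::finite) lq_data \<Rightarrow> real^'d^'d \<Rightarrow> real^'d^'d
    \<Rightarrow> (real \<Rightarrow> real \<Rightarrow> real^'d^'d) \<Rightarrow> (real \<Rightarrow> real^'d) \<Rightarrow> real \<Rightarrow> real^'d" where
  "Ft_map c P Pi0 L p u =
       Psi2_map c P Pi0 L p u
     - (transpose (Mhat_map c P Pi0) ** matrix_inv (R_map c P)) *v Gamma_map c P p u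
     - (\<integral>v. (transpose (Upsilon_map c P L v u) ** matrix_inv (R_map c P))
              *v Gamma_map c P p v \<partial>LI)"

text \<open>The affine part \<open>\<theta>\<close> of the feedback: \<open>\<theta>(u) = - R(P)\<^sup>-\<^sup>1 \<Gamma>(P, p)(u)\<close>.\<close>

definition theta_map :: "('d::finite, 'm::finite) lq_data \<Rightarrow> real^'d^'d
    \<Rightarrow> (real \<Rightarrow> real^'d) \<Rightarrow> real \<Rightarrow> real^'m" where
  "theta_map c P p u = - (matrix_inv (R_map c P) *v Gamma_map c P p u)"

section \<open>Finite-horizon equations on \<open>[0,T]\<close>\<close>

definition solves_P_eq ::
  "('d::finite, 'm::finite) lq_data \<Rightarrow> real \<Rightarrow> (real \<Rightarrow> real^'d^'d) \<Rightarrow> bool" where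
  "solves_P_eq c T P \<longleftrightarrow> (\<forall>t\<in>{0..T}. psd_mat (P t)) \<and> P T = 0 \<and>
     (\<exists>P'. continuous_on {0..T} P' \<and>
       (\<forall>t\<in>{0..T}. (P has_vector_derivative P' t) (at t within {0..T}) \<and>
          P' t + Q_map c (P t)
            - transpose (M_map c (P t)) ** matrix_inv (R_map c (P t)) ** M_map c (P t) = 0))"

definition solves_Pib_eq :: "('d::finite, 'm::finite) lq_data \<Rightarrow> real
    \<Rightarrow> (real \<Rightarrow> real^'d^'d) \<Rightarrow> (real \<Rightarrow> real^'d^'d) \<Rightarrow> bool" where
  "solves_Pib_eq c T P Pib \<longleftrightarrow> (\<forall>t\<in>{0..T}. psd_mat (Pib t)) \<and> Pib T = 0 \<and>
     (\<exists>Pib'. continuous_on {0..T} Pib' \<and>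
       (\<forall>t\<in>{0..T}. (Pib has_vector_derivative Pib' t) (at t within {0..T}) \<and>
          Pib' t + Qhat_map c (P t) (Pib t - P t)
            - transpose (Mhat_map c (P t) (Pib t - P t)) ** matrix_inv (R_map c (P t))
                ** Mhat_map c (P t) (Pib t - P t) = 0))"

definition solves_Lam_eq :: "('d::finite, 'm::finite) lq_data \<Rightarrow> real
    \<Rightarrow> (real \<Rightarrow> real^'d^'d) \<Rightarrow> (real \<Rightarrow> real^'d^'d)
    \<Rightarrow> (real \<Rightarrow> real \<Rightarrow> real \<Rightarrow> real^'d^'d) \<Rightarrow> bool" where
  "solves_Lam_eq c T P Pib L \<longleftrightarrow> (AE (u, v) in LII. L T u v = 0) \<and>
     (\<exists>L'. C1_L2 LII {0..T} (\<lambda>t. case_prod (L t)) (\<lambda>t. case_prod (L' t)) \<and>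
       (\<forall>t\<in>{0..T}. AE (u, v) in LII.
          L' t u v + F_map c (P t) (Pib t - P t) (L t) u v = 0))"

definition solves_p_eq :: "('d::finite, 'm::finite) lq_data \<Rightarrow> real
    \<Rightarrow> (real \<Rightarrow> real^'d^'d) \<Rightarrow> (real \<Rightarrow> real^'d^'d)
    \<Rightarrow> (real \<Rightarrow> real \<Rightarrow> real \<Rightarrow> real^'d^'d) \<Rightarrow> (real \<Rightarrow> real \<Rightarrow> real^'d) \<Rightarrow> bool" where
  "solves_p_eq c T P Pib L p \<longleftrightarrow> (AE u in LI. p T u = 0) \<and>
     (\<exists>p'. C1_L2 LI {0..T} p p' \<and>
       (\<forall>t\<in>{0..T}. AE u in LI.
          p' t u + Ft_map c (P t) (Pib t - P t) (L t) (p t) u = 0))"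

section \<open>Algebraic system\<close>

definition solves_alg_riccati ::
  "('d::finite, 'm::finite) lq_data \<Rightarrow> real^'d^'d \<Rightarrow> real^'d^'d \<Rightarrow> bool" where
  "solves_alg_riccati c P Pib \<longleftrightarrow> pd_mat P \<and> pd_mat Pib \<and>
     Q_map c P - transpose (M_map c P) ** matrix_inv (R_map c P) ** M_map c P = 0 \<and>
     Qhat_map c P (Pib - P)
       - transpose (Mhat_map c P (Pib - P)) ** matrix_inv (R_map c P)
           ** Mhat_map c P (Pib - P) = 0"

definition solves_alg_Lam_p :: "('d::finite, 'm::finite) lq_data \<Rightarrow> real^'d^'d \<Rightarrow> real^'d^'d
    \<Rightarrow> (real \<Rightarrow> real \<Rightarrow> real^'d^'d) \<Rightarrow> (real \<Rightarrow> real^'d) \<Rightarrow> bool" where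
  "solves_alg_Lam_p c P Pib L p \<longleftrightarrow>
     case_prod L \<in> L2 LII \<and> p \<in> L2 LI \<and>
     (\<forall>\<phi>\<in>L2 LI. 0 \<le> (\<integral>u. (\<integral>v. \<phi> u \<bullet> (L u v *v \<phi> v) \<partial>LI) \<partial>LI)) \<and>
     (AE (u, v) in LII. F_map c P (Pib - P) L u v = 0) \<and>
     (AE u in LI. Ft_map c P (Pib - P) L p u = 0)"

text \<open>\<open>LamT T\<close> is the solution of the \<open>\<Lambda>\<close>-equation with horizon \<open>T\<close>.\<close>

definition algebraic_solvability :: "('d::finite, 'm::finite) lq_data
    \<Rightarrow> real^'d^'d \<Rightarrow> real^'d^'d \<Rightarrow> (real \<Rightarrow> real \<Rightarrow> real \<Rightarrow> real \<Rightarrow> real^'d^'d) \<Rightarrow> bool" where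
  "algebraic_solvability c P Pib LamT \<longleftrightarrow>
     (\<exists>L p. solves_alg_Lam_p c P Pib L p \<and>
        (\<forall>L1 p1. solves_alg_Lam_p c P Pib L1 p1 \<longrightarrow>
           (AE (u, v) in LII. L1 u v = L u v) \<and> (AE u in LI. p1 u = p u)) \<and>
        (\<forall>t\<ge>0. ((\<lambda>T. L2norm LII (\<lambda>(u, v). LamT T t u v - L u v)) \<longlongrightarrow> 0) at_top))"

definition positivity_cond :: "('d::finite, 'm::finite) lq_data \<Rightarrow> bool" where
  "positivity_cond c \<longleftrightarrow>
     pd_mat (cQ c - transpose (cS c) ** matrix_inv (cR c) ** cS c) \<and>
     pd_mat (cQ c + cQb c - transpose (cS c) ** matrix_inv (cR c) ** cS c) \<and>
     psd_mat (cQc c) \<and>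
     (\<forall>\<phi>\<in>L2 LI. 0 \<le> (\<integral>u. (\<integral>v. \<phi> u \<bullet> ((cG c u v *\<^sub>R cQt c) *v \<phi> v) \<partial>LI) \<partial>LI))"

section \<open>Wasserstein space\<close>

text \<open>\<open>P2 S\<close>: Borel probability measures carried by \<open>S\<close> with finite second moment.\<close>

definition P2 :: "'a::metric_space set \<Rightarrow> 'a measure set" where
  "P2 S = {\<mu>. sets \<mu> = sets borel \<and> prob_space \<mu> \<and> (AE x in \<mu>. x \<in> S) \<and>
     (\<exists>x0. (\<integral>\<^sup>+x. ennreal ((dist x x0)\<^sup>2) \<partial>\<mu>) < \<infinity>)}"

definition couplings :: "'a::metric_space measure \<Rightarrow> 'a measure \<Rightarrow> ('a \<times> 'a) measure set" where
  "couplings \<mu> \<nu> = {\<pi>. sets \<pi> = sets borel \<and> distr \<pi> borel fst = \<mu> \<and> distr \<pi> borel snd = \<nu>}"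

definition W2 :: "'a::metric_space measure \<Rightarrow> 'a measure \<Rightarrow> real" where
  "W2 \<mu> \<nu> = sqrt (enn2real
     (INF \<pi>\<in>couplings \<mu> \<nu>. \<integral>\<^sup>+z. ennreal ((dist (fst z) (snd z))\<^sup>2) \<partial>\<pi>))"

text \<open>\<open>C([0,T]; \<real>)\<close> is embedded isometrically into the bounded continuous functions on \<open>\<real>\<close>
  by extending paths constantly to the left of \<open>0\<close> and to the right of \<open>T\<close>.\<close>

definition path_space :: "real \<Rightarrow> (real \<Rightarrow>\<^sub>C real) set" where
  "path_space T =
     {f. \<forall>s. apply_bcontfun f s = apply_bcontfun f (min (max 0 s) T)}"

text \<open>\<open>stopped_path T t w\<close> is the path \<open>w(\<cdot> \<and> t)\<close> on \<open>[0,T]\<close>.\<close>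

definition stopped_path :: "real \<Rightarrow> real \<Rightarrow> (real \<Rightarrow> real) \<Rightarrow> (real \<Rightarrow>\<^sub>C real)" where
  "stopped_path T t w = Bcontfun (\<lambda>s. w (min (min (max 0 s) T) t))"

section \<open>Probabilistic setup\<close>

text \<open>Independence of two random variables; unlike \<^const>\<open>prob_space.indep_var\<close>, their values may
  have different types.\<close>

definition indep_rvs :: "'w measure \<Rightarrow> 'a measure \<Rightarrow> ('w \<Rightarrow> 'a) \<Rightarrow> 'b measure \<Rightarrow> ('w \<Rightarrow> 'b) \<Rightarrow> bool" where
  "indep_rvs M N X N' Y \<longleftrightarrow> X \<in> measurable M N \<and> Y \<in> measurable M N' \<and>
     prob_space.indep_set M {X -` E \<inter> space M | E. E \<in> sets N} {Y -` E \<inter> space M | E. E \<in> sets N'}"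

definition brownian_motion :: "'w measure \<Rightarrow> (real \<Rightarrow> 'w \<Rightarrow> real) \<Rightarrow> bool" where
  "brownian_motion M B \<longleftrightarrow>
     (\<forall>t\<ge>0. B t \<in> borel_measurable M) \<and>
     (AE \<omega> in M. B 0 \<omega> = 0) \<and>
     (AE \<omega> in M. continuous_on {0..} (\<lambda>t. B t \<omega>)) \<and>
     (\<forall>s t. 0 \<le> s \<and> s < t \<longrightarrow>
        distributed M lborel (\<lambda>\<omega>. B t \<omega> - B s \<omega>)
          (\<lambda>x. ennreal (normal_density 0 (sqrt (t - s)) x)) \<and>
        indep_rvs M
          (PiM {0..s} (\<lambda>_. borel)) (\<lambda>\<omega>. \<lambda>r\<in>{0..s}. B r \<omega>)
          borel (\<lambda>\<omega>. B t \<omega> - B s \<omega>))"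

definition prob_setup ::
  "'w measure \<Rightarrow> (real \<Rightarrow> real \<Rightarrow> 'w \<Rightarrow> real) \<Rightarrow> (real \<Rightarrow> 'w \<Rightarrow> real) \<Rightarrow> bool" where
  "prob_setup M W \<zeta> \<longleftrightarrow> prob_space M \<and> complete_measure M \<and>
     (\<forall>u\<in>{0..1}. brownian_motion M (W u) \<and>
        distributed M lborel (\<zeta> u) (indicator {0<..<1}) \<and>
        indep_rvs M
          (PiM {0..} (\<lambda>_. borel)) (\<lambda>\<omega>. \<lambda>t\<in>{0..}. W u t \<omega>) borel (\<zeta> u)) \<and>
     prob_space.indep_vars M (\<lambda>_. PiM {0..} (\<lambda>_. borel) \<Otimes>\<^sub>M borel)
       (\<lambda>u \<omega>. (\<lambda>t\<in>{0..}. W u t \<omega>, \<zeta> u \<omega>)) {0..1}"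

text \<open>The filtration generated by a process \<open>B\<close>, a random variable \<open>z\<close> and the null sets.\<close>

definition filt :: "'w measure \<Rightarrow> (real \<Rightarrow> 'w \<Rightarrow> real) \<Rightarrow> ('w \<Rightarrow> real) \<Rightarrow> real \<Rightarrow> 'w measure" where
  "filt M B z t = sigma (space M)
     ({B s -` E \<inter> space M | s E. 0 \<le> s \<and> s \<le> t \<and> E \<in> sets borel}
      \<union> {z -` E \<inter> space M | E. E \<in> sets borel} \<union> null_sets M)"

definition initial_law :: "'w measure \<Rightarrow> real \<Rightarrow> (real \<Rightarrow> 'w \<Rightarrow> real) \<Rightarrow> ('w \<Rightarrow> real)
    \<Rightarrow> ('w \<Rightarrow> real^'d) \<Rightarrow> ((real \<Rightarrow>\<^sub>C real) \<times> real \<times> (real^'d::finite)) measure" where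
  "initial_law M T B z x =
     distr M borel (\<lambda>\<omega>. (stopped_path T 0 (\<lambda>s. B s \<omega>), z \<omega>, x \<omega>))"

text \<open>Measurability of \<open>u \<mapsto> Law\<close> is with respect to the Borel sets of the 2-Wasserstein
  topology. The last integral is an integral over \<open>u\<close> of an expectation, so no joint
  measurability of \<open>\<xi>\<close> in \<open>(u, \<omega>)\<close> is involved.\<close>

definition L20 :: "'w measure \<Rightarrow> (real \<Rightarrow> real \<Rightarrow> 'w \<Rightarrow> real) \<Rightarrow> (real \<Rightarrow> 'w \<Rightarrow> real)
    \<Rightarrow> (real \<Rightarrow> 'w \<Rightarrow> real^'d::finite) set" where
  "L20 M W \<zeta> = {\<xi>.
     (\<forall>u\<in>{0..1}. \<xi> u \<in> borel_measurable (filt M (W u) (\<zeta> u) 0)) \<and>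
     (\<forall>T>0. let S = path_space T \<times> {0<..<1} \<times> UNIV;
                law = (\<lambda>u. initial_law M T (W u) (\<zeta> u) (\<xi> u)) in
        (\<forall>u\<in>{0..1}. law u \<in> P2 S) \<and>
        (\<forall>U. openin (Metric_space.mtopology (P2 S) W2) U \<longrightarrow>
           {u\<in>{0..1}. law u \<in> U} \<in> sets LI)) \<and>
     (\<integral>\<^sup>+u. (\<integral>\<^sup>+\<omega>. ennreal ((norm (\<xi> u \<omega>))\<^sup>2) \<partial>M) \<partial>LI) < \<infinity>}"

section \<open>Ito integral\<close>

text \<open>The simple process \<open>\<Sum>i<n. \<eta> i 1\<^bsub>(\<tau> i, \<tau> (i+1)]\<^esub>\<close> on \<open>[0,t]\<close> with \<open>\<eta> i\<close> bounded and
  \<open>F (\<tau> i)\<close>-measurable, and its stochastic integral with respect to \<open>B\<close>.\<close>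

definition simple_process :: "'w measure \<Rightarrow> (real \<Rightarrow> 'w measure) \<Rightarrow> real
    \<Rightarrow> nat \<Rightarrow> (nat \<Rightarrow> real) \<Rightarrow> (nat \<Rightarrow> 'w \<Rightarrow> 'b::euclidean_space) \<Rightarrow> bool" where
  "simple_process M F t n \<tau> \<eta> \<longleftrightarrow>
     (\<forall>i\<le>n. 0 \<le> \<tau> i \<and> \<tau> i \<le> t) \<and> (\<forall>i<n. \<tau> i \<le> \<tau> (Suc i)) \<and>
     (\<forall>i<n. \<eta> i \<in> borel_measurable (F (\<tau> i)) \<and> (\<exists>K. \<forall>\<omega>\<in>space M. norm (\<eta> i \<omega>) \<le> K))"

definition simple_value :: "nat \<Rightarrow> (nat \<Rightarrow> real) \<Rightarrow> (nat \<Rightarrow> 'w \<Rightarrow> 'b::euclidean_space)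
    \<Rightarrow> real \<Rightarrow> 'w \<Rightarrow> 'b" where
  "simple_value n \<tau> \<eta> s \<omega> = (\<Sum>i<n. indicat_real {\<tau> i<..\<tau> (Suc i)} s *\<^sub>R \<eta> i \<omega>)"

definition simple_integral :: "(real \<Rightarrow> 'w \<Rightarrow> real) \<Rightarrow> nat \<Rightarrow> (nat \<Rightarrow> real)
    \<Rightarrow> (nat \<Rightarrow> 'w \<Rightarrow> 'b::euclidean_space) \<Rightarrow> 'w \<Rightarrow> 'b" where
  "simple_integral B n \<tau> \<eta> \<omega> = (\<Sum>i<n. (B (\<tau> (Suc i)) \<omega> - B (\<tau> i) \<omega>) *\<^sub>R \<eta> i \<omega>)"

text \<open>\<open>Y\<close> is (a version of) the Ito integral of \<open>H\<close> over \<open>[0,t]\<close> with respect to \<open>B\<close>: there are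
  simple processes converging to \<open>H\<close> in \<open>L\<^sup>2(dP ds)\<close> whose integrals converge to \<open>Y\<close>
  in \<open>L\<^sup>2(dP)\<close>.\<close>

definition has_ito_integral :: "'w measure \<Rightarrow> (real \<Rightarrow> 'w measure) \<Rightarrow> (real \<Rightarrow> 'w \<Rightarrow> real) \<Rightarrow> real
    \<Rightarrow> (real \<Rightarrow> 'w \<Rightarrow> 'b::euclidean_space) \<Rightarrow> ('w \<Rightarrow> 'b) \<Rightarrow> bool" where
  "has_ito_integral M F B t H Y \<longleftrightarrow> Y \<in> borel_measurable M \<and>
     (\<exists>n \<tau> \<eta>. (\<forall>k. simple_process M F t (n k) (\<tau> k) (\<eta> k)) \<and>
        (\<lambda>k::nat. \<integral>\<^sup>+\<omega>. (\<integral>\<^sup>+s\<in>{0..t}.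
            ennreal ((norm (H s \<omega> - simple_value (n k) (\<tau> k) (\<eta> k) s \<omega>))\<^sup>2) \<partial>lborel) \<partial>M)
          \<longlonglongrightarrow> 0 \<and>
        (\<lambda>k. \<integral>\<^sup>+\<omega>. ennreal ((norm (Y \<omega> - simple_integral B (n k) (\<tau> k) (\<eta> k) \<omega>))\<^sup>2) \<partial>M)
          \<longlonglongrightarrow> 0)"

text \<open>Strong solution on \<open>[0,\<infinity>)\<close> of \<open>dX = E X dt + H X dB\<close>, \<open>X(0) = x\<close>.\<close>

definition solves_linear_sde :: "'w measure \<Rightarrow> (real \<Rightarrow> 'w measure) \<Rightarrow> (real \<Rightarrow> 'w \<Rightarrow> real)
    \<Rightarrow> real^'d^'d \<Rightarrow> real^'d^'d \<Rightarrow> ('w \<Rightarrow> real^'d::finite) \<Rightarrow> (real \<Rightarrow> 'w \<Rightarrow> real^'d) \<Rightarrow> bool" where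
  "solves_linear_sde M F B E H x X \<longleftrightarrow>
     (\<forall>t\<ge>0. X t \<in> borel_measurable (F t)) \<and>
     (AE \<omega> in M. continuous_on {0..} (\<lambda>t. X t \<omega>)) \<and>
     (AE \<omega> in M. X 0 \<omega> = x \<omega>) \<and>
     (\<forall>t\<ge>0. \<exists>Y. has_ito_integral M F B t (\<lambda>s \<omega>. H *v X s \<omega>) Y \<and>
        (AE \<omega> in M. X t \<omega> = x \<omega> + (LINT s:{0..t}|lborel. E *v X s \<omega>) + Y \<omega>))"

section \<open>Stabilizability\<close>

definition solves_mean_ode :: "('d::finite, 'm::finite) lq_data \<Rightarrow> real^'d^'m
    \<Rightarrow> (real \<Rightarrow> real \<Rightarrow> real^'d^'m) \<Rightarrow> (real \<Rightarrow> real^'d) \<Rightarrow> (real \<Rightarrow> real \<Rightarrow> real^'d) \<Rightarrow> bool" where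
  "solves_mean_ode c Thb Tht x X \<longleftrightarrow> (AE u in LI. X 0 u = x u) \<and>
     (\<exists>X'. C1_L2 LI {0..} X X' \<and>
       (\<forall>t\<ge>0. AE u in LI.
          X' t u = (cA c + cAb c + cB c ** Thb) *v X t u
            + (\<integral>v. (cG c u v *\<^sub>R cAt c + cB c ** Tht u v) *v X t v \<partial>LI)))"

text \<open>In the second part, \<open>X u t \<omega>\<close> is only meaningful as a process for each fixed \<open>u\<close>: the
  processes are independent in \<open>u\<close>, so \<open>(u, \<omega>) \<mapsto> X u t \<omega>\<close> is in general not jointly
  measurable. The expectation of the integral over \<open>I\<close> is therefore read as the integral
  over \<open>I\<close> of the expectation.\<close>

definition stabilizability_cond :: "('d::finite, 'm::finite) lq_data \<Rightarrow> 'w measure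
    \<Rightarrow> (real \<Rightarrow> real \<Rightarrow> 'w \<Rightarrow> real) \<Rightarrow> (real \<Rightarrow> 'w \<Rightarrow> real) \<Rightarrow> bool" where
  "stabilizability_cond c M W \<zeta> \<longleftrightarrow>
     (\<exists>Thb Tht. case_prod Tht \<in> L2 LII \<and>
        (\<forall>\<xi>\<in>L20 M W \<zeta>. \<forall>X. solves_mean_ode c Thb Tht (\<lambda>u. \<integral>\<omega>. \<xi> u \<omega> \<partial>M) X \<longrightarrow>
           (\<integral>\<^sup>+t\<in>{0..}. (\<integral>\<^sup>+u. ennreal ((norm (X t u))\<^sup>2) \<partial>LI) \<partial>lborel) < \<infinity>)) \<and>
     (\<exists>Th. \<forall>\<xi>\<in>L20 M W \<zeta>. \<forall>X.
        (\<forall>u\<in>{0..1}. solves_linear_sde M (filt M (W u) (\<zeta> u)) (W u)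
           (cA c + cB c ** Th) (cC c + cD c ** Th) (\<xi> u) (X u)) \<longrightarrow>
        (\<integral>\<^sup>+u. (\<integral>\<^sup>+\<omega>. (\<integral>\<^sup>+t\<in>{0..}. ennreal ((norm (X u t \<omega>))\<^sup>2) \<partial>lborel) \<partial>M) \<partial>LI) < \<infinity>)"

end

theory Submission
  imports Defs
begin

text \<open>
  Write \<open>s = T - t\<close>. Adding the equations for \<open>\<Pi>\<close>-bar and \<open>\<Lambda>\<close> gives one Riccati equation on
  \<open>L\<^sup>2(I)\<close> for the operator \<open>X = \<Pi>\<close>-bar \<open>+ \<Lambda>\<close>. Its right-hand side is a minimum over feedbacks of
  expressions affine in \<open>(X, P)\<close>, hence concave; it vanishes at the algebraic solution and is at
  least \<open>\<delta>\<close> times the algebraic solution at \<open>0\<close>. Therefore \<open>(1 - e\<^sup>-\<^sup>\<delta>\<^sup>s)\<close> times the algebraic solution is a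
  subsolution, and \<open>P\<^sub>T\<close> and \<open>X\<^sub>T\<close> lie between it and the algebraic solution. The positive terms of the
  cost make the algebraic solution a Lyapunov function of the closed loop. The error \<open>p - p\<^sub>T\<close> solves
  the adjoint closed-loop equation up to terms of size \<open>e\<^sup>-\<^sup>\<delta>\<^sup>s\<close>, so it decays in the dual energy norm.
\<close>


section \<open>Dini inequalities and comparison of quadratic forms\<close>

text \<open>The factor phi = 1 - e^(-\<delta> s) solves phi' = \<delta> (1 - phi), phi(0) = 0: by
  concavity the Riccati form at phi times the algebraic solution is at least 1 - phi times the
  running cost, hence at least phi' times that solution. The positivity condition makes the cost
  coercive; \<open>\<delta>\<close> is the coercivity constant over the norm of the algebraic
  solution. Since \<open>P\<close> enters the equation for \<open>X\<close>, it is enclosed first,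
  with the same \<open>\<delta>\<close>. Infinite dimension shapes the rest. Extremal vectors of a
  form need not exist, so order between operators is propagated through suprema and one-sided
  difference quotients. The equations are used weakly, tested against x, so that adjoints act on the
  test vector. Neither \<open>\<Lambda>\<close> nor its finite-horizon version is assumed symmetric;
  symmetry is derived before quadratic forms are compared. The final constants come from the limit
  objects and from a bound on the inverse of R(P) uniform over all P \<ge> 0, and therefore do not
  depend on T.\<close>

lemma dini_nonpos:
  fixes f :: "real \<Rightarrow> real"
  assumes cont: "continuous_on {a..b} f" and fa: "f a \<le> 0" and K: "K \<ge> 0"
    and step: "\<And>s. a \<le> s \<Longrightarrow> s < b \<Longrightarrow> f s > 0 \<Longrightarrow>
      \<forall>\<^sub>F h in at_right 0. f (s + h) \<le> (1 + K * h) * f s"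
    and t: "t \<in> {a..b}"
  shows "f t \<le> 0"
proof (rule ccontr)
  assume "\<not> f t \<le> 0"
  then have ft: "f t > 0" by simp
  then have at: "a < t" using fa t by (metis atLeastAtMost_iff not_less order_le_less)
  \<comment> \<open>Half of the value that would make \<open>g t\<close> vanish. The barrier is
    strictly positive, so \<open>f\<close> is positive at the last contact, which is where
    \<open>step\<close> is applied.\<close>
  define \<epsilon> where "\<epsilon> = f t / (2 * exp (K * (t - a)))"
  have \<epsilon>: "\<epsilon> > 0" using ft by (simp add: \<epsilon>_def)
  define g where "g s = f s - \<epsilon> * exp (K * (s - a))" for s
  have gt: "g t > 0" using ft by (simp add: g_def \<epsilon>_def)
  have contg: "continuous_on {a..t} g"
    unfolding g_def using t by (intro continuous_intros continuous_on_subset[OF cont]) auto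
  define S where "S = {s \<in> {a..t}. g s \<le> 0}"
  have aS: "a \<in> S" using at fa \<epsilon> by (auto simp: S_def g_def)
  have clS: "closed S"
    unfolding S_def by (intro continuous_on_closed_Collect_le contg continuous_on_const closed_atLeastAtMost)
  have bdd: "bdd_above S" by (auto simp: S_def intro!: bdd_aboveI[of _ t])
  \<comment> \<open>The last time at which \<open>f\<close> does not exceed the barrier. After it
    \<open>g\<close> is positive, but one step from it keeps \<open>g \<le> 0\<close>, because 1 + K
    h \<le> e^(K h).\<close>
  define s0 where "s0 = Sup S"
  have s0S: "s0 \<in> S" unfolding s0_def
    by (rule closed_contains_Sup) (use aS bdd clS in auto)
  then have s0: "a \<le> s0" "s0 < t" and gs0: "g s0 \<le> 0"
    using gt by (auto simp: S_def order.strict_iff_order)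
  have pos: "g s > 0" if "s0 < s" "s \<le> t" for s
  proof (rule ccontr)
    assume "\<not> g s > 0"
    then have "s \<in> S" using that s0 by (simp add: S_def)
    from cSup_upper[OF this bdd] that show False by (simp add: s0_def)
  qed
  have lim: "(g \<longlongrightarrow> g s0) (at_right s0)"
  proof -
    have "(g \<longlongrightarrow> g s0) (at s0 within {a..t})"
      using contg s0 by (auto simp: continuous_on_def)
    then have "(g \<longlongrightarrow> g s0) (at s0 within {s0..t})"
      by (rule tendsto_within_subset) (use s0 in auto)
    then show ?thesis using s0 by (simp add: at_within_Icc_at_right)
  qed
  have "\<forall>\<^sub>F s in at_right s0. 0 \<le> g s"
    unfolding eventually_at_right_field using pos s0 less_imp_le by blast
  then have "g s0 \<ge> 0"
    by (rule tendsto_lowerbound[OF lim]) simp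
  with gs0 have "f s0 = \<epsilon> * exp (K * (s0 - a))" by (simp add: g_def)
  then have fs0: "f s0 > 0" using \<epsilon> by simp
  have "\<forall>\<^sub>F h in at_right 0. f (s0 + h) \<le> (1 + K * h) * f s0"
    using step[of s0] s0 t fs0 by auto
  moreover have "\<forall>\<^sub>F h in at_right (0::real). h < t - s0"
    using s0 by (auto simp: eventually_at_right_field intro!: exI[of _ "t - s0"])
  moreover have "\<forall>\<^sub>F h in at_right (0::real). 0 < h"
    by (simp add: eventually_at_right_less)
  ultimately have "\<forall>\<^sub>F h in at_right (0::real). f (s0 + h) \<le> (1 + K * h) * f s0 \<and> h < t - s0 \<and> 0 < h"
    by eventually_elim auto
  then obtain h where h: "f (s0 + h) \<le> (1 + K * h) * f s0" "h < t - s0" "0 < h"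
    using eventually_happens'[OF trivial_limit_at_right_real] by blast
  have "f (s0 + h) \<le> exp (K * h) * f s0"
    by (rule order_trans[OF h(1) mult_right_mono]) (use fs0 exp_ge_add_one_self[of "K * h"] in auto)
  also have "\<dots> = \<epsilon> * exp (K * (s0 + h - a))"
    by (simp add: \<open>f s0 = _\<close> exp_add[symmetric] algebra_simps)
  finally have "g (s0 + h) \<le> 0" by (simp add: g_def)
  with pos[of "s0 + h"] h show False by simp
qed

lemma has_vector_derivative_at_right_remainder:
  fixes f :: "real \<Rightarrow> 'a::real_normed_vector"
  assumes "(f has_vector_derivative f') (at s within {a..b})" "a \<le> s" "s < b" "\<eta> > 0"
  shows "\<forall>\<^sub>F h in at_right 0. norm (f (s + h) - f s - h *\<^sub>R f') \<le> \<eta> * h"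
proof -
  have "(f has_derivative (\<lambda>x. x *\<^sub>R f')) (at s within {a..b})"
    using assms(1) by (simp add: has_vector_derivative_def)
  then obtain d where d: "d > 0"
    "\<And>y. y \<in> {a..b} \<Longrightarrow> norm (y - s) < d \<Longrightarrow> norm (f y - f s - (y - s) *\<^sub>R f') \<le> \<eta> * norm (y - s)"
    using assms(4) unfolding has_derivative_within_alt by metis
  have "norm (f (s + h) - f s - h *\<^sub>R f') \<le> \<eta> * h" if "0 < h" "h < min d (b - s)" for h
    using d(2)[of "s + h"] that assms(2) by auto
  then show ?thesis
    unfolding eventually_at_right_field using d(1) assms(3)
    by (intro exI[of _ "min d (b - s)"]) auto
qed

text \<open>Exchanging \<open>s\<close> and \<open>r\<close> makes the one-sided bound two-sided.
  The one-sided form is what a supremum of functionals supplies, and the lemma is applied to such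
  suprema.\<close>

lemma continuous_on_dominated:
  fixes f :: "'a::metric_space \<Rightarrow> 'b::real_normed_vector" and g :: "'a \<Rightarrow> real"
  assumes "continuous_on S f" and le: "\<And>s r. g s \<le> g r + C * norm (f s - f r)"
  shows "continuous_on S g"
  unfolding continuous_on_def
proof
  fix r assume "r \<in> S"
  then have "(f \<longlongrightarrow> f r) (at r within S)" using assms(1) by (auto simp: continuous_on_def)
  then have "((\<lambda>s. C * norm (f s - f r)) \<longlongrightarrow> C * norm (f r - f r)) (at r within S)"
    by (intro tendsto_intros)
  then have "((\<lambda>s. C * norm (f s - f r)) \<longlongrightarrow> 0) (at r within S)" by simp
  then have "((\<lambda>s. g s - g r) \<longlongrightarrow> 0) (at r within S)"
  proof (rule Lim_null_comparison[rotated], intro always_eventually allI)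
    show "norm (g s - g r) \<le> C * norm (f s - f r)" for s
      using le[of s r] le[of r s] by (simp add: norm_minus_commute abs_le_iff)
  qed
  then show "(g \<longlongrightarrow> g r) (at r within S)" by (simp add: LIM_zero_iff)
qed

lemma inner_blinfun_le:
  fixes Z :: "'h::real_inner \<Rightarrow>\<^sub>L 'h"
  shows "\<bar>inner x (Z y)\<bar> \<le> norm Z * norm x * norm y"
proof -
  have "\<bar>inner x (Z y)\<bar> \<le> norm x * norm (Z y)" by (rule Cauchy_Schwarz_ineq2)
  also have "\<dots> \<le> norm x * (norm Z * norm y)"
    by (intro mult_left_mono norm_blinfun) auto
  finally show ?thesis by (simp add: mult_ac)
qed

text \<open>With \<open>\<mu>(s)\<close> the supremum of \<open>- \<langle>x, Z(s) x\<rangle>\<close> over the unit ball, the step from \<open>s\<close> to \<open>s + h\<close>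
  replaces \<open>x\<close> by \<open>x + h a(x)\<close> up to \<open>o(h)\<close>. This gives a Dini inequality for \<open>\<mu>\<close>.\<close>

lemma form_comparison:
  fixes Z Z' :: "real \<Rightarrow> 'h::real_inner \<Rightarrow>\<^sub>L 'h" and a c :: "real \<Rightarrow> 'h \<Rightarrow> 'h"
  assumes deriv: "\<And>s. s \<in> {0..T} \<Longrightarrow> (Z has_vector_derivative Z' s) (at s within {0..T})"
    and sym: "\<And>s x y. s \<in> {0..T} \<Longrightarrow> inner x (Z s y) = inner (Z s x) y"
    and Z0: "\<And>x. 0 \<le> inner x (Z 0 x)"
    and ineq: "\<And>s x. s \<in> {0..T} \<Longrightarrow>
      2 * inner (a s x) (Z s x) + \<kappa> * inner (c s x) (Z s (c s x)) \<le> inner x (Z' s x)"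
    and a: "\<And>s x. s \<in> {0..T} \<Longrightarrow> norm (a s x) \<le> \<alpha> * norm x"
    and c: "\<And>s x. s \<in> {0..T} \<Longrightarrow> norm (c s x) \<le> \<gamma> * norm x"
    and \<kappa>: "\<kappa> \<ge> 0" and t: "t \<in> {0..T}"
  shows "0 \<le> inner x (Z t x)"
proof -
  define \<alpha>1 where "\<alpha>1 = \<bar>\<alpha>\<bar> + 1"
  have \<alpha>1: "\<alpha>1 > 0" by (simp add: \<alpha>1_def)
  have a1: "norm (a s x) \<le> \<alpha>1 * norm x" if "s \<in> {0..T}" for s x
    using order_trans[OF a[OF that, of x] mult_right_mono[of \<alpha> \<alpha>1 "norm x"]] by (auto simp: \<alpha>1_def)
  define \<mu> where "\<mu> s = (SUP x\<in>{x. norm x \<le> 1}. - inner x (Z s x))" for s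
  have le: "- inner x (Z s x) \<le> norm (Z s)" if "norm x \<le> 1" for s x
  proof -
    have "- inner x (Z s x) \<le> norm (Z s) * norm x * norm x"
      using inner_blinfun_le[of x "Z s" x] by linarith
    also have "\<dots> \<le> norm (Z s) * 1 * 1" using that by (intro mult_mono) auto
    finally show ?thesis by simp
  qed
  have bdd: "bdd_above ((\<lambda>x. - inner x (Z s x)) ` {x. norm x \<le> 1})" for s
    using le by (auto intro!: bdd_aboveI[of _ "norm (Z s)"])
  have \<mu>_upper: "- inner x (Z s x) \<le> \<mu> s" if "norm x \<le> 1" for s x
    unfolding \<mu>_def using that by (intro cSUP_upper bdd) auto
  have \<mu>_nonneg: "0 \<le> \<mu> s" for s using \<mu>_upper[of 0 s] by simp
  have \<mu>_form: "- inner x (Z s x) \<le> \<mu> s * (norm x)\<^sup>2" for s x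
  proof (cases "x = 0")
    case False
    have "- inner (x /\<^sub>R norm x) (Z s (x /\<^sub>R norm x)) \<le> \<mu> s"
      using False by (intro \<mu>_upper) auto
    then show ?thesis using False
      by (simp add: blinfun.scaleR_right field_simps power2_eq_square)
  qed simp
  have \<mu>_least: "\<mu> s \<le> B" if "\<And>x. norm x \<le> 1 \<Longrightarrow> - inner x (Z s x) \<le> B" for s B
    unfolding \<mu>_def using that by (intro cSUP_least) (auto intro!: exI[of _ 0])
  have \<mu>_diff: "\<mu> s \<le> \<mu> r + norm (Z s - Z r)" for s r
  proof (rule \<mu>_least)
    fix x :: 'h assume x: "norm x \<le> 1"
    have "\<bar>inner x ((Z s - Z r) x)\<bar> \<le> norm (Z s - Z r) * norm x * norm x"
      by (rule inner_blinfun_le)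
    also have "\<dots> \<le> norm (Z s - Z r) * 1 * 1" using x by (intro mult_mono) auto
    finally have "- inner x (Z s x) \<le> - inner x (Z r x) + norm (Z s - Z r)"
      by (simp add: blinfun.diff_left inner_diff_right)
    with \<mu>_upper[OF x, of r] show "- inner x (Z s x) \<le> \<mu> r + norm (Z s - Z r)" by simp
  qed
  have contZ: "continuous_on {0..T} Z"
    using deriv by (rule continuous_on_vector_derivative)
  have cont: "continuous_on {0..T} \<mu>"
    by (rule continuous_on_dominated[OF contZ, of _ 1]) (simp add: \<mu>_diff)
  \<comment> \<open>\<open>3 * \<alpha>1\<close> pays for the growth of the norm of x + h a(x) and
    \<open>\<kappa> * \<gamma>\<^sup>2\<close> for the term with \<open>c\<close>. The summand 1
    pays for two errors of size h \<mu>(s) / 2: the remainder of \<open>Z\<close> and the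
    second-order term.\<close>
  define K where "K = 3 * \<alpha>1 + \<kappa> * \<gamma>\<^sup>2 + 1"
  have "\<mu> t \<le> 0"
  proof (rule dini_nonpos[OF cont])
    show "\<mu> 0 \<le> 0" using Z0 by (intro \<mu>_least) auto
    show "K \<ge> 0" using \<kappa> \<alpha>1 t by (auto simp: K_def)
    fix s assume s: "0 \<le> s" "s < T" and pos: "\<mu> s > 0"
    then have sT: "s \<in> {0..T}" by auto
    \<comment> \<open>Positivity of \<open>\<mu> s\<close> allows the remainder to be measured in
      multiples of \<open>\<mu> s\<close>, so the estimate stays multiplicative, as
      \<open>dini_nonpos\<close> requires.\<close>
    have ev1: "\<forall>\<^sub>F h in at_right 0. norm (Z (s + h) - Z s - h *\<^sub>R Z' s) \<le> \<mu> s / 2 * h"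
      by (rule has_vector_derivative_at_right_remainder[OF deriv[OF sT]]) (use s pos in auto)
    \<comment> \<open>The first bound gives (1 + h \<alpha>1)^2 \<le> 1 + 3 \<alpha>1 h; the second
      makes h <y, Z y> at most \<mu>(s) / 2.\<close>
    define h0 where "h0 = min (1 / \<alpha>1) (\<mu> s / (2 * (\<alpha>1\<^sup>2 * norm (Z s) + 1)))"
    have den: "\<alpha>1\<^sup>2 * norm (Z s) + 1 > 0" by (intro add_nonneg_pos) auto
    then have "h0 > 0" using pos \<alpha>1 by (auto simp: h0_def)
    then have ev2: "\<forall>\<^sub>F h in at_right 0. 0 < h \<and> h < h0"
      unfolding eventually_at_right_field by (intro exI[of _ h0]) auto
    show "\<forall>\<^sub>F h in at_right 0. \<mu> (s + h) \<le> (1 + K * h) * \<mu> s"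
      using ev1 ev2
    proof eventually_elim
      case (elim h)
      then have h: "h > 0" "h * \<alpha>1 \<le> 1" and h2: "h * (2 * (\<alpha>1\<^sup>2 * norm (Z s) + 1)) \<le> \<mu> s"
        using \<alpha>1 den by (auto simp: h0_def field_simps)
      show ?case
      proof (rule \<mu>_least)
        fix x :: 'h assume x: "norm x \<le> 1"
        define y where "y = a s x"
        define z where "z = c s x"
        have y: "norm y \<le> \<alpha>1" unfolding y_def
          by (rule order_trans[OF a1[OF sT, of x] mult_left_le[OF x]]) (use \<alpha>1 in simp)
        have z: "norm z \<le> \<bar>\<gamma>\<bar>"
        proof -
          have "norm z \<le> \<gamma> * norm x" using c[OF sT] by (simp add: z_def)
          also have "\<dots> \<le> \<bar>\<gamma>\<bar> * 1" using x by (intro mult_mono) auto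
          finally show ?thesis by simp
        qed
        define E where "E = Z (s + h) - Z s - h *\<^sub>R Z' s"
        have E: "norm E \<le> \<mu> s / 2 * h" using elim by (simp add: E_def)
        have "\<bar>inner x (E x)\<bar> \<le> norm E * norm x * norm x" by (rule inner_blinfun_le)
        also have "\<dots> \<le> norm E * 1 * 1" using x by (intro mult_mono) auto
        finally have Ex: "- inner x (E x) \<le> \<mu> s / 2 * h" using E by linarith
        have Zh: "Z (s + h) = Z s + h *\<^sub>R Z' s + E" by (simp add: E_def)
        have 1: "- inner x (Z (s + h) x) = - inner x (Z s x) - h * inner x (Z' s x) - inner x (E x)"
          by (simp add: Zh blinfun.add_left blinfun.scaleR_left inner_add_right)
        have 2: "- (h * inner x (Z' s x)) \<le> - (h * (2 * inner y (Z s x) + \<kappa> * inner z (Z s z)))"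
          using ineq[OF sT, of x] h by (simp add: y_def z_def)
        \<comment> \<open>The linear term in h is absorbed into the form at the single vector x + h
          y, to which \<open>\<mu>_form\<close> applies; the price is the second-order term
          estimated in \<open>5\<close>.\<close>
        have 3: "inner (x + h *\<^sub>R y) (Z s (x + h *\<^sub>R y))
          = inner x (Z s x) + 2 * h * inner y (Z s x) + h\<^sup>2 * inner y (Z s y)"
          using sym[OF sT, of x y]
          by (simp add: blinfun.add_right blinfun.scaleR_right inner_add_left inner_add_right
              power2_eq_square inner_commute[of "Z s x" y] distrib_left)
        have "norm (x + h *\<^sub>R y) \<le> 1 + h * \<alpha>1"
          using norm_triangle_ineq[of x "h *\<^sub>R y"] x mult_left_mono[OF y less_imp_le[OF h(1)]] h(1)
          by (simp only: norm_scaleR abs_of_pos)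
        then have "(norm (x + h *\<^sub>R y))\<^sup>2 \<le> (1 + h * \<alpha>1)\<^sup>2" by (intro power_mono) auto
        also have "\<dots> \<le> 1 + 3 * \<alpha>1 * h"
        proof -
          have "(h * \<alpha>1) * (h * \<alpha>1) \<le> 1 * (h * \<alpha>1)"
            using h \<alpha>1 by (intro mult_right_mono) auto
          then show ?thesis by (simp add: power2_eq_square algebra_simps)
        qed
        finally have "\<mu> s * (norm (x + h *\<^sub>R y))\<^sup>2 \<le> \<mu> s * (1 + 3 * \<alpha>1 * h)"
          using pos by (intro mult_left_mono) auto
        with \<mu>_form[of "x + h *\<^sub>R y" s]
        have 4: "- inner (x + h *\<^sub>R y) (Z s (x + h *\<^sub>R y)) \<le> \<mu> s * (1 + 3 * \<alpha>1 * h)" by simp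
        have "inner y (Z s y) \<le> norm (Z s) * norm y * norm y"
          using inner_blinfun_le[of y "Z s" y] by linarith
        also have "\<dots> \<le> norm (Z s) * \<alpha>1 * \<alpha>1"
          using y \<alpha>1 by (intro mult_mono mult_left_mono mult_nonneg_nonneg) auto
        finally have "h * inner y (Z s y) \<le> h * (\<alpha>1\<^sup>2 * norm (Z s) + 1)"
          using h by (intro mult_left_mono) (auto simp: power2_eq_square mult_ac)
        moreover have "2 * (h * (\<alpha>1\<^sup>2 * norm (Z s) + 1)) \<le> \<mu> s"
          using h2 by (simp only: mult.left_commute)
        ultimately have "h * inner y (Z s y) \<le> \<mu> s / 2" by linarith
        then have "h * (h * inner y (Z s y)) \<le> h * (\<mu> s / 2)"
          by (rule mult_left_mono) (use h in simp)
        then have 5: "h\<^sup>2 * inner y (Z s y) \<le> h * (\<mu> s / 2)"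
          by (simp only: power2_eq_square mult.assoc)
        have "- inner z (Z s z) \<le> \<mu> s * (norm z)\<^sup>2" by (rule \<mu>_form)
        also have "\<dots> \<le> \<mu> s * \<gamma>\<^sup>2"
          using z pos by (intro mult_left_mono) (auto simp: abs_le_square_iff[symmetric])
        finally have "h * \<kappa> * (- inner z (Z s z)) \<le> h * \<kappa> * (\<mu> s * \<gamma>\<^sup>2)"
          using h \<kappa> by (intro mult_left_mono) auto
        then have 6: "- (h * (\<kappa> * inner z (Z s z))) \<le> h * \<kappa> * \<gamma>\<^sup>2 * \<mu> s" by (simp add: mult_ac)
        show "- inner x (Z (s + h) x) \<le> (1 + K * h) * \<mu> s"
        proof -
          have "(1 + K * h) * \<mu> s
              = \<mu> s * (1 + 3 * \<alpha>1 * h) + h * \<kappa> * \<gamma>\<^sup>2 * \<mu> s + h * (\<mu> s / 2) + \<mu> s / 2 * h"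
            by (simp add: K_def algebra_simps)
          moreover have "h * (2 * inner y (Z s x) + \<kappa> * inner z (Z s z))
              = 2 * h * inner y (Z s x) + h * (\<kappa> * inner z (Z s z))"
            by (simp add: algebra_simps)
          ultimately show ?thesis using 1 2 3 4 5 6 Ex by linarith
        qed
      qed
    qed
  qed (use t in auto)
  then have "\<mu> t = 0" using \<mu>_nonneg[of t] by simp
  with \<mu>_form[of x t] show ?thesis by simp
qed

section \<open>Exponential decay: a scalar inequality and the dual energy norm\<close>

lemma dini_exponential_decay:
  fixes N :: "real \<Rightarrow> real"
  assumes cont: "continuous_on {0..T} N" and N0: "N 0 \<le> N0" "0 \<le> N0" and D: "D > 0" and c: "c \<ge> 0"
    and step: "\<And>s \<eta>. 0 \<le> s \<Longrightarrow> s < T \<Longrightarrow> \<eta> > 0 \<Longrightarrow>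
      \<forall>\<^sub>F h in at_right 0. N (s + h) \<le> N s + h * (- D * N s + c * exp (- D * s) * (1 + N s) + \<eta>)"
    and t: "t \<in> {0..T}"
  shows "N t \<le> exp (c / D) * (N0 + 2 * (c + 1) / D) * exp (- (D / 2) * t)"
proof -
  \<comment> \<open>Construction of a barrier: \<open>E\<close> solves E' = (- D + c e^(-D s)) E and
    is at least e^(-c/D) e^(-D s). So \<open>a\<close> gives W(0) = N0, and \<open>b\<close> makes
    the source b E at least (c + 1) e^(-D s). Decay and source have the same rate; this resonance
    produces the factor s in \<open>W\<close>.\<close>
  define a where "a = N0 * exp (c / D)"
  define b where "b = (c + 1) * exp (c / D)"
  define E where "E s = exp (- D * s - c / D * exp (- D * s))" for s :: real
  define W where "W s = (a + b * s) * E s" for s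
  define W' where "W' s = b * E s + (- D + c * exp (- D * s)) * W s" for s
  have ab: "a \<ge> 0" "b \<ge> 0" using N0 c by (auto simp: a_def b_def)
  have W_deriv: "(W has_vector_derivative W' s) (at s within {0..T})" for s
    unfolding has_real_derivative_iff_has_vector_derivative[symmetric] W_def W'_def E_def
    using D by (auto intro!: derivative_eq_intros simp: field_simps)
  have contW: "continuous_on {0..T} W"
    using W_deriv by (rule continuous_on_vector_derivative)
  have bE: "b * E s \<ge> (c + 1) * exp (- D * s)" if "s \<ge> 0" for s
  proof -
    have "c / D * exp (- D * s) \<le> c / D * 1"
      using c D that by (intro mult_left_mono) auto
    then have "exp (- D * s) \<le> exp (c / D) * E s"
      by (simp add: E_def exp_add[symmetric])
    then show ?thesis using c mult_left_mono[of "exp (- D * s)" "exp (c / D) * E s" "c + 1"]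
      by (simp add: b_def mult.assoc)
  qed
  have "N t - W t \<le> 0"
  proof (rule dini_nonpos[where f = "\<lambda>s. N s - W s" and K = c])
    show "continuous_on {0..T} (\<lambda>s. N s - W s)" by (intro continuous_intros cont contW)
    have "W 0 = N0" by (simp add: W_def a_def E_def exp_minus)
    then show "N 0 - W 0 \<le> 0" using N0 by simp
    fix s assume s: "0 \<le> s" "s < T" and pos: "N s - W s > 0"
    \<comment> \<open>The source of \<open>W\<close> exceeds what is needed by e^(-D s). One half is
      spent on the error \<open>\<eta>\<close> in \<open>step\<close>, the other on the remainder of
      \<open>W\<close>.\<close>
    define \<eta> where "\<eta> = exp (- D * s) / 2"
    have \<eta>: "\<eta> > 0" by (simp add: \<eta>_def)
    have ev: "\<forall>\<^sub>F h in at_right (0::real). 0 < h" by (simp add: eventually_at_right_less)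
    show "\<forall>\<^sub>F h in at_right 0. N (s + h) - W (s + h) \<le> (1 + c * h) * (N s - W s)"
      using step[OF s \<eta>] has_vector_derivative_at_right_remainder[OF W_deriv s \<eta>] ev
    proof eventually_elim
      case (elim h)
      define k where "k = - D + c * exp (- D * s)"
      have "c * exp (- D * s) \<le> c * 1" using c D s by (intro mult_left_mono) auto
      then have k: "k \<le> c" using D by (simp add: k_def)
      have 1: "W (s + h) \<ge> W s + h * W' s - \<eta> * h" using elim(2) by (simp add: abs_le_iff)
      have 2: "h * W' s \<ge> h * ((c + 1) * exp (- D * s) + k * W s)"
        using bE[OF s(1)] elim(3) by (intro mult_left_mono) (auto simp: W'_def k_def)
      have "- D * N s + c * exp (- D * s) * (1 + N s) + \<eta> = k * N s + c * exp (- D * s) + \<eta>"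
        by (simp add: k_def algebra_simps)
      with elim(1) have "N (s + h) \<le> N s + h * (k * N s + c * exp (- D * s) + \<eta>)" by simp
      then have "N (s + h) - W (s + h) \<le> N s - W s + h * (k * N s + c * exp (- D * s) + \<eta>)
          - h * ((c + 1) * exp (- D * s) + k * W s) + \<eta> * h"
        using 1 2 by linarith
      also have "\<dots> = N s - W s + h * (k * (N s - W s))"
        by (simp add: \<eta>_def algebra_simps)
      also have "h * (k * (N s - W s)) \<le> h * (c * (N s - W s))"
        using k pos elim(3) by (intro mult_left_mono mult_right_mono) auto
      finally show ?case by (simp add: algebra_simps)
    qed
  qed (use c t in auto)
  also have "W t \<le> (a + b * t) * exp (- D * t)"
    unfolding W_def E_def using ab c D t by (intro mult_left_mono) auto
  \<comment> \<open>Half of the rate is given up to absorb the factor t.\<close>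
  moreover have "(a + b * t) * exp (- D * t) \<le> (a + 2 * b / D) * exp (- (D / 2) * t)"
  proof -
    have "D / 2 * t \<le> exp (D / 2 * t)" using exp_ge_add_one_self[of "D / 2 * t"] by linarith
    then have "t * exp (- (D / 2) * t) \<le> 2 / D"
      using D by (simp add: exp_minus field_simps)
    moreover have "exp (- (D / 2) * t) \<le> 1" using D t by simp
    ultimately have "a * exp (- (D / 2) * t) + b * (t * exp (- (D / 2) * t)) \<le> a * 1 + b * (2 / D)"
      using ab by (intro add_mono mult_left_mono) auto
    then have "(a * exp (- (D / 2) * t) + b * (t * exp (- (D / 2) * t))) * exp (- (D / 2) * t)
        \<le> (a * 1 + b * (2 / D)) * exp (- (D / 2) * t)"
      by (rule mult_right_mono) simp
    moreover have "exp (- D * t) = exp (- (D / 2) * t) * exp (- (D / 2) * t)"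
      by (simp add: exp_add[symmetric])
    ultimately show ?thesis by (simp add: algebra_simps)
  qed
  moreover have "a + 2 * b / D = exp (c / D) * (N0 + 2 * (c + 1) / D)"
    by (simp add: a_def b_def field_simps)
  ultimately show ?thesis by simp
qed

text \<open>\<open>A\<close> is dissipative for the energy form of \<open>X\<close>, so its adjoint is dissipative for the dual norm
  \<open>N(e) = sup {\<langle>e, x\<rangle> | \<langle>x, X x\<rangle> \<le> 1}\<close>; this replaces the form of \<open>X\<^sup>-\<^sup>1\<close>, whose
  existence would require completeness.\<close>

lemma dual_exponential_stability:
  fixes X :: "'h::real_inner \<Rightarrow>\<^sub>L 'h" and A :: "'h \<Rightarrow> 'h"
  assumes sym: "\<And>x y. inner x (X y) = inner (X x) y"
    and coer: "\<kappa> > 0" "\<And>x. \<kappa> * (norm x)\<^sup>2 \<le> inner x (X x)"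
    and lyap: "\<epsilon> > 0" "\<And>x. 2 * inner (A x) (X x) \<le> - \<epsilon> * (norm x)\<^sup>2"
    and A: "\<And>x. norm (A x) \<le> \<alpha> * norm x"
    and C: "C \<ge> 0" and \<delta>: "\<delta> > 0" and E0: "E0 \<ge> 0"
  shows "\<exists>K>0. \<exists>r>0. \<forall>T e e'.
    (\<forall>s\<in>{0..T}. (e has_vector_derivative e' s) (at s within {0..T})) \<longrightarrow>
    norm (e 0) \<le> E0 \<longrightarrow>
    (\<forall>s\<in>{0..T}. \<forall>x. \<bar>inner x (e' s) - inner (A x) (e s)\<bar>
       \<le> C * exp (- \<delta> * s) * (1 + norm (e s)) * norm x) \<longrightarrow>
    (\<forall>s\<in>{0..T}. norm (e s) \<le> K * exp (- r * s))"
proof -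
  define M where "M = norm X + 1"
  have M: "M \<ge> 1" by (simp add: M_def)
  have XM: "inner x (X x) \<le> M * (norm x)\<^sup>2" for x
    using inner_blinfun_le[of x X x] mult_right_mono[of "norm X" M "(norm x)\<^sup>2"]
    by (simp add: M_def power2_eq_square mult.assoc)
  have Xnn: "0 \<le> inner x (X x)" for x
    using coer(2)[of x] coer(1) by (smt (verit) mult_nonneg_nonneg zero_le_power2)
  define en where "en x = sqrt (inner x (X x))" for x
  define U where "U = {x. inner x (X x) \<le> 1}"
  define N where "N e = (SUP x\<in>U. inner e x)" for e
  have U0: "0 \<in> U" by (simp add: U_def)
  have Unorm: "norm x \<le> 1 / sqrt \<kappa>" if "x \<in> U" for x
  proof -
    have "\<kappa> * (norm x)\<^sup>2 \<le> 1" using coer(2)[of x] that by (simp add: U_def)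
    then have "(norm x)\<^sup>2 \<le> 1 / \<kappa>" using coer(1) by (simp add: field_simps)
    then have "norm x \<le> sqrt (1 / \<kappa>)" by (rule real_le_rsqrt)
    then show ?thesis by (simp add: real_sqrt_divide)
  qed
  have U_le: "inner e x \<le> norm e / sqrt \<kappa>" if "x \<in> U" for e x
  proof -
    have "inner e x \<le> norm e * norm x" by (rule norm_cauchy_schwarz)
    also have "\<dots> \<le> norm e * (1 / sqrt \<kappa>)" using Unorm[OF that] by (intro mult_left_mono) auto
    finally show ?thesis by simp
  qed
  have bdd: "bdd_above (inner e ` U)" for e
    using U_le by (auto intro!: bdd_aboveI[of _ "norm e / sqrt \<kappa>"])
  have N_upper: "inner e x \<le> N e" if "x \<in> U" for e x
    unfolding N_def by (intro cSUP_upper bdd that)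
  have N_least: "N e \<le> b" if "\<And>x. x \<in> U \<Longrightarrow> inner e x \<le> b" for e b
    unfolding N_def using U0 that by (intro cSUP_least) auto
  have N_nonneg: "0 \<le> N e" for e using N_upper[OF U0, of e] by simp
  have N_en: "inner e x \<le> N e * en x" for e x
  proof (cases "x = 0")
    case False
    then have "0 < \<kappa> * (norm x)\<^sup>2" using coer(1) by simp
    then have en: "en x > 0" using coer(2)[of x] unfolding en_def by (intro real_sqrt_gt_zero) linarith
    have "inner (x /\<^sub>R en x) (X (x /\<^sub>R en x)) = inner x (X x) / (en x)\<^sup>2"
      by (simp add: blinfun.scaleR_right power2_eq_square divide_simps)
    also have "(en x)\<^sup>2 = inner x (X x)" unfolding en_def by (rule real_sqrt_pow2[OF Xnn])
    finally have "x /\<^sub>R en x \<in> U" using en by (auto simp: U_def en_def)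
    from N_upper[OF this, of e] en show ?thesis by (simp add: field_simps)
  qed (simp add: en_def)
  have en_le: "en x \<le> sqrt M * norm x" for x
    unfolding en_def using real_sqrt_le_mono[OF XM[of x]] by (simp add: real_sqrt_mult)
  \<comment> \<open>Testing the dual norm with \<open>e\<close> itself.\<close>
  have norm_le: "norm e \<le> sqrt M * N e" for e
  proof (cases "e = 0")
    case False
    have "norm e * norm e = inner e e" by (simp add: dot_square_norm power2_eq_square)
    also have "\<dots> \<le> N e * en e" by (rule N_en)
    also have "\<dots> \<le> N e * (sqrt M * norm e)" by (intro mult_left_mono en_le N_nonneg)
    finally have "norm e * norm e \<le> (sqrt M * N e) * norm e" by (simp add: mult_ac)
    with False show ?thesis by simp
  qed (use N_nonneg M in auto)
  have N_le: "N e \<le> norm e / sqrt \<kappa>" for e by (intro N_least U_le)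
  have N_tri: "N e \<le> N f + norm (e - f) / sqrt \<kappa>" for e f
  proof (rule N_least)
    fix x assume x: "x \<in> U"
    have "inner e x = inner f x + inner (e - f) x" by (simp add: inner_diff_left)
    with N_upper[OF x, of f] U_le[OF x, of "e - f"]
    show "inner e x \<le> N f + norm (e - f) / sqrt \<kappa>" by simp
  qed
  define \<alpha>1 where "\<alpha>1 = \<bar>\<alpha>\<bar> + 1"
  have \<alpha>1: "\<alpha>1 > 0" by (simp add: \<alpha>1_def)
  have A1: "norm (A x) \<le> \<alpha>1 * norm x" for x
    by (rule order_trans[OF A mult_right_mono]) (auto simp: \<alpha>1_def)
  \<comment> \<open>Half of \<open>\<epsilon>\<close> absorbs the second-order term of x + h A x.
    The other half, with <x, X x> \<le> M |x|^2, gives rate 2 d for the squared energy, hence d for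
    the energy.\<close>
  define d where "d = \<epsilon> / (4 * M)"
  have d: "d > 0" using lyap M by (auto simp: d_def)
  \<comment> \<open>\<open>dini_exponential_decay\<close> has a single rate for the contraction and
    for the perturbation, so the slower of the two is taken.\<close>
  define D where "D = min d \<delta>"
  have D: "D > 0" "D \<le> d" "D \<le> \<delta>" using d \<delta> by (auto simp: D_def)
  \<comment> \<open>On \<open>U\<close> the norm is at most 1 / sqrt \<kappa>, and 1 + |e| is at
    most sqrt M (1 + N e) because M \<ge> 1.\<close>
  define c where "c = C * sqrt M / sqrt \<kappa>"
  have c: "c \<ge> 0" using C M coer by (simp add: c_def)
  define h0 where "h0 = min (1 / (2 * d)) (\<epsilon> / (2 * (\<alpha>1\<^sup>2 * M)))"
  have h0: "h0 > 0" using d lyap \<alpha>1 M by (auto simp: h0_def)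
  have contract: "en (x + h *\<^sub>R A x) \<le> 1 - d * h" if h: "0 < h" "h < h0" and x: "x \<in> U" for h x
  proof -
    have h1: "2 * d * h \<le> 1" using h d by (auto simp: h0_def field_simps)
    have h2: "h * (\<alpha>1\<^sup>2 * M) \<le> \<epsilon> / 2" using h \<alpha>1 M by (auto simp: h0_def field_simps)
    have "inner (A x) (X (A x)) \<le> M * (norm (A x))\<^sup>2" by (rule XM)
    also have "\<dots> \<le> M * (\<alpha>1 * norm x)\<^sup>2" using M A1 by (intro mult_left_mono power_mono) auto
    finally have "inner (A x) (X (A x)) \<le> (\<alpha>1\<^sup>2 * M) * (norm x)\<^sup>2" by (simp add: power_mult_distrib mult_ac)
    then have "h * inner (A x) (X (A x)) \<le> h * ((\<alpha>1\<^sup>2 * M) * (norm x)\<^sup>2)"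
      using h by (intro mult_left_mono) auto
    also have "\<dots> \<le> \<epsilon> / 2 * (norm x)\<^sup>2"
      using mult_right_mono[OF h2, of "(norm x)\<^sup>2"] by (simp add: mult.assoc)
    finally have 1: "2 * inner (A x) (X x) + h * inner (A x) (X (A x)) \<le> - (\<epsilon> / 2) * (norm x)\<^sup>2"
      using lyap(2)[of x] by linarith
    have "inner x (X x) / M \<le> (norm x)\<^sup>2" using XM[of x] M by (simp add: field_simps)
    then have "- (\<epsilon> / 2) * (norm x)\<^sup>2 \<le> - (\<epsilon> / 2) * (inner x (X x) / M)"
      using lyap(1) by (intro mult_left_mono_neg) auto
    also have "\<dots> = - (2 * d) * inner x (X x)" by (simp add: d_def)
    finally have "2 * inner (A x) (X x) + h * inner (A x) (X (A x)) \<le> - (2 * d) * inner x (X x)"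
      using 1 by linarith
    then have 2: "h * (2 * inner (A x) (X x) + h * inner (A x) (X (A x))) \<le> h * (- (2 * d) * inner x (X x))"
      using h by (intro mult_left_mono) auto
    have "inner (x + h *\<^sub>R A x) (X (x + h *\<^sub>R A x))
        = inner x (X x) + h * (2 * inner (A x) (X x) + h * inner (A x) (X (A x)))"
      using sym[of x "A x"]
      by (simp add: blinfun.add_right blinfun.scaleR_right inner_add_left inner_add_right
          inner_commute[of "X x" "A x"] distrib_left)
    also have "\<dots> \<le> (1 - 2 * d * h) * inner x (X x)" using 2 by (simp add: algebra_simps)
    also have "\<dots> \<le> (1 - 2 * d * h) * 1" using x h1 by (intro mult_left_mono) (auto simp: U_def)
    also have "\<dots> \<le> (1 - d * h)\<^sup>2" using d h by (simp add: power2_eq_square algebra_simps)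
    finally show ?thesis unfolding en_def
      using h1 d h by (intro real_le_lsqrt) auto
  qed
  define N0 where "N0 = E0 / sqrt \<kappa>"
  have N0: "N0 \<ge> 0" using E0 coer by (simp add: N0_def)
  define K where "K = sqrt M * (exp (c / D) * (N0 + 2 * (c + 1) / D))"
  have Kpos: "K > 0" using M N0 c D
    by (auto simp: K_def intro!: mult_pos_pos add_nonneg_pos divide_pos_pos)
  have main: "norm (e t) \<le> K * exp (- (D / 2) * t)"
    if deriv: "\<And>s. s \<in> {0..T} \<Longrightarrow> (e has_vector_derivative e' s) (at s within {0..T})"
      and e0: "norm (e 0) \<le> E0"
      and err: "\<And>s x. s \<in> {0..T} \<Longrightarrow> \<bar>inner x (e' s) - inner (A x) (e s)\<bar>
       \<le> C * exp (- \<delta> * s) * (1 + norm (e s)) * norm x"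
      and t: "t \<in> {0..T}" for T e e' t
  proof -
    have conte: "continuous_on {0..T} e" using deriv by (rule continuous_on_vector_derivative)
    have "continuous_on {0..T} (\<lambda>s. N (e s))"
      by (rule continuous_on_dominated[OF conte, of _ "1 / sqrt \<kappa>"]) (use N_tri in simp)
    then have "N (e t) \<le> exp (c / D) * (N0 + 2 * (c + 1) / D) * exp (- (D / 2) * t)"
    proof (rule dini_exponential_decay[where N = "\<lambda>s. N (e s)", OF _ _ N0 D(1) c _ t])
      show "N (e 0) \<le> N0" unfolding N0_def
        by (rule order_trans[OF N_le]) (use e0 coer in \<open>auto intro: divide_right_mono\<close>)
      fix s \<eta> :: real assume s: "0 \<le> s" "s < T" and \<eta>: "\<eta> > 0"
      then have sT: "s \<in> {0..T}" by auto
      have \<eta>\<kappa>: "\<eta> * sqrt \<kappa> > 0" using \<eta> coer by simp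
      have ev: "\<forall>\<^sub>F h in at_right 0. 0 < h \<and> h < h0"
        unfolding eventually_at_right_field using h0 by (intro exI[of _ h0]) auto
      show "\<forall>\<^sub>F h in at_right 0. N (e (s + h))
          \<le> N (e s) + h * (- D * N (e s) + c * exp (- D * s) * (1 + N (e s)) + \<eta>)"
        using has_vector_derivative_at_right_remainder[OF deriv[OF sT] s \<eta>\<kappa>] ev
      proof eventually_elim
        case (elim h)
        then have h: "0 < h" "h < h0" by auto
        define w where "w = e (s + h) - e s - h *\<^sub>R e' s"
        have w: "norm w \<le> \<eta> * sqrt \<kappa> * h" using elim by (simp add: w_def)
        show ?case
        proof (rule N_least)
          fix x assume x: "x \<in> U"
          have xn: "norm x \<le> 1 / sqrt \<kappa>" by (rule Unorm[OF x])
          have "inner w x \<le> norm w / sqrt \<kappa>" by (rule U_le[OF x])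
          also have "\<dots> \<le> (\<eta> * sqrt \<kappa> * h) / sqrt \<kappa>" using w coer by (intro divide_right_mono) auto
          also have "\<dots> = h * \<eta>" using coer by simp
          finally have 1: "inner w x \<le> h * \<eta>" .
          have "inner (e' s) x - inner (e s) (A x) \<le> C * exp (- \<delta> * s) * (1 + norm (e s)) * norm x"
            using err[OF sT, of x] by (simp add: inner_commute abs_le_iff)
          also have "\<dots> \<le> C * exp (- D * s) * (sqrt M * (1 + N (e s))) * (1 / sqrt \<kappa>)"
          proof -
            have "1 \<le> sqrt M" using M by simp
            with norm_le[of "e s"] have "1 + norm (e s) \<le> sqrt M * (1 + N (e s))"
              unfolding distrib_left by linarith
            moreover have "- \<delta> * s \<le> - D * s" using D s by (simp add: mult_right_mono)
            ultimately show ?thesis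
              using C xn M N_nonneg[of "e s"] by (intro mult_mono mult_left_mono mult_nonneg_nonneg) auto
          qed
          also have "\<dots> = c * exp (- D * s) * (1 + N (e s))" by (simp add: c_def)
          finally have "h * (inner (e' s) x - inner (e s) (A x)) \<le> h * (c * exp (- D * s) * (1 + N (e s)))"
            using h by (intro mult_left_mono) auto
          then have 2: "h * inner (e' s) x \<le> h * inner (e s) (A x) + h * (c * exp (- D * s) * (1 + N (e s)))"
            by (simp add: right_diff_distrib)
          \<comment> \<open>The adjoint of \<open>A\<close> acts through the test vector: for x in
            \<open>U\<close>, the vector x + h A x has energy at most 1 - d h.\<close>
          have "inner (e s) (x + h *\<^sub>R A x) \<le> N (e s) * en (x + h *\<^sub>R A x)" by (rule N_en)
          also have "\<dots> \<le> N (e s) * (1 - d * h)" by (intro mult_left_mono contract h x N_nonneg)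
          also have "\<dots> \<le> N (e s) * (1 - D * h)"
            using D h by (intro mult_left_mono N_nonneg) auto
          finally have 3: "inner (e s) x + h * inner (e s) (A x) \<le> N (e s) - h * (D * N (e s))"
            by (simp add: inner_add_right algebra_simps)
          have "inner (e (s + h)) x = inner (e s) x + h * inner (e' s) x + inner w x"
            by (simp add: w_def inner_diff_left)
          also have "\<dots> \<le> N (e s) - h * (D * N (e s)) + h * (c * exp (- D * s) * (1 + N (e s))) + h * \<eta>"
            using 1 2 3 by linarith
          finally show "inner (e (s + h)) x
              \<le> N (e s) + h * (- D * N (e s) + c * exp (- D * s) * (1 + N (e s)) + \<eta>)"
            by (simp add: algebra_simps)
        qed
      qed
    qed
    then have "sqrt M * N (e t) \<le> sqrt M * (exp (c / D) * (N0 + 2 * (c + 1) / D) * exp (- (D / 2) * t))"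
      using M by (intro mult_left_mono) auto
    with norm_le[of "e t"] show ?thesis by (simp add: K_def mult_ac)
  qed
  show ?thesis
  proof (rule exI[of _ K], intro conjI Kpos, rule exI[of _ "D / 2"], intro conjI allI impI ballI)
    show "D / 2 > 0" using D by simp
  qed (rule main; blast)
qed

section \<open>Riccati inequalities on an inner product space\<close>

text \<open>For \<open>\<theta> = \<Theta>(z)\<close> optimal this is the quadratic form of the right-hand side of a Riccati equation. It is
  affine in \<open>(X, P)\<close>, so the Riccati form is concave in \<open>(X, P)\<close>.\<close>

definition ric_form ::
  "('h::real_inner \<Rightarrow>\<^sub>L 'h) \<Rightarrow> ('h \<Rightarrow>\<^sub>L 'h) \<Rightarrow> ('k::real_inner \<Rightarrow>\<^sub>L 'h) \<Rightarrow> ('k \<Rightarrow>\<^sub>L 'h)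
    \<Rightarrow> ('k \<Rightarrow> 'h \<Rightarrow> real) \<Rightarrow> ('h \<Rightarrow>\<^sub>L 'h) \<Rightarrow> ('h \<Rightarrow>\<^sub>L 'h) \<Rightarrow> 'k \<Rightarrow> 'h \<Rightarrow> real" where
  "ric_form A B C D cost X P \<theta> z = 2 * inner (A z + C \<theta>) (X z)
     + inner (B z + D \<theta>) (P (B z + D \<theta>)) + cost \<theta> z"

text \<open>By concavity \<open>(1 - e\<^sup>-\<^sup>\<delta>\<^sup>s) Xb\<close> is a subsolution, since
  the Riccati form vanishes at \<open>Xb\<close> and equals the minimal cost, which is at least \<open>\<delta> Xb\<close>, at \<open>0\<close>.
  The number \<open>\<kappa>\<close> is \<open>1\<close> if \<open>P = X\<close> and \<open>0\<close> if \<open>P\<close> is given and already known to satisfy the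
  estimates.\<close>

lemma riccati_sandwich:
  fixes X X' P :: "real \<Rightarrow> 'h::real_inner \<Rightarrow>\<^sub>L 'h" and Xb Pb :: "'h \<Rightarrow>\<^sub>L 'h"
    and \<Theta> :: "real \<Rightarrow> 'h \<Rightarrow> 'k::real_inner" and \<Theta>b :: "'h \<Rightarrow> 'k"
    and A B :: "'h \<Rightarrow>\<^sub>L 'h" and C D :: "'k \<Rightarrow>\<^sub>L 'h" and cost :: "'k \<Rightarrow> 'h \<Rightarrow> real"
  defines "J \<equiv> ric_form A B C D cost"
  assumes deriv: "\<And>s. s \<in> {0..T} \<Longrightarrow> (X has_vector_derivative X' s) (at s within {0..T})"
    and X0: "X 0 = 0"
    and symX: "\<And>s x y. s \<in> {0..T} \<Longrightarrow> inner x (X s y) = inner (X s x) y"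
    and symXb: "\<And>x y. inner x (Xb y) = inner (Xb x) y"
    and Xb: "\<And>x. 0 \<le> inner x (Xb x)"
    and ric: "\<And>s z. s \<in> {0..T} \<Longrightarrow> inner z (X' s z) = J (X s) (P s) (\<Theta> s z) z"
    and min: "\<And>s \<theta> z. s \<in> {0..T} \<Longrightarrow> J (X s) (P s) (\<Theta> s z) z \<le> J (X s) (P s) \<theta> z"
    and alg: "\<And>z. J Xb Pb (\<Theta>b z) z = 0"
    and algmin: "\<And>\<theta> z. 0 \<le> J Xb Pb \<theta> z"
    and cost: "\<And>\<theta> z. \<delta> * inner z (Xb z) \<le> cost \<theta> z"
    and \<delta>: "\<delta> > 0"
    and \<Theta>: "\<And>s z. s \<in> {0..T} \<Longrightarrow> norm (\<Theta> s z) \<le> k * norm z"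
    and \<Theta>b: "\<And>z. norm (\<Theta>b z) \<le> k * norm z"
    and \<kappa>: "\<kappa> \<ge> 0"
    and Plow: "\<And>s \<psi>. s \<in> {0..T} \<Longrightarrow> \<kappa> * inner \<psi> ((X s - (1 - exp (- \<delta> * s)) *\<^sub>R Xb) \<psi>)
                 \<le> inner \<psi> ((P s - (1 - exp (- \<delta> * s)) *\<^sub>R Pb) \<psi>)"
    and Pup: "\<And>s \<psi>. s \<in> {0..T} \<Longrightarrow> \<kappa> * inner \<psi> ((Xb - X s) \<psi>) \<le> inner \<psi> ((Pb - P s) \<psi>)"
    and t: "t \<in> {0..T}"
  shows "(1 - exp (- \<delta> * t)) * inner x (Xb x) \<le> inner x (X t x)"
    and "inner x (X t x) \<le> inner x (Xb x)"
proof -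
  have bnd: "norm (F z + G (\<theta>::'k)) \<le> (norm F + norm G * \<bar>k\<bar>) * norm z"
    if "norm \<theta> \<le> k * norm z" for F :: "'h \<Rightarrow>\<^sub>L 'h" and G :: "'k \<Rightarrow>\<^sub>L 'h" and \<theta> z
  proof -
    have "norm \<theta> \<le> \<bar>k\<bar> * norm z" by (rule order_trans[OF that mult_right_mono]) auto
    then have "norm G * norm \<theta> \<le> norm G * (\<bar>k\<bar> * norm z)" by (rule mult_left_mono) simp
    with norm_blinfun[of G \<theta>] norm_blinfun[of F z] norm_triangle_ineq[of "F z" "G \<theta>"]
    show ?thesis by (simp add: distrib_right)
  qed
  \<comment> \<open>All forms are evaluated at the control that is optimal for (X, P). With y =
    e^(-\<delta> s), affinity of \<open>J\<close> makes J(X, P) - (1 - y) J(Xb, Pb) - y J(0, 0) the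
    linear part of \<open>J\<close> at the differences, and J(0, 0) is \<open>cost\<close>.\<close>
  have "0 \<le> inner x ((X t - (1 - exp (- \<delta> * t)) *\<^sub>R Xb) x)"
  proof (rule form_comparison[where Z = "\<lambda>s. X s - (1 - exp (- \<delta> * s)) *\<^sub>R Xb"
        and Z' = "\<lambda>s. X' s - (\<delta> * exp (- \<delta> * s)) *\<^sub>R Xb"
        and a = "\<lambda>s z. A z + C (\<Theta> s z)" and c = "\<lambda>s z. B z + D (\<Theta> s z)"
        and \<alpha> = "norm A + norm C * \<bar>k\<bar>" and \<gamma> = "norm B + norm D * \<bar>k\<bar>", OF _ _ _ _ _ _ \<kappa> t])
    show "((\<lambda>s. X s - (1 - exp (- \<delta> * s)) *\<^sub>R Xb) has_vector_derivative
        X' s - (\<delta> * exp (- \<delta> * s)) *\<^sub>R Xb) (at s within {0..T})" if "s \<in> {0..T}" for s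
    proof -
      have "((\<lambda>s. 1 - exp (- \<delta> * s)) has_real_derivative \<delta> * exp (- \<delta> * s)) (at s within {0..T})"
        by (auto intro!: derivative_eq_intros)
      from has_vector_derivative_diff[OF deriv[OF that] has_vector_derivative_scaleR[OF this
          has_vector_derivative_const[of Xb]]]
      show ?thesis by simp
    qed
    fix s and z :: 'h assume s: "s \<in> {0..T}"
    define a where "a = A z + C (\<Theta> s z)"
    define c where "c = B z + D (\<Theta> s z)"
    define x where "x = exp (- \<delta> * s)"
    have x: "0 < x" "x \<le> 1" using \<delta> s by (auto simp: x_def)
    have 1: "J (X s) (P s) (\<Theta> s z) z = 2 * inner a (X s z) + inner c (P s c) + cost (\<Theta> s z) z"
      and 2: "J Xb Pb (\<Theta> s z) z = 2 * inner a (Xb z) + inner c (Pb c) + cost (\<Theta> s z) z"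
      by (simp_all add: J_def ric_form_def a_def c_def)
    have "(1 - x) * J Xb Pb (\<Theta> s z) z \<ge> 0" using x algmin by simp
    moreover have "x * (\<delta> * inner z (Xb z)) \<le> x * cost (\<Theta> s z) z"
      using x cost by (intro mult_left_mono) auto
    ultimately have "2 * inner a ((X s - (1 - x) *\<^sub>R Xb) z) + inner c ((P s - (1 - x) *\<^sub>R Pb) c)
        \<le> J (X s) (P s) (\<Theta> s z) z - x * (\<delta> * inner z (Xb z))"
      unfolding 1 2
      by (simp add: blinfun.diff_left blinfun.scaleR_left inner_diff_right left_diff_distrib right_diff_distrib
          distrib_left)
    also have "\<dots> = inner z ((X' s - (\<delta> * x) *\<^sub>R Xb) z)"
      by (simp add: ric[OF s, symmetric] blinfun.diff_left blinfun.scaleR_left inner_diff_right)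
    finally show "2 * inner (A z + C (\<Theta> s z)) ((X s - (1 - exp (- \<delta> * s)) *\<^sub>R Xb) z)
        + \<kappa> * inner (B z + D (\<Theta> s z)) ((X s - (1 - exp (- \<delta> * s)) *\<^sub>R Xb) (B z + D (\<Theta> s z)))
        \<le> inner z ((X' s - (\<delta> * exp (- \<delta> * s)) *\<^sub>R Xb) z)"
      using Plow[OF s, of c] by (simp add: a_def c_def x_def)
  qed (auto simp: X0 blinfun.diff_left blinfun.scaleR_left inner_diff_left inner_diff_right
      symX symXb intro!: bnd \<Theta>)
  then show "(1 - exp (- \<delta> * t)) * inner x (Xb x) \<le> inner x (X t x)"
    by (simp add: blinfun.diff_left blinfun.scaleR_left inner_diff_right)
  \<comment> \<open>For the upper bound the control optimal for (Xb, Pb) is inserted: it annihilates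
    \<open>J\<close> there and is at best suboptimal for (X, P), which gives the required
    sign.\<close>
  have "0 \<le> inner x ((Xb - X t) x)"
  proof (rule form_comparison[where Z = "\<lambda>s. Xb - X s" and Z' = "\<lambda>s. - X' s"
        and a = "\<lambda>s z. A z + C (\<Theta>b z)" and c = "\<lambda>s z. B z + D (\<Theta>b z)"
        and \<alpha> = "norm A + norm C * \<bar>k\<bar>" and \<gamma> = "norm B + norm D * \<bar>k\<bar>", OF _ _ _ _ _ _ \<kappa> t])
    show "((\<lambda>s. Xb - X s) has_vector_derivative - X' s) (at s within {0..T})" if "s \<in> {0..T}" for s
      using has_vector_derivative_diff[OF has_vector_derivative_const deriv[OF that]] by simp
    fix s and z :: 'h assume s: "s \<in> {0..T}"
    have "inner z ((- X' s) z) \<ge> J Xb Pb (\<Theta>b z) z - J (X s) (P s) (\<Theta>b z) z"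
      using min[OF s, of z "\<Theta>b z"] by (simp add: alg ric[OF s] blinfun.minus_left)
    then show "2 * inner (A z + C (\<Theta>b z)) ((Xb - X s) z)
        + \<kappa> * inner (B z + D (\<Theta>b z)) ((Xb - X s) (B z + D (\<Theta>b z))) \<le> inner z ((- X' s) z)"
      using Pup[OF s, of "B z + D (\<Theta>b z)"]
      by (simp add: J_def ric_form_def blinfun.diff_left inner_diff_right algebra_simps)
  qed (auto simp: X0 blinfun.diff_left inner_diff_left inner_diff_right symX Xb intro!: bnd \<Theta>b symXb)
  then show "inner x (X t x) \<le> inner x (Xb x)"
    by (simp add: blinfun.diff_left inner_diff_right)
qed

section \<open>Square-integrable functions on a measure space\<close>

lemma L2_measurable [measurable_dest]: "f \<in> L2 M \<Longrightarrow> f \<in> borel_measurable M"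
  by (simp add: L2_def)

lemma L2_integrable: "f \<in> L2 M \<Longrightarrow> integrable M (\<lambda>x. (norm (f x))\<^sup>2)"
  by (simp add: L2_def)

lemma L2I:
  assumes "f \<in> borel_measurable M" "integrable M g" "\<And>x. (norm (f x))\<^sup>2 \<le> g x"
  shows "f \<in> L2 M"
proof -
  have "integrable M (\<lambda>x. (norm (f x))\<^sup>2)"
    by (rule Bochner_Integration.integrable_bound[OF assms(2)])
      (use assms(1,3) in \<open>auto intro!: order_trans[OF assms(3)] abs_ge_self\<close>)
  with assms(1) show ?thesis by (simp add: L2_def)
qed

lemma integrable_norm_mult_L2:
  assumes f: "f \<in> L2 M" and g: "g \<in> L2 M"
  shows "integrable M (\<lambda>x. norm (f x) * norm (g x))"
proof (rule Bochner_Integration.integrable_bound)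
  show "integrable M (\<lambda>x. (norm (f x))\<^sup>2 + (norm (g x))\<^sup>2)"
    using f g by (intro Bochner_Integration.integrable_add L2_integrable)
  show "(\<lambda>x. norm (f x) * norm (g x)) \<in> borel_measurable M" using f g by measurable
  have "norm (f x) * norm (g x) \<le> (norm (f x))\<^sup>2 + (norm (g x))\<^sup>2" for x
    using sum_squares_bound[of "norm (f x)" "norm (g x)"]
      mult_nonneg_nonneg[OF norm_ge_zero[of "f x"] norm_ge_zero[of "g x"]] by linarith
  then show "AE x in M. norm (norm (f x) * norm (g x)) \<le> norm ((norm (f x))\<^sup>2 + (norm (g x))\<^sup>2)"
    by (intro AE_I2) simp
qed

lemma integrable_inner_L2:
  assumes f: "f \<in> L2 M" and g: "g \<in> L2 M"
  shows "integrable M (\<lambda>x. inner (f x) (g x))"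
  by (rule Bochner_Integration.integrable_bound[OF integrable_norm_mult_L2[OF f g]])
    (use f g in \<open>auto intro!: Cauchy_Schwarz_ineq2\<close>)

lemma L2_add:
  assumes f: "f \<in> L2 M" and g: "g \<in> L2 M"
  shows "(\<lambda>x. f x + g x) \<in> L2 M"
proof (rule L2I[where g = "\<lambda>x. 2 * (norm (f x))\<^sup>2 + 2 * (norm (g x))\<^sup>2"])
  show "(\<lambda>x. f x + g x) \<in> borel_measurable M" using f g by measurable
  show "integrable M (\<lambda>x. 2 * (norm (f x))\<^sup>2 + 2 * (norm (g x))\<^sup>2)"
    using f g by (auto intro!: L2_integrable)
  fix x
  have "(norm (f x + g x))\<^sup>2 \<le> (norm (f x) + norm (g x))\<^sup>2"
    by (intro power_mono norm_triangle_ineq) auto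
  also have "\<dots> \<le> 2 * (norm (f x))\<^sup>2 + 2 * (norm (g x))\<^sup>2"
    using sum_squares_bound[of "norm (f x)" "norm (g x)"] by (simp add: power2_sum)
  finally show "(norm (f x + g x))\<^sup>2 \<le> 2 * (norm (f x))\<^sup>2 + 2 * (norm (g x))\<^sup>2" .
qed

lemma L2_scaleR:
  assumes f: "f \<in> L2 M"
  shows "(\<lambda>x. c *\<^sub>R f x) \<in> L2 M"
  by (rule L2I[where g = "\<lambda>x. c\<^sup>2 * (norm (f x))\<^sup>2"])
    (use f in \<open>auto intro: L2_integrable simp: power_mult_distrib\<close>)

lemma L2_zero: "(\<lambda>x. 0) \<in> L2 M"
  by (simp add: L2_def)

lemma L2_uminus: "f \<in> L2 M \<Longrightarrow> (\<lambda>x. - f x) \<in> L2 M"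
  using L2_scaleR[of f M "-1"] by simp

lemma L2_diff: "f \<in> L2 M \<Longrightarrow> g \<in> L2 M \<Longrightarrow> (\<lambda>x. f x - g x) \<in> L2 M"
  using L2_add[OF _ L2_uminus, of f M g] by simp

lemma L2_cong_AE:
  assumes "f \<in> L2 M" "g \<in> borel_measurable M" "AE x in M. f x = g x"
  shows "g \<in> L2 M"
proof -
  have "integrable M (\<lambda>x. (norm (f x))\<^sup>2) \<longleftrightarrow> integrable M (\<lambda>x. (norm (g x))\<^sup>2)"
    by (rule integrable_cong_AE) (use assms in \<open>auto simp: L2_def\<close>)
  with assms show ?thesis by (simp add: L2_def)
qed

lemma finite_measure_LI: "finite_measure LI"
  by (rule finite_measure_lebesgue_on) auto

interpretation LI: finite_measure LI by (rule finite_measure_LI)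

interpretation LII: pair_sigma_finite LI LI ..

lemma L2_const: "(\<lambda>x. c) \<in> L2 LI"
  by (simp add: L2_def)

section \<open>The inner product space of square-integrable functions\<close>

\<comment> \<open>The relation is reflexive only on \<open>L2 LI\<close>, hence
  \<open>partial\<close>. Every class has a square-integrable representative \<open>fn\<close>, but
  identities between representatives hold only almost everywhere.\<close>
quotient_type (overloaded) 'b l2 = "real \<Rightarrow> 'b::euclidean_space" / partial:
  "\<lambda>f g. f \<in> L2 LI \<and> g \<in> L2 LI \<and> (AE x in LI. f x = g x)"
proof (rule part_equivpI)
  show "\<exists>f::real \<Rightarrow> 'b. f \<in> L2 LI \<and> f \<in> L2 LI \<and> (AE x in LI. f x = f x)"
    by (intro exI[of _ "\<lambda>_. 0"]) (simp add: L2_zero)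
  show "symp (\<lambda>(f::real \<Rightarrow> 'b) g. f \<in> L2 LI \<and> g \<in> L2 LI \<and> (AE x in LI. f x = g x))"
    by (auto simp: symp_def elim!: eventually_mono)
  show "transp (\<lambda>(f::real \<Rightarrow> 'b) g. f \<in> L2 LI \<and> g \<in> L2 LI \<and> (AE x in LI. f x = g x))"
    unfolding transp_def by (auto elim!: eventually_elim2)
qed

definition l2 :: "(real \<Rightarrow> 'b::euclidean_space) \<Rightarrow> 'b l2" where "l2 = abs_l2"
definition fn :: "'b::euclidean_space l2 \<Rightarrow> real \<Rightarrow> 'b" where "fn = rep_l2"

lemma fn_L2 [simp, measurable_dest]: "fn x \<in> L2 LI"
  using Quotient_rep_reflp[OF Quotient_l2] by (simp add: fn_def)

lemma fn_measurable [measurable]: "fn x \<in> borel_measurable LI"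
  by (rule L2_measurable) simp

lemma l2_fn [simp]: "l2 (fn x) = x"
  using Quotient_abs_rep[OF Quotient_l2] by (simp add: fn_def l2_def)

lemma l2_eq_iff: "f \<in> L2 LI \<Longrightarrow> g \<in> L2 LI \<Longrightarrow> l2 f = l2 g \<longleftrightarrow> (AE u in LI. f u = g u)"
  using Quotient_rel[OF Quotient_l2, of f g] by (auto simp: l2_def)

lemma l2_eqI:
  assumes f: "f \<in> L2 LI" and g: "g \<in> borel_measurable LI" and eq: "AE u in LI. f u = g u"
  shows "l2 f = l2 g"
  using l2_eq_iff[OF f L2_cong_AE[OF f g eq]] eq by simp

lemma fn_l2: "f \<in> L2 LI \<Longrightarrow> AE u in LI. fn (l2 f) u = f u"
  using l2_eq_iff[of "fn (l2 f)" f] by simp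

instantiation l2 :: (euclidean_space) real_vector
begin

definition zero_l2 :: "'a l2" where "zero_l2 = l2 (\<lambda>_. 0)"
definition plus_l2 :: "'a l2 \<Rightarrow> 'a l2 \<Rightarrow> 'a l2" where "plus_l2 x y = l2 (\<lambda>u. fn x u + fn y u)"
definition uminus_l2 :: "'a l2 \<Rightarrow> 'a l2" where "uminus_l2 x = l2 (\<lambda>u. - fn x u)"
definition minus_l2 :: "'a l2 \<Rightarrow> 'a l2 \<Rightarrow> 'a l2" where "minus_l2 x y = l2 (\<lambda>u. fn x u - fn y u)"
definition scaleR_l2 :: "real \<Rightarrow> 'a l2 \<Rightarrow> 'a l2" where "scaleR_l2 c x = l2 (\<lambda>u. c *\<^sub>R fn x u)"

lemma fn_zero: "AE u in LI. fn (0::'a l2) u = 0"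
  unfolding zero_l2_def by (rule fn_l2[OF L2_zero])

lemma fn_add: "AE u in LI. fn (x + y) u = fn x u + fn (y::'a l2) u"
  unfolding plus_l2_def by (intro fn_l2 L2_add fn_L2)

lemma fn_uminus: "AE u in LI. fn (- x) u = - fn (x::'a l2) u"
  unfolding uminus_l2_def by (intro fn_l2 L2_uminus fn_L2)

lemma fn_diff: "AE u in LI. fn (x - y) u = fn x u - fn (y::'a l2) u"
  unfolding minus_l2_def by (intro fn_l2 L2_diff fn_L2)

lemma fn_scaleR: "AE u in LI. fn (c *\<^sub>R x) u = c *\<^sub>R fn (x::'a l2) u"
  unfolding scaleR_l2_def by (intro fn_l2 L2_scaleR fn_L2)

lemma l2_eq_fnI: "(AE u in LI. fn x u = fn y u) \<Longrightarrow> x = (y::'a l2)"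
  using l2_eq_iff[of "fn x" "fn y"] by simp

instance
proof
  fix x y z :: "'a l2" and a b :: real
  show "x + y + z = x + (y + z)"
    by (rule l2_eq_fnI, use fn_add[of "x + y" z] fn_add[of x y] fn_add[of x "y + z"] fn_add[of y z] in eventually_elim) (simp add: add_ac)
  show "x + y = y + x"
    by (rule l2_eq_fnI, use fn_add[of x y] fn_add[of y x] in eventually_elim) (simp add: add_ac)
  show "0 + x = x"
    by (rule l2_eq_fnI, use fn_add[of 0 x] fn_zero in eventually_elim) simp
  show "- x + x = 0"
    by (rule l2_eq_fnI, use fn_add[of "- x" x] fn_zero fn_uminus[of x] in eventually_elim) simp
  show "x - y = x + - y"
    by (rule l2_eq_fnI, use fn_add[of x "- y"] fn_diff[of x y] fn_uminus[of y] in eventually_elim) simp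
  show "a *\<^sub>R (x + y) = a *\<^sub>R x + a *\<^sub>R y"
    by (rule l2_eq_fnI, use fn_scaleR[of a "x + y"] fn_add[of x y] fn_add[of "a *\<^sub>R x" "a *\<^sub>R y"] fn_scaleR[of a x] fn_scaleR[of a y] in eventually_elim) (simp add: scaleR_right_distrib)
  show "(a + b) *\<^sub>R x = a *\<^sub>R x + b *\<^sub>R x"
    by (rule l2_eq_fnI, use fn_scaleR[of "a + b" x] fn_add[of "a *\<^sub>R x" "b *\<^sub>R x"] fn_scaleR[of a x] fn_scaleR[of b x] in eventually_elim) (simp add: scaleR_left_distrib)
  show "a *\<^sub>R b *\<^sub>R x = (a * b) *\<^sub>R x"
    by (rule l2_eq_fnI, use fn_scaleR[of a "b *\<^sub>R x"] fn_scaleR[of "a * b" x] fn_scaleR[of b x] in eventually_elim) simp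
  show "1 *\<^sub>R x = x"
    by (rule l2_eq_fnI, use fn_scaleR[of 1 x] in eventually_elim) simp
qed

end

instantiation l2 :: (euclidean_space) real_inner
begin

definition inner_l2 :: "'a l2 \<Rightarrow> 'a l2 \<Rightarrow> real" where
  "inner_l2 x y = (\<integral>u. inner (fn x u) (fn y u) \<partial>LI)"
definition norm_l2 :: "'a l2 \<Rightarrow> real" where "norm_l2 x = sqrt (inner x x)"
definition sgn_l2 :: "'a l2 \<Rightarrow> 'a l2" where "sgn_l2 x = x /\<^sub>R norm x"
definition dist_l2 :: "'a l2 \<Rightarrow> 'a l2 \<Rightarrow> real" where "dist_l2 x y = norm (x - y)"
definition uniformity_l2 :: "('a l2 \<times> 'a l2) filter" where
  "uniformity_l2 = (INF e\<in>{0<..}. principal {(x, y). dist x y < e})"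
definition open_l2 :: "'a l2 set \<Rightarrow> bool" where
  "open_l2 U \<longleftrightarrow> (\<forall>x\<in>U. eventually (\<lambda>(x', y). x' = x \<longrightarrow> y \<in> U) uniformity)"

instance
proof
  fix x y z :: "'a l2" and r :: real
  show "inner x y = inner y x" by (simp add: inner_l2_def inner_commute)
  have "inner (x + y) z = (\<integral>u. inner (fn x u) (fn z u) + inner (fn y u) (fn z u) \<partial>LI)"
    unfolding inner_l2_def
  proof (rule integral_cong_AE)
    show "AE u in LI. inner (fn (x + y) u) (fn z u) = inner (fn x u) (fn z u) + inner (fn y u) (fn z u)"
      using fn_add[of x y] by eventually_elim (simp add: inner_add_left)
  qed measurable
  then show "inner (x + y) z = inner x z + inner y z"
    by (simp add: inner_l2_def integrable_inner_L2)
  have "inner (r *\<^sub>R x) y = (\<integral>u. r * inner (fn x u) (fn y u) \<partial>LI)"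
    unfolding inner_l2_def
  proof (rule integral_cong_AE)
    show "AE u in LI. inner (fn (r *\<^sub>R x) u) (fn y u) = r * inner (fn x u) (fn y u)"
      using fn_scaleR[of r x] by eventually_elim simp
  qed measurable
  then show "inner (r *\<^sub>R x) y = r * inner x y" by (simp add: inner_l2_def)
  show "0 \<le> inner x x" by (simp add: inner_l2_def)
  have "inner x x = 0 \<longleftrightarrow> (AE u in LI. inner (fn x u) (fn x u) = 0)"
    unfolding inner_l2_def by (intro integral_nonneg_eq_0_iff_AE integrable_inner_L2) auto
  also have "\<dots> \<longleftrightarrow> x = 0"
    using l2_eq_iff[of "fn x" "\<lambda>_. 0"] by (simp add: zero_l2_def L2_zero)
  finally show "inner x x = 0 \<longleftrightarrow> x = 0" .
qed (simp_all add: norm_l2_def sgn_l2_def dist_l2_def uniformity_l2_def open_l2_def)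

end

lemma inner_l2:
  assumes "f \<in> L2 LI" "g \<in> L2 LI"
  shows "inner (l2 f) (l2 g) = (\<integral>u. inner (f u) (g u) \<partial>LI)"
  unfolding inner_l2_def
proof (rule integral_cong_AE)
  show "AE u in LI. inner (fn (l2 f) u) (fn (l2 g) u) = inner (f u) (g u)"
    using fn_l2[OF assms(1)] fn_l2[OF assms(2)] by eventually_elim simp
qed (use assms in measurable)

lemma norm_l2: "f \<in> L2 LI \<Longrightarrow> norm (l2 f) = L2norm LI f"
  by (simp add: norm_eq_sqrt_inner[of "l2 f"] inner_l2 L2norm_def power2_norm_eq_inner)

lemma norm_fn: "norm x = L2norm LI (fn x)"
  using norm_l2[of "fn x"] by simp

lemma l2_add: "f \<in> L2 LI \<Longrightarrow> g \<in> L2 LI \<Longrightarrow> l2 (\<lambda>u. f u + g u) = l2 f + l2 g"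
  unfolding plus_l2_def using fn_l2[of f] fn_l2[of g]
  by (intro l2_eqI L2_add) (auto elim!: eventually_elim2)

lemma l2_diff: "f \<in> L2 LI \<Longrightarrow> g \<in> L2 LI \<Longrightarrow> l2 (\<lambda>u. f u - g u) = l2 f - l2 g"
  unfolding minus_l2_def using fn_l2[of f] fn_l2[of g]
  by (intro l2_eqI L2_diff) (auto elim!: eventually_elim2)

lemma l2_scaleR: "f \<in> L2 LI \<Longrightarrow> l2 (\<lambda>u. c *\<^sub>R f u) = c *\<^sub>R l2 f"
  unfolding scaleR_l2_def using fn_l2[of f]
  by (intro l2_eqI L2_scaleR) (auto elim!: eventually_mono)

lemma l2_zero: "AE u in LI. f u = 0 \<Longrightarrow> f \<in> L2 LI \<Longrightarrow> l2 f = 0"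
  by (simp add: zero_l2_def l2_eq_iff L2_zero)

text \<open>The Cauchy-Schwarz inequality of \<open>l2\<close>, applied to the scalar functions |f|
  and |g|; in this way \<open>f\<close> and \<open>g\<close> may have different target
  spaces.\<close>

lemma integral_norm_mult_le:
  fixes f :: "real \<Rightarrow> 'b::euclidean_space" and g :: "real \<Rightarrow> 'c::euclidean_space"
  assumes f: "f \<in> L2 LI" and g: "g \<in> L2 LI"
  shows "(\<integral>u. norm (f u) * norm (g u) \<partial>LI) \<le> L2norm LI f * L2norm LI g"
proof -
  have f': "(\<lambda>u. norm (f u)) \<in> L2 LI" and g': "(\<lambda>u. norm (g u)) \<in> L2 LI"
    using f g by (auto simp: L2_def)
  show ?thesis
    using norm_cauchy_schwarz[of "l2 (\<lambda>u. norm (f u))" "l2 (\<lambda>u. norm (g u))"]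
    by (simp add: inner_l2[OF f' g'] norm_l2[OF f'] norm_l2[OF g'] L2norm_def)
qed

section \<open>Matrix and kernel operators\<close>

lemma norm_matrix_vector_le:
  fixes M :: "real^'a^'b"
  shows "norm (M *v x) \<le> norm M * norm x"
proof -
  have comp: "norm ((M *v x) $ i) \<le> norm (M $ i) * norm x" for i
    using Cauchy_Schwarz_ineq2[of "M $ i" x]
    by (simp add: matrix_vector_mult_def inner_vec_def)
  have "norm (M *v x) \<le> L2_set (\<lambda>i. norm (M $ i) * norm x) UNIV"
    unfolding norm_vec_def[of "M *v x"] by (intro L2_set_mono comp) auto
  also have "\<dots> = norm M * norm x"
    by (simp add: norm_vec_def[of M] L2_set_left_distrib)
  finally show ?thesis .
qed

lemma bounded_bilinear_matrix_vector_mult: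
  "bounded_bilinear ((*v) :: real^'a^'b \<Rightarrow> real^'a \<Rightarrow> real^'b)"
  by (rule bounded_bilinear.intro)
    (auto simp: matrix_vector_mult_add_rdistrib matrix_vector_right_distrib scaleR_matrix_vector_assoc
      matrix_vector_mult_scaleR intro!: exI[of _ 1] norm_matrix_vector_le)

lemma norm_transpose: "norm (transpose M) = norm (M :: real^'a^'b)"
proof -
  have sq: "(norm N)\<^sup>2 = (\<Sum>i\<in>UNIV. \<Sum>j\<in>UNIV. (N $ i $ j)\<^sup>2)" for N :: "real^'c^'d"
    by (simp add: norm_vec_def L2_set_def sum_nonneg)
  have "(norm (transpose M))\<^sup>2 = (norm M)\<^sup>2"
    unfolding sq transpose_def by (simp add: sum.swap[of _ "UNIV :: 'a set"])
  then show ?thesis by simp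
qed

lemma scaleR_matrix_mult: "(c *\<^sub>R M) ** N = c *\<^sub>R (M ** (N :: real^'a^'b) :: real^'a^'c)"
  by (simp add: matrix_matrix_mult_def vec_eq_iff sum_distrib_left mult_ac)

lemma matrix_mult_scaleR: "M ** (c *\<^sub>R N) = c *\<^sub>R (M ** (N :: real^'a^'b) :: real^'a^'c)"
  by (simp add: matrix_matrix_mult_def vec_eq_iff sum_distrib_left mult_ac)

lemma matrix_mult_add_left: "(M + N) ** L = M ** L + (N ** (L :: real^'a^'b) :: real^'a^'c)"
  by (simp add: matrix_matrix_mult_def vec_eq_iff distrib_right sum.distrib)

lemma bounded_bilinear_matrix_mult:
  "bounded_bilinear ((**) :: real^'b^'c \<Rightarrow> real^'a^'b \<Rightarrow> real^'a^'c)"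
  unfolding bilinear_conv_bounded_bilinear[symmetric] bilinear_def
  by (auto intro!: linearI simp: matrix_add_ldistrib matrix_mult_add_left scaleR_matrix_mult matrix_mult_scaleR)

lemma borel_measurable_bilinear:
  fixes h :: "'b::euclidean_space \<Rightarrow> 'c::euclidean_space \<Rightarrow> 'd::euclidean_space"
  assumes "bounded_bilinear h" "f \<in> borel_measurable M" "g \<in> borel_measurable M"
  shows "(\<lambda>x. h (f x) (g x)) \<in> borel_measurable M"
proof -
  have "continuous_on UNIV (\<lambda>z. h (fst z) (snd z))"
    by (intro bounded_bilinear.continuous_on[OF assms(1)] continuous_intros)
  then show ?thesis
    using borel_measurable_continuous_Pair[OF assms(2,3), of h] by (simp add: case_prod_beta')
qed

lemma measurable_matrix_vector_mult [measurable (raw)]: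
  fixes f :: "'x \<Rightarrow> real^'a^'b"
  assumes "f \<in> borel_measurable M" "g \<in> borel_measurable M"
  shows "(\<lambda>x. f x *v g x) \<in> borel_measurable M"
  by (rule borel_measurable_bilinear[OF bounded_bilinear_matrix_vector_mult assms])

lemma measurable_matrix_mult [measurable (raw)]:
  fixes f :: "'x \<Rightarrow> real^'b^'c" and g :: "'x \<Rightarrow> real^'a^'b"
  assumes "f \<in> borel_measurable M" "g \<in> borel_measurable M"
  shows "(\<lambda>x. f x ** g x) \<in> borel_measurable M"
  by (rule borel_measurable_bilinear[OF bounded_bilinear_matrix_mult assms])

lemma linear_transpose: "linear (transpose :: real^'a^'b \<Rightarrow> real^'b^'a)"
  by (rule linearI) (simp_all add: transpose_def vec_eq_iff)

lemma measurable_transpose [measurable (raw)]: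
  fixes f :: "'x \<Rightarrow> real^'a^'b"
  assumes "f \<in> borel_measurable M"
  shows "(\<lambda>x. transpose (f x)) \<in> borel_measurable M"
  using measurable_compose[OF assms borel_measurable_continuous_onI[OF
      linear_continuous_on[OF linear_conv_bounded_linear[THEN iffD1, OF linear_transpose]]]] .

lemma transpose_add: "transpose (M + N) = transpose M + (transpose N :: real^'a^'b)"
  by (rule linear_add[OF linear_transpose])

lemma transpose_scaleR: "transpose (c *\<^sub>R M) = c *\<^sub>R (transpose M :: real^'a^'b)"
  by (rule linear_scale[OF linear_transpose])

lemma L2_matrix: "f \<in> L2 M \<Longrightarrow> (\<lambda>u. (A :: real^'a^'b) *v f u) \<in> L2 M"
proof (rule L2I[where g = "\<lambda>u. (norm A)\<^sup>2 * (norm (f u))\<^sup>2"])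
  fix u show "(norm (A *v f u))\<^sup>2 \<le> (norm A)\<^sup>2 * (norm (f u))\<^sup>2"
    unfolding power_mult_distrib[symmetric] by (intro power_mono norm_matrix_vector_le) simp
qed (auto intro: L2_integrable)

text \<open>Pointwise multiplication by a constant matrix. The embedding is linear and bounded and
  respects products, transposes and quadratic lower bounds, so matrix Riccati equations and their
  derivatives become operator ones.\<close>

definition mop :: "real^'a^'b \<Rightarrow> (real^'a) l2 \<Rightarrow>\<^sub>L (real^'b) l2" where
  "mop M = Blinfun (\<lambda>x. l2 (\<lambda>u. M *v fn x u))"

lemma L2norm_mono:
  assumes "f \<in> L2 M" "g \<in> L2 M" "0 \<le> c" "AE x in M. norm (f x) \<le> c * norm (g x)"
  shows "L2norm M f \<le> c * L2norm M g"
proof -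
  have "(\<integral>x. (norm (f x))\<^sup>2 \<partial>M) \<le> (\<integral>x. c\<^sup>2 * (norm (g x))\<^sup>2 \<partial>M)"
  proof (rule integral_mono_AE)
    show "AE x in M. (norm (f x))\<^sup>2 \<le> c\<^sup>2 * (norm (g x))\<^sup>2"
      using assms(4) by eventually_elim (simp add: power_mono flip: power_mult_distrib)
  qed (use assms in \<open>auto intro: L2_integrable\<close>)
  then have "L2norm M f \<le> sqrt (c\<^sup>2 * (\<integral>x. (norm (g x))\<^sup>2 \<partial>M))"
    unfolding L2norm_def by simp
  also have "\<dots> = c * L2norm M g" using assms(3) by (simp add: L2norm_def real_sqrt_mult)
  finally show ?thesis .
qed

lemma mop_apply:
  fixes M :: "real^'a^'b"
  shows "mop M x = l2 (\<lambda>u. M *v fn x u)"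
proof -
  have "bounded_linear (\<lambda>x. l2 (\<lambda>u. M *v fn x u))"
  proof (rule bounded_linear_intro[where K = "norm M"])
    fix x y :: "(real^'a) l2" and r :: real
    show "l2 (\<lambda>u. M *v fn (x + y) u) = l2 (\<lambda>u. M *v fn x u) + l2 (\<lambda>u. M *v fn y u)"
      unfolding l2_add[OF L2_matrix L2_matrix, OF fn_L2 fn_L2, symmetric]
      by (rule l2_eqI, simp add: L2_matrix, measurable, use fn_add[of x y] in eventually_elim)
        (simp add: matrix_vector_right_distrib)
    show "l2 (\<lambda>u. M *v fn (r *\<^sub>R x) u) = r *\<^sub>R l2 (\<lambda>u. M *v fn x u)"
      unfolding l2_scaleR[OF L2_matrix, OF fn_L2, symmetric]
      by (rule l2_eqI, simp add: L2_matrix, measurable, use fn_scaleR[of r x] in eventually_elim)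
        (simp add: matrix_vector_mult_scaleR)
    show "norm (l2 (\<lambda>u. M *v fn x u)) \<le> norm x * norm M"
      using L2norm_mono[OF L2_matrix fn_L2, OF fn_L2, of "norm M" M x x]
      by (simp add: norm_l2 L2_matrix norm_fn[of x] norm_matrix_vector_le mult.commute)
  qed
  then show ?thesis by (simp add: mop_def bounded_linear_Blinfun_apply)
qed

lemma mop_l2: "f \<in> L2 LI \<Longrightarrow> mop M (l2 f) = l2 (\<lambda>u. M *v f u)"
  unfolding mop_apply
  by (rule l2_eqI, simp add: L2_matrix, measurable, use fn_l2[of f] in \<open>auto elim: eventually_mono\<close>)

lemma norm_mop_le: "norm (mop M) \<le> norm M"
proof (rule norm_blinfun_bound)
  fix x
  show "norm (mop M x) \<le> norm M * norm x"
    using L2norm_mono[OF L2_matrix fn_L2, OF fn_L2, of "norm M" M x x]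
    by (simp add: mop_apply norm_l2 L2_matrix norm_fn[of x] norm_matrix_vector_le)
qed simp

lemma inner_mop_apply: "inner x (mop M y) = (\<integral>u. inner (fn x u) (M *v fn y u) \<partial>LI)"
  using inner_l2[of "fn x" "\<lambda>u. M *v fn y u"] by (simp add: mop_apply L2_matrix)

lemma inner_matrix: "inner x (M *v y) = inner (transpose M *v x) (y :: real^'a)"
  by (simp add: dot_lmul_matrix)

lemma inner_mop: "inner x (mop M y) = inner (mop (transpose M) x) y"
  using inner_l2[of "\<lambda>u. transpose M *v fn x u" "fn y"] L2_matrix[OF fn_L2, of "transpose M" x]
  by (simp only: inner_mop_apply mop_apply[of "transpose M"] l2_fn fn_L2 inner_matrix)

lemma mop_sym:
  assumes "transpose M = M"
  shows "inner x (mop M y) = inner (mop M x) y"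
  using inner_mop[of x M y] assms by simp

lemma mop_mult: "mop (M ** N) x = mop M (mop N x)"
  by (simp add: mop_apply[of N] mop_l2 L2_matrix mop_apply[of "M ** N"] matrix_vector_mul_assoc)

lemma mop_add: "mop (M + N) = mop M + mop N"
  by (rule blinfun_eqI)
    (simp add: mop_apply blinfun.add_left l2_add[symmetric] L2_matrix matrix_vector_mult_add_rdistrib)

lemma mop_scaleR: "mop (c *\<^sub>R M) = c *\<^sub>R mop M"
  by (rule blinfun_eqI)
    (simp add: mop_apply blinfun.scaleR_left l2_scaleR[symmetric] L2_matrix scaleR_matrix_vector_assoc[symmetric])

lemma bounded_linear_mop: "bounded_linear mop"
  by (rule bounded_linear_intro[where K = 1]) (auto simp: mop_add mop_scaleR norm_mop_le)

lemma mop_diff: "mop (M - N) = mop M - mop N"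
  by (rule linear_diff[OF bounded_linear.linear[OF bounded_linear_mop]])

lemma mop_minus: "mop (- M) = - mop M"
  using mop_scaleR[of "-1" M] by simp

lemma mop_zero [simp]: "mop 0 = 0"
  by (rule linear_0[OF bounded_linear.linear[OF bounded_linear_mop]])

lemma mop_one: "mop (mat 1) x = x"
  by (simp add: mop_apply)

lemma mop_coercive:
  assumes "\<And>v. \<epsilon> * (norm v)\<^sup>2 \<le> inner v (M *v v)"
  shows "\<epsilon> * (norm x)\<^sup>2 \<le> inner x (mop M x)"
proof -
  have "\<epsilon> * (norm x)\<^sup>2 = (\<integral>u. \<epsilon> * (norm (fn x u))\<^sup>2 \<partial>LI)"
    by (simp add: norm_fn L2norm_def)
  also have "\<dots> \<le> inner x (mop M x)"
    unfolding inner_mop_apply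
    by (intro integral_mono integrable_mult_right L2_integrable integrable_inner_L2 assms fn_L2 L2_matrix)
  finally show ?thesis .
qed

text \<open>The minimum over the compact unit sphere provides the uniform constant that is needed on
  the infinite-dimensional space.\<close>

lemma pd_mat_coercive:
  fixes M :: "real^'a^'a"
  assumes "pd_mat M"
  obtains \<epsilon> where "\<epsilon> > 0" "\<And>v. \<epsilon> * (norm v)\<^sup>2 \<le> inner v (M *v v)"
proof -
  have cont: "continuous_on (sphere 0 1) (\<lambda>v. inner v (M *v v))"
    by (intro continuous_intros)
  have ne: "sphere (0::real^'a) 1 \<noteq> {}" by simp
  obtain v0 where v0: "v0 \<in> sphere 0 1" "\<And>v. v \<in> sphere 0 1 \<Longrightarrow> inner v0 (M *v v0) \<le> inner v (M *v v)"
    using continuous_attains_inf[OF compact_sphere ne cont] by blast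
  show ?thesis
  proof (rule that[of "inner v0 (M *v v0)"])
    show "inner v0 (M *v v0) > 0" using assms v0(1) by (cases "v0 = 0") (auto simp: pd_mat_def)
    fix v
    show "inner v0 (M *v v0) * (norm v)\<^sup>2 \<le> inner v (M *v v)"
    proof (cases "v = 0")
      case False
      with v0(2)[of "v /\<^sub>R norm v"] show ?thesis
        by (simp add: matrix_vector_mult_scaleR field_simps power2_eq_square)
    qed simp
  qed
qed

text \<open>\<open>matrix_inv\<close> is defined by choice and says something only once
  invertibility is known; here that follows from the trivial kernel.\<close>

lemma pd_mat_inverse:
  fixes M :: "real^'a^'a"
  assumes "pd_mat M"
  shows "M ** matrix_inv M = mat 1" "matrix_inv M ** M = mat 1" "transpose (matrix_inv M) = matrix_inv M"
proof -
  have "M *v x = 0 \<longrightarrow> x = 0" for x using assms by (auto simp: pd_mat_def)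
  then have "\<exists>B. B ** M = mat 1"
    by (auto simp: matrix_left_invertible_ker)
  then have inv: "invertible M"
    using matrix_left_right_inverse by (auto simp: invertible_def)
  show 1: "M ** matrix_inv M = mat 1" and 2: "matrix_inv M ** M = mat 1"
    using someI_ex[OF inv[unfolded invertible_def]] by (auto simp: matrix_inv_def)
  have "transpose (matrix_inv M) = transpose (matrix_inv M) ** (M ** matrix_inv M)" by (simp add: 1)
  also have "\<dots> = transpose (M ** matrix_inv M) ** matrix_inv M"
    using assms by (simp add: pd_mat_def sym_mat_def matrix_transpose_mul matrix_mul_assoc)
  finally show "transpose (matrix_inv M) = matrix_inv M" by (simp add: 1)
qed

section \<open>Fubini for products, and operators with square-integrable kernels\<close>

lemma (in pair_sigma_finite) integrable_tensor:
  fixes k g :: "_ \<Rightarrow> real"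
  assumes k: "integrable M1 k" and g: "integrable M2 g"
  shows "integrable (M1 \<Otimes>\<^sub>M M2) (\<lambda>(x, y). k x * g y)"
    and "(\<integral>(x, y). k x * g y \<partial>(M1 \<Otimes>\<^sub>M M2)) = (\<integral>x. k x \<partial>M1) * (\<integral>y. g y \<partial>M2)"
proof -
  have [measurable]: "k \<in> borel_measurable M1" "g \<in> borel_measurable M2"
    using k g by auto
  show *: "integrable (M1 \<Otimes>\<^sub>M M2) (\<lambda>(x, y). k x * g y)"
  proof (rule Fubini_integrable)
    show "integrable M1 (\<lambda>x. \<integral>y. norm (case (x, y) of (x, y) \<Rightarrow> k x * g y) \<partial>M2)"
      using k by (simp add: abs_mult)
    show "AE x in M1. integrable M2 (\<lambda>y. case (x, y) of (x, y) \<Rightarrow> k x * g y)"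
      using g by simp
  qed measurable
  show "(\<integral>(x, y). k x * g y \<partial>(M1 \<Otimes>\<^sub>M M2)) = (\<integral>x. k x \<partial>M1) * (\<integral>y. g y \<partial>M2)"
    using integral_fst'[OF *] by simp
qed

interpretation finite_LII: finite_measure LII
  by (rule finite_measure_pair_measure) unfold_locales

interpretation LIII: pair_sigma_finite LI LII ..

text \<open>Supplies the dominating functions for the triple integral in
  \<open>has_kform_comp\<close>: two of the variables enter through \<open>k\<close>, the third
  through \<open>g\<close>.\<close>

lemma integrable_tensor_triple:
  fixes k :: "real \<Rightarrow> real \<Rightarrow> real" and g :: "real \<Rightarrow> real"
  assumes k: "integrable LII (case_prod k)" and g: "integrable LI g"
  shows "integrable (LI \<Otimes>\<^sub>M LII) (\<lambda>(w, u, v). k w u * g v)"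
    and "integrable (LI \<Otimes>\<^sub>M LII) (\<lambda>(w, u, v). k w v * g u)"
proof -
  have [measurable]: "case_prod k \<in> borel_measurable LII" "g \<in> borel_measurable LI"
    using k g by auto
  have AEk: "AE w in LI. integrable LI (k w)"
    using LII.AE_integrable_fst'[OF k] by simp
  define m where "m w = (\<integral>u. \<bar>k w u\<bar> \<partial>LI) * (\<integral>v. \<bar>g v\<bar> \<partial>LI)" for w
  have m: "integrable LI m"
    unfolding m_def using LII.integrable_fst'[OF integrable_norm[OF k]] by simp
  have *: "integrable (LI \<Otimes>\<^sub>M LII) (\<lambda>(w, z). f w z)"
    if meas: "case_prod f \<in> borel_measurable (LI \<Otimes>\<^sub>M LII)"
      and f: "\<And>w. integrable LI (k w) \<Longrightarrow> integrable LII (f w) \<and> (\<integral>z. norm (f w z) \<partial>LII) = m w"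
    for f :: "real \<Rightarrow> real \<times> real \<Rightarrow> real"
  proof (rule LIII.Fubini_integrable[OF meas])
    have "integrable LI (\<lambda>w. \<integral>z. norm (f w z) \<partial>LII)"
      by (rule integrable_cong_AE[THEN iffD2, OF _ _ _ m])
        (use meas m AEk f in \<open>auto elim: eventually_mono\<close>)
    then show "integrable LI (\<lambda>w. \<integral>z. norm (case_prod f (w, z)) \<partial>LII)" by simp
    show "AE w in LI. integrable LII (\<lambda>z. case_prod f (w, z))"
      using AEk f by (auto elim: eventually_mono)
  qed
  have "integrable (LI \<Otimes>\<^sub>M LII) (\<lambda>(w, z). case z of (u, v) \<Rightarrow> k w u * g v)"
    using LII.integrable_tensor[OF _ g] LII.integrable_tensor(2)[OF integrable_abs integrable_abs[OF g]]
    by (intro *) (auto simp: m_def case_prod_beta' abs_mult)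
  then show "integrable (LI \<Otimes>\<^sub>M LII) (\<lambda>(w, u, v). k w u * g v)" by (simp add: case_prod_beta')
  have "integrable (LI \<Otimes>\<^sub>M LII) (\<lambda>(w, z). case z of (u, v) \<Rightarrow> g u * k w v)"
    using LII.integrable_tensor[OF g] LII.integrable_tensor(2)[OF integrable_abs[OF g] integrable_abs]
    by (intro *) (auto simp: m_def mult.commute[of "\<integral>u. \<bar>k _ u\<bar> \<partial>LI"] case_prod_beta' abs_mult)
  then show "integrable (LI \<Otimes>\<^sub>M LII) (\<lambda>(w, u, v). k w v * g u)" by (simp add: case_prod_beta' mult.commute)
qed

lemma L2_section:
  fixes K :: "real \<Rightarrow> real \<Rightarrow> 'b::euclidean_space"
  assumes K: "case_prod K \<in> L2 LII"
  shows "AE u in LI. K u \<in> L2 LI"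
proof -
  have [measurable]: "case_prod K \<in> borel_measurable LII" using K by (rule L2_measurable)
  have "AE u in LI. integrable LI (\<lambda>v. (norm (K u v))\<^sup>2)"
    using LII.AE_integrable_fst'[OF L2_integrable[OF K]] by simp
  then show ?thesis
    using AE_space
  proof eventually_elim
    case (elim u)
    then have "K u \<in> borel_measurable LI"
      using measurable_compose[OF measurable_Pair1'[OF elim(2), of LI] L2_measurable[OF K]] by simp
    with elim show ?case by (simp add: L2_def)
  qed
qed

lemma integrable_matrix_vector:
  fixes A :: "'x \<Rightarrow> real^'a^'b"
  assumes A: "A \<in> L2 M" and f: "f \<in> L2 M"
  shows "integrable M (\<lambda>v. A v *v f v)"
  by (rule Bochner_Integration.integrable_bound[OF integrable_norm_mult_L2[OF A f]])
    (use A f in \<open>auto simp: norm_matrix_vector_le\<close>)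

text \<open>Cauchy-Schwarz on almost every section K(u, .), then integration in u: the
  Hilbert-Schmidt bound. The function \<open>k\<close> in the proof is the integrable majorant
  obtained from the sections.\<close>

lemma kernel_apply_L2:
  fixes K :: "real \<Rightarrow> real \<Rightarrow> real^'a^'b"
  assumes K: "case_prod K \<in> L2 LII" and f: "f \<in> L2 LI"
  shows "(\<lambda>u. \<integral>v. K u v *v f v \<partial>LI) \<in> L2 LI"
    and "L2norm LI (\<lambda>u. \<integral>v. K u v *v f v \<partial>LI) \<le> L2norm LII (case_prod K) * L2norm LI f"
proof -
  have [measurable]: "case_prod K \<in> borel_measurable LII" "f \<in> borel_measurable LI"
    using K f by (auto intro: L2_measurable)
  define k where "k u = (\<integral>v. (norm (K u v))\<^sup>2 \<partial>LI) * (L2norm LI f)\<^sup>2" for u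
  have nn: "0 \<le> k u" for u by (simp add: k_def)
  have ik: "integrable LI k"
    using LII.integrable_fst'[OF L2_integrable[OF K]] by (simp add: k_def[abs_def])
  have meas: "(\<lambda>u. \<integral>v. K u v *v f v \<partial>LI) \<in> borel_measurable LI" by measurable
  have bound: "AE u in LI. (norm (\<integral>v. K u v *v f v \<partial>LI))\<^sup>2 \<le> k u"
    using L2_section[OF K]
  proof eventually_elim
    case (elim u)
    have "norm (\<integral>v. K u v *v f v \<partial>LI) \<le> (\<integral>v. norm (K u v) * norm (f v) \<partial>LI)"
      by (rule order_trans[OF integral_norm_bound integral_mono[OF
              integrable_norm[OF integrable_matrix_vector[OF elim f]] integrable_norm_mult_L2[OF elim f]]])
        (rule norm_matrix_vector_le)
    also have "\<dots> \<le> L2norm LI (K u) * L2norm LI f" by (rule integral_norm_mult_le[OF elim f])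
    finally have "(norm (\<integral>v. K u v *v f v \<partial>LI))\<^sup>2 \<le> (L2norm LI (K u) * L2norm LI f)\<^sup>2"
      by (rule power_mono) simp
    then show ?case by (simp add: k_def L2norm_def power_mult_distrib)
  qed
  have int: "integrable LI (\<lambda>u. (norm (\<integral>v. K u v *v f v \<partial>LI))\<^sup>2)"
  proof (rule Bochner_Integration.integrable_bound[OF ik])
    show "AE u in LI. norm ((norm (\<integral>v. K u v *v f v \<partial>LI))\<^sup>2) \<le> norm (k u)"
      using bound by eventually_elim (simp add: nn)
  qed measurable
  then show "(\<lambda>u. \<integral>v. K u v *v f v \<partial>LI) \<in> L2 LI" using meas by (simp add: L2_def)
  have "(\<integral>u. (norm (\<integral>v. K u v *v f v \<partial>LI))\<^sup>2 \<partial>LI) \<le> (\<integral>u. k u \<partial>LI)"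
    by (rule integral_mono_AE[OF int ik bound])
  also have "\<dots> = (L2norm LII (case_prod K) * L2norm LI f)\<^sup>2"
    using LII.integral_fst'[OF L2_integrable[OF K]]
    by (simp add: k_def[abs_def] power_mult_distrib L2norm_def)
  finally have "sqrt (\<integral>u. (norm (\<integral>v. K u v *v f v \<partial>LI))\<^sup>2 \<partial>LI)
      \<le> sqrt ((L2norm LII (case_prod K) * L2norm LI f)\<^sup>2)" by (rule real_sqrt_le_mono)
  also have "\<dots> = L2norm LII (case_prod K) * L2norm LI f"
    by (simp add: L2norm_def)
  finally show "L2norm LI (\<lambda>u. \<integral>v. K u v *v f v \<partial>LI) \<le> L2norm LII (case_prod K) * L2norm LI f"
    by (simp add: L2norm_def)
qed

lemma kernel_apply_cong:
  fixes K :: "real \<Rightarrow> real \<Rightarrow> real^'a^'b"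
  assumes K: "case_prod K \<in> L2 LII" and f: "f \<in> L2 LI" and g: "g \<in> L2 LI"
    and eq: "AE v in LI. f v = g v"
  shows "l2 (\<lambda>u. \<integral>v. K u v *v f v \<partial>LI) = l2 (\<lambda>u. \<integral>v. K u v *v g v \<partial>LI)"
proof (rule l2_eqI[OF kernel_apply_L2(1)[OF K f] L2_measurable[OF kernel_apply_L2(1)[OF K g]]])
  show "AE u in LI. (\<integral>v. K u v *v f v \<partial>LI) = (\<integral>v. K u v *v g v \<partial>LI)"
    using L2_section[OF K]
  proof eventually_elim
    case (elim u)
    note [measurable] = L2_measurable[OF elim] L2_measurable[OF f] L2_measurable[OF g]
    show ?case
      by (rule integral_cong_AE, measurable) (use eq in \<open>auto elim: eventually_mono\<close>)
  qed
qed

text \<open>Only meaningful for \<open>K\<close> in \<open>L\<^sup>2(I \<times> I)\<close>.\<close>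

definition kop :: "(real \<Rightarrow> real \<Rightarrow> real^'a^'b) \<Rightarrow> (real^'a) l2 \<Rightarrow>\<^sub>L (real^'b) l2" where
  "kop K = Blinfun (\<lambda>x. l2 (\<lambda>u. \<integral>v. K u v *v fn x v \<partial>LI))"

lemma kop_apply:
  fixes K :: "real \<Rightarrow> real \<Rightarrow> real^'a^'b"
  assumes K: "case_prod K \<in> L2 LII"
  shows "kop K x = l2 (\<lambda>u. \<integral>v. K u v *v fn x v \<partial>LI)"
proof -
  have "bounded_linear (\<lambda>x. l2 (\<lambda>u. \<integral>v. K u v *v fn x v \<partial>LI))"
  proof (rule bounded_linear_intro[where K = "L2norm LII (case_prod K)"])
    fix x y :: "(real^'a) l2" and r :: real
    note KL2 = kernel_apply_L2(1)[OF K fn_L2] and xy = L2_add[OF fn_L2 fn_L2, of x y]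
    have "AE u in LI. (\<integral>v. K u v *v (fn x v + fn y v) \<partial>LI)
        = (\<integral>v. K u v *v fn x v \<partial>LI) + (\<integral>v. K u v *v fn y v \<partial>LI)"
      using L2_section[OF K]
      by eventually_elim (simp add: matrix_vector_right_distrib integrable_matrix_vector)
    then have "l2 (\<lambda>u. \<integral>v. K u v *v (fn x v + fn y v) \<partial>LI)
        = l2 (\<lambda>u. \<integral>v. K u v *v fn x v \<partial>LI) + l2 (\<lambda>u. \<integral>v. K u v *v fn y v \<partial>LI)"
      unfolding l2_add[OF KL2 KL2, symmetric]
      by (intro l2_eqI kernel_apply_L2(1)[OF K xy] L2_measurable[OF L2_add[OF KL2 KL2]])
    then show "l2 (\<lambda>u. \<integral>v. K u v *v fn (x + y) v \<partial>LI)
        = l2 (\<lambda>u. \<integral>v. K u v *v fn x v \<partial>LI) + l2 (\<lambda>u. \<integral>v. K u v *v fn y v \<partial>LI)"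
      using kernel_apply_cong[OF K fn_L2 xy fn_add] by simp
    show "l2 (\<lambda>u. \<integral>v. K u v *v fn (r *\<^sub>R x) v \<partial>LI) = r *\<^sub>R l2 (\<lambda>u. \<integral>v. K u v *v fn x v \<partial>LI)"
      using kernel_apply_cong[OF K fn_L2 L2_scaleR[OF fn_L2] fn_scaleR, of r x]
      by (simp add: matrix_vector_mult_scaleR l2_scaleR[OF KL2])
    show "norm (l2 (\<lambda>u. \<integral>v. K u v *v fn x v \<partial>LI)) \<le> norm x * L2norm LII (case_prod K)"
      using kernel_apply_L2[OF K fn_L2, of x] by (simp add: norm_l2 norm_fn[of x] mult.commute)
  qed
  then show ?thesis by (simp add: kop_def bounded_linear_Blinfun_apply)
qed

lemma norm_kop_le:
  assumes K: "case_prod K \<in> L2 LII"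
  shows "norm (kop K) \<le> L2norm LII (case_prod K)"
proof (rule norm_blinfun_bound)
  show "norm (kop K x) \<le> L2norm LII (case_prod K) * norm x" for x
    using kernel_apply_L2[OF K fn_L2, of x] by (simp add: kop_apply[OF K] norm_l2 norm_fn[of x])
qed (simp add: L2norm_def)

lemma kop_l2:
  assumes K: "case_prod K \<in> L2 LII" and f: "f \<in> L2 LI"
  shows "kop K (l2 f) = l2 (\<lambda>u. \<integral>v. K u v *v f v \<partial>LI)"
  unfolding kop_apply[OF K] by (rule kernel_apply_cong[OF K fn_L2 f fn_l2[OF f]])

text \<open>The kernels \<open>\<integral>K(w,u)\<^sup>T J(w,v) dw\<close> in the equation for \<open>\<Lambda>\<close> enter only through their bilinear
  forms, so it need not be shown that they are square-integrable themselves.\<close>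

definition has_kform ::
  "(real \<Rightarrow> real \<Rightarrow> real^'a^'b) \<Rightarrow> (real^'b) l2 \<Rightarrow> (real^'a) l2 \<Rightarrow> real \<Rightarrow> bool" where
  "has_kform K x y r \<longleftrightarrow> has_bochner_integral LII (\<lambda>(u, v). inner (fn x u) (K u v *v fn y v)) r"

lemma has_kform_unique: "has_kform K x y r \<Longrightarrow> has_kform K x y r' \<Longrightarrow> r = r'"
  unfolding has_kform_def by (rule has_bochner_integral_eq)

lemma has_kform_add:
  assumes "has_kform K x y r" "has_kform J x y s"
  shows "has_kform (\<lambda>u v. K u v + J u v) x y (r + s)"
  using has_bochner_integral_add[OF assms[unfolded has_kform_def]]
  by (simp add: has_kform_def case_prod_beta' matrix_vector_mult_add_rdistrib inner_add_right)

lemma has_kform_diff: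
  assumes "has_kform K x y r" "has_kform J x y s"
  shows "has_kform (\<lambda>u v. K u v - J u v) x y (r - s)"
  using has_bochner_integral_diff[OF assms[unfolded has_kform_def]]
  by (simp add: has_kform_def case_prod_beta' matrix_vector_mult_diff_rdistrib inner_diff_right)

lemma has_kform_scaleR:
  assumes "has_kform K x y r"
  shows "has_kform (\<lambda>u v. c *\<^sub>R K u v) x y (c * r)"
  using has_bochner_integral_mult_right[of c, OF assms[unfolded has_kform_def]]
  by (simp add: has_kform_def case_prod_beta' scaleR_matrix_vector_assoc[symmetric])

lemma has_kform_transpose:
  assumes "has_kform K x y r"
  shows "has_kform (\<lambda>u v. transpose (K v u)) y x r"
proof -
  have f: "integrable LII (\<lambda>(u, v). inner (fn x u) (K u v *v fn y v))"
    and r: "(\<integral>(u, v). inner (fn x u) (K u v *v fn y v) \<partial>LII) = r"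
    using assms by (auto simp: has_kform_def has_bochner_integral_iff)
  have eq: "inner (fn y u) (transpose (K v u) *v fn x v) = inner (fn x v) (K v u *v fn y u)" for u v
    by (simp add: inner_matrix inner_commute)
  show ?thesis
    using LII.integrable_product_swap[OF f] LII.integral_product_swap[OF borel_measurable_integrable[OF f]] r
    by (simp add: has_kform_def has_bochner_integral_iff case_prod_beta' eq del: transpose_matrix_vector)
qed

lemma integrable_kform:
  fixes K :: "real \<Rightarrow> real \<Rightarrow> real^'a^'b"
  assumes K: "case_prod K \<in> L2 LII"
  shows "integrable LII (\<lambda>(u, v). inner (fn x u) (K u v *v fn y v))"
proof (rule Bochner_Integration.integrable_bound)
  have [measurable]: "case_prod K \<in> borel_measurable LII" using K by (rule L2_measurable)
  have t: "(\<lambda>(u, v). norm (fn x u) * norm (fn y v)) \<in> L2 LII"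
    using LII.integrable_tensor(1)[OF L2_integrable[OF fn_L2] L2_integrable[OF fn_L2], of x y]
    by (simp add: L2_def case_prod_beta' power_mult_distrib)
  show "integrable LII (\<lambda>z. norm (case z of (u, v) \<Rightarrow> norm (fn x u) * norm (fn y v)) * norm (case_prod K z))"
    by (rule integrable_norm_mult_L2[OF t K])
  show "(\<lambda>(u, v). inner (fn x u) (K u v *v fn y v)) \<in> borel_measurable LII" by measurable
  have "\<bar>inner a (A *v b)\<bar> \<le> norm a * norm b * norm A" for a :: "real^'b" and A :: "real^'a^'b" and b
  proof -
    have "\<bar>inner a (A *v b)\<bar> \<le> norm a * norm (A *v b)" by (rule Cauchy_Schwarz_ineq2)
    also have "\<dots> \<le> norm a * (norm A * norm b)"
      by (intro mult_left_mono norm_matrix_vector_le) simp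
    finally show ?thesis by (simp add: mult_ac)
  qed
  then show "AE z in LII. norm (case z of (u, v) \<Rightarrow> inner (fn x u) (K u v *v fn y v))
      \<le> norm (norm (case z of (u, v) \<Rightarrow> norm (fn x u) * norm (fn y v)) * norm (case_prod K z))"
    by (intro AE_I2) (simp add: case_prod_beta' abs_mult)
qed

lemma has_kform_kop:
  fixes K :: "real \<Rightarrow> real \<Rightarrow> real^'a^'b"
  assumes K: "case_prod K \<in> L2 LII"
  shows "has_kform K x y (inner x (kop K y))"
proof -
  have [measurable]: "case_prod K \<in> borel_measurable LII" using K by (rule L2_measurable)
  have "inner x (kop K y) = (\<integral>u. inner (fn x u) (\<integral>v. K u v *v fn y v \<partial>LI) \<partial>LI)"
    using inner_l2[OF fn_L2 kernel_apply_L2(1)[OF K fn_L2], of x y] by (simp add: kop_apply[OF K])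
  also have "\<dots> = (\<integral>u. (\<integral>v. inner (fn x u) (K u v *v fn y v) \<partial>LI) \<partial>LI)"
  proof (rule integral_cong_AE)
    show "AE u in LI. inner (fn x u) (\<integral>v. K u v *v fn y v \<partial>LI) = (\<integral>v. inner (fn x u) (K u v *v fn y v) \<partial>LI)"
      using L2_section[OF K]
      by eventually_elim (simp add: integrable_matrix_vector)
  qed measurable
  also have "\<dots> = (\<integral>(u, v). inner (fn x u) (K u v *v fn y v) \<partial>LII)"
    using LII.integral_fst'[OF integrable_kform[OF K]] by simp
  finally show ?thesis
    using integrable_kform[OF K] by (simp add: has_kform_def has_bochner_integral_iff)
qed

lemma kop_eqI:
  fixes A :: "(real^'a) l2 \<Rightarrow>\<^sub>L (real^'b) l2"
  assumes "case_prod K \<in> L2 LII" "\<And>x y. has_kform K x y (inner x (A y))"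
  shows "kop K = A"
proof (rule blinfun_eqI)
  fix y
  have "\<forall>x. inner x (kop K y) = inner x (A y)"
    using has_kform_unique[OF has_kform_kop[OF assms(1)] assms(2)] by blast
  then show "kop K y = A y" by (simp add: vector_eq_ldot)
qed

lemma L2_kernel_add: "case_prod K \<in> L2 M \<Longrightarrow> case_prod J \<in> L2 M \<Longrightarrow> (\<lambda>(u, v). K u v + J u v) \<in> L2 M"
  and L2_kernel_diff: "case_prod K \<in> L2 M \<Longrightarrow> case_prod J \<in> L2 M \<Longrightarrow> (\<lambda>(u, v). K u v - J u v) \<in> L2 M"
  and L2_kernel_scaleR: "case_prod K \<in> L2 M \<Longrightarrow> (\<lambda>(u, v). a *\<^sub>R K u v) \<in> L2 M"
  using L2_add[of "case_prod K" M "case_prod J"] L2_diff[of "case_prod K" M "case_prod J"]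
    L2_scaleR[of "case_prod K" M a] by (simp_all add: case_prod_beta')

lemma kop_add:
  assumes "case_prod K \<in> L2 LII" "case_prod J \<in> L2 LII"
  shows "kop (\<lambda>u v. K u v + J u v) = kop K + kop J"
  by (rule kop_eqI[OF L2_kernel_add[OF assms]]) (use has_kform_add[OF assms[THEN has_kform_kop]] in \<open>simp add: blinfun.add_left inner_add_right\<close>)

lemma kop_scaleR:
  assumes "case_prod K \<in> L2 LII"
  shows "kop (\<lambda>u v. c *\<^sub>R K u v) = c *\<^sub>R kop K"
  by (rule kop_eqI[OF L2_kernel_scaleR[OF assms]]) (use has_kform_scaleR[OF assms[THEN has_kform_kop]] in \<open>simp add: blinfun.scaleR_left\<close>)

lemma kop_diff:
  assumes "case_prod K \<in> L2 LII" "case_prod J \<in> L2 LII"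
  shows "kop (\<lambda>u v. K u v - J u v) = kop K - kop J"
  by (rule kop_eqI[OF L2_kernel_diff[OF assms]]) (use has_kform_diff[OF assms[THEN has_kform_kop]] in \<open>simp add: blinfun.diff_left inner_diff_right\<close>)

lemma L2_swap: "case_prod K \<in> L2 LII \<Longrightarrow> (\<lambda>(u, v). K v u) \<in> L2 LII"
  using LII.integrable_product_swap[of "\<lambda>z. (norm (case_prod K z))\<^sup>2"] measurable_pair_swap[of "case_prod K" LI LI borel]
  by (simp add: L2_def case_prod_beta')

lemma L2_transpose:
  fixes K :: "real \<Rightarrow> real \<Rightarrow> real^'a^'b"
  assumes "case_prod K \<in> L2 LII"
  shows "(\<lambda>(u, v). transpose (K v u)) \<in> L2 LII"
  using L2_swap[OF assms] by (simp add: L2_def case_prod_beta' norm_transpose measurable_transpose)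

lemma inner_kop_transpose:
  assumes "case_prod K \<in> L2 LII"
  shows "inner x (kop (\<lambda>u v. transpose (K v u)) y) = inner (kop K x) y"
  using has_kform_unique[OF has_kform_kop[OF L2_transpose[OF assms]] has_kform_transpose[OF has_kform_kop[OF assms]]]
  by (simp add: inner_commute)

lemma norm_matrix_mult_bound:
  obtains c where "c \<ge> 0" "\<And>(M :: real^'b^'c) (N :: real^'a^'b). norm (M ** N) \<le> c * (norm M * norm N)"
  using bounded_bilinear.nonneg_bounded[OF bounded_bilinear_matrix_mult] by (metis mult.commute mult.assoc)

lemma L2_matrix_left:
  fixes K :: "real \<Rightarrow> real \<Rightarrow> real^'a^'b" and M :: "real^'b^'c"
  assumes K: "case_prod K \<in> L2 LII"
  shows "(\<lambda>(u, v). M ** K u v) \<in> L2 LII"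
proof -
  obtain c where c: "c \<ge> 0" "\<And>(M :: real^'b^'c) (N :: real^'a^'b). norm (M ** N) \<le> c * (norm M * norm N)"
    using norm_matrix_mult_bound by blast
  have [measurable]: "case_prod K \<in> borel_measurable LII" using K by (rule L2_measurable)
  show ?thesis
  proof (rule L2I)
    show "(\<lambda>(u, v). M ** K u v) \<in> borel_measurable LII" by measurable
    show "integrable LII (\<lambda>z. (c * norm M)\<^sup>2 * (norm (case_prod K z))\<^sup>2)" using K by (auto intro: L2_integrable)
    show "(norm (case z of (u, v) \<Rightarrow> M ** K u v))\<^sup>2 \<le> (c * norm M)\<^sup>2 * (norm (case_prod K z))\<^sup>2" for z
      unfolding power_mult_distrib[symmetric]
      using c(2)[of M "case_prod K z"] by (intro power_mono) (simp_all add: case_prod_beta' mult.assoc)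
  qed
qed

lemma kop_left:
  fixes K :: "real \<Rightarrow> real \<Rightarrow> real^'a^'b" and M :: "real^'b^'c"
  assumes K: "case_prod K \<in> L2 LII"
  shows "kop (\<lambda>u v. M ** K u v) y = mop M (kop K y)"
proof -
  have [measurable]: "case_prod K \<in> borel_measurable LII" using K by (rule L2_measurable)
  have "kop (\<lambda>u v. M ** K u v) y = l2 (\<lambda>u. \<integral>v. (M ** K u v) *v fn y v \<partial>LI)"
    by (rule kop_apply[OF L2_matrix_left[OF K]])
  also have "\<dots> = l2 (\<lambda>u. M *v (\<integral>v. K u v *v fn y v \<partial>LI))"
  proof (rule l2_eqI[OF kernel_apply_L2(1)[OF L2_matrix_left[OF K] fn_L2]])
    show "AE u in LI. (\<integral>v. (M ** K u v) *v fn y v \<partial>LI) = M *v (\<integral>v. K u v *v fn y v \<partial>LI)"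
      using L2_section[OF K]
      by eventually_elim
        (simp add: matrix_vector_mul_assoc[symmetric] integral_bounded_linear[OF matrix_vector_mul_bounded_linear]
          integrable_matrix_vector)
  qed measurable
  also have "\<dots> = mop M (kop K y)"
    by (simp add: kop_apply[OF K] mop_l2 kernel_apply_L2(1)[OF K])
  finally show ?thesis .
qed

text \<open>The kernel belongs to the adjoint of \<open>kop K\<close> composed with
  \<open>kop J\<close>. Fubini brings the integral over w to the outside, where the integrand splits
  into the two applied kernels.\<close>

lemma has_kform_comp:
  fixes K :: "real \<Rightarrow> real \<Rightarrow> real^'a^'c" and J :: "real \<Rightarrow> real \<Rightarrow> real^'b^'c"
  assumes K: "case_prod K \<in> L2 LII" and J: "case_prod J \<in> L2 LII"
  shows "has_kform (\<lambda>u v. \<integral>w. transpose (K w u) ** J w v \<partial>LI) x y (inner (kop K x) (kop J y))"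
proof -
  have [measurable]: "case_prod K \<in> borel_measurable LII" "case_prod J \<in> borel_measurable LII"
    using K J by (auto intro: L2_measurable)
  have K2: "integrable LII (\<lambda>(w, u). (norm (K w u))\<^sup>2)" and J2: "integrable LII (\<lambda>(w, u). (norm (J w u))\<^sup>2)"
    using L2_integrable[OF K] L2_integrable[OF J] by (simp_all add: case_prod_beta')
  define f where "f = (\<lambda>(w, u, v). inner (K w u *v fn x u) (J w v *v fn y v))"
  have f_meas: "f \<in> borel_measurable (LI \<Otimes>\<^sub>M LII)" unfolding f_def by measurable
  have f_le: "\<bar>inner (A *v a) (B *v b)\<bar> \<le> (norm A)\<^sup>2 * (norm b)\<^sup>2 + (norm B)\<^sup>2 * (norm a)\<^sup>2"
    for A :: "real^'a^'c" and B :: "real^'b^'c" and a b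
  proof -
    have "\<bar>inner (A *v a) (B *v b)\<bar> \<le> norm (A *v a) * norm (B *v b)" by (rule Cauchy_Schwarz_ineq2)
    also have "\<dots> \<le> (norm A * norm a) * (norm B * norm b)"
      by (intro mult_mono norm_matrix_vector_le) auto
    \<comment> \<open>The factors are regrouped crosswise, so that each square is a function of two
      variables times a function of the third. In the direct grouping a term such as |K(w,u)|^2
      |x(u)|^2 would arise, which need not be integrable.\<close>
    also have "\<dots> = (norm A * norm b) * (norm B * norm a)" by (simp add: mult_ac)
    also have "\<dots> \<le> (norm A * norm b)\<^sup>2 + (norm B * norm a)\<^sup>2"
    proof -
      have "p * q \<le> p\<^sup>2 + q\<^sup>2" if "0 \<le> p" "0 \<le> q" for p q :: real
        using sum_squares_bound[of p q] mult_nonneg_nonneg[OF that] by linarith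
      then show ?thesis by simp
    qed
    finally show ?thesis by (simp add: power_mult_distrib)
  qed
  have f_int: "integrable (LI \<Otimes>\<^sub>M LII) f"
  proof (rule Bochner_Integration.integrable_bound)
    show "integrable (LI \<Otimes>\<^sub>M LII) (\<lambda>z. (case z of (w, u, v) \<Rightarrow> (norm (K w u))\<^sup>2 * (norm (fn y v))\<^sup>2)
        + (case z of (w, u, v) \<Rightarrow> (norm (J w v))\<^sup>2 * (norm (fn x u))\<^sup>2))"
      by (intro Bochner_Integration.integrable_add integrable_tensor_triple K2 J2 L2_integrable fn_L2)
    show "AE z in LI \<Otimes>\<^sub>M LII. norm (f z)
        \<le> norm ((case z of (w, u, v) \<Rightarrow> (norm (K w u))\<^sup>2 * (norm (fn y v))\<^sup>2)
        + (case z of (w, u, v) \<Rightarrow> (norm (J w v))\<^sup>2 * (norm (fn x u))\<^sup>2))"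
      by (intro AE_I2) (auto simp: f_def split: prod.splits intro!: order_trans[OF f_le])
  qed (rule f_meas)
  have one: "integrable LI (\<lambda>u. 1 :: real)" by simp
  have AEK: "AE z in LII. integrable LI (\<lambda>w. (norm (K w (fst z)))\<^sup>2)"
  proof -
    have "integrable (LI \<Otimes>\<^sub>M LII) (case_prod (\<lambda>w z. (norm (K w (fst z)))\<^sup>2))"
      using integrable_tensor_triple(1)[OF K2 one] by (simp add: case_prod_beta')
    from LIII.AE_integrable_snd[OF this] show ?thesis .
  qed
  have AEJ: "AE z in LII. integrable LI (\<lambda>w. (norm (J w (snd z)))\<^sup>2)"
  proof -
    have "integrable (LI \<Otimes>\<^sub>M LII) (case_prod (\<lambda>w z. (norm (J w (snd z)))\<^sup>2))"
      using integrable_tensor_triple(2)[OF J2 one] by (simp add: case_prod_beta')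
    from LIII.AE_integrable_snd[OF this] show ?thesis .
  qed
  obtain c where c: "c \<ge> 0" "\<And>(M :: real^'c^'a) (N :: real^'b^'c). norm (M ** N) \<le> c * (norm M * norm N)"
    using norm_matrix_mult_bound by blast
  define g where "g = (\<lambda>w z. f (w, z))"
  have g_int: "integrable (LI \<Otimes>\<^sub>M LII) (case_prod g)" using f_int by (simp add: g_def)
  \<comment> \<open>Integrability of the matrix product in w, for almost every (u, v), is what
    allows x and y to be pulled out of the inner integral; a non-integrable one would have the
    default value 0.\<close>
  have inner_z: "AE z in LII. (\<integral>w. g w z \<partial>LI)
      = (case z of (u, v) \<Rightarrow> inner (fn x u) ((\<integral>w. transpose (K w u) ** J w v \<partial>LI) *v fn y v))"
    using AEK AEJ AE_space
  proof eventually_elim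
    case (elim z)
    obtain u v where z: "z = (u, v)" by (cases z)
    have uv: "u \<in> space LI" "v \<in> space LI" using elim(3) by (auto simp: z space_pair_measure)
    have Ku: "(\<lambda>w. K w u) \<in> borel_measurable LI" and Jv: "(\<lambda>w. J w v) \<in> borel_measurable LI"
      using measurable_compose[OF measurable_Pair2'[OF uv(1), of LI] L2_measurable[OF K]]
        measurable_compose[OF measurable_Pair2'[OF uv(2), of LI] L2_measurable[OF J]] by simp_all
    have Ku2: "(\<lambda>w. K w u) \<in> L2 LI" and Jv2: "(\<lambda>w. J w v) \<in> L2 LI"
      using elim Ku Jv by (auto simp: L2_def z)
    have int: "integrable LI (\<lambda>w. transpose (K w u) ** J w v)"
    proof (rule Bochner_Integration.integrable_bound)
      show "integrable LI (\<lambda>w. c * (norm (K w u) * norm (J w v)))"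
        using integrable_norm_mult_L2[OF Ku2 Jv2] by simp
      show "(\<lambda>w. transpose (K w u) ** J w v) \<in> borel_measurable LI" using Ku Jv by measurable
      show "AE w in LI. norm (transpose (K w u) ** J w v) \<le> norm (c * (norm (K w u) * norm (J w v)))"
        using c(2)[of "transpose (K w u)" "J w v" for w] c(1) by (simp add: norm_transpose abs_mult)
    qed
    have eq: "g w z = inner (fn x u) ((transpose (K w u) ** J w v) *v fn y v)" for w
      using inner_matrix[of "fn x u" "transpose (K w u)" "J w v *v fn y v"]
      by (simp add: g_def f_def z matrix_vector_mul_assoc[symmetric] del: transpose_matrix_vector)
    have "bounded_linear (\<lambda>A. inner (fn x u) (A *v fn y v))"
      by (intro bounded_linear_compose[OF bounded_linear_inner_right]
          bounded_bilinear.bounded_linear_left[OF bounded_bilinear_matrix_vector_mult])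
    from integral_bounded_linear[OF this int] show ?case unfolding eq by (simp add: z)
  qed
  have meas_rhs: "(\<lambda>(u, v). inner (fn x u) ((\<integral>w. transpose (K w u) ** J w v \<partial>LI) *v fn y v))
      \<in> borel_measurable LII" by measurable
  have int_rhs: "integrable LII (\<lambda>(u, v). inner (fn x u) ((\<integral>w. transpose (K w u) ** J w v \<partial>LI) *v fn y v))"
    using LIII.integrable_snd[OF g_int] integrable_cong_AE[OF _ meas_rhs inner_z]
      borel_measurable_integrable[OF LIII.integrable_snd[OF g_int]] by blast
  have "(\<integral>(u, v). inner (fn x u) ((\<integral>w. transpose (K w u) ** J w v \<partial>LI) *v fn y v) \<partial>LII)
      = (\<integral>z. (\<integral>w. g w z \<partial>LI) \<partial>LII)"
    using integral_cong_AE[OF borel_measurable_integrable[OF LIII.integrable_snd[OF g_int]] meas_rhs inner_z] by simp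
  also have "\<dots> = (\<integral>w. (\<integral>z. g w z \<partial>LII) \<partial>LI)"
    by (rule LIII.Fubini_integral[OF g_int])
  also have "\<dots> = (\<integral>w. inner (\<integral>u. K w u *v fn x u \<partial>LI) (\<integral>v. J w v *v fn y v \<partial>LI) \<partial>LI)"
  proof (rule integral_cong_AE)
    show "(\<lambda>w. \<integral>z. g w z \<partial>LII) \<in> borel_measurable LI"
      using borel_measurable_integrable[OF LIII.integrable_fst'[OF f_int]] by (simp add: g_def)
    show "AE w in LI. (\<integral>z. g w z \<partial>LII) = inner (\<integral>u. K w u *v fn x u \<partial>LI) (\<integral>v. J w v *v fn y v \<partial>LI)"
      using L2_section[OF K] L2_section[OF J] LIII.AE_integrable_fst'[OF f_int]
    proof eventually_elim
      case (elim w)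
      have iK: "integrable LI (\<lambda>u. K w u *v fn x u)" and iJ: "integrable LI (\<lambda>v. J w v *v fn y v)"
        using elim by (auto intro: integrable_matrix_vector)
      have "(\<integral>z. g w z \<partial>LII) = (\<integral>u. (\<integral>v. g w (u, v) \<partial>LI) \<partial>LI)"
        using LII.integral_fst'[OF elim(3)] by (simp add: g_def)
      then show ?case by (simp add: g_def f_def iK iJ)
    qed
  qed measurable
  also have "\<dots> = inner (kop K x) (kop J y)"
    by (simp add: kop_apply K J inner_l2 kernel_apply_L2(1))
  finally show ?thesis
    using int_rhs by (simp add: has_kform_def has_bochner_integral_iff)
qed

section \<open>The operator Riccati equation\<close>

lemma L2_scaleR_matrix:
  fixes M :: "real^'a^'b"
  assumes g: "case_prod g \<in> L2 LII"
  shows "(\<lambda>(u, v). g u v *\<^sub>R M) \<in> L2 LII"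
proof -
  have "(\<lambda>z. case_prod g z *\<^sub>R M) \<in> L2 LII"
    by (rule L2I[where g = "\<lambda>z. (norm (case_prod g z))\<^sup>2 * (norm M)\<^sup>2"])
      (use g L2_integrable[OF g] in \<open>auto simp: power_mult_distrib\<close>)
  then show ?thesis by (simp add: case_prod_beta')
qed

lemma inner_mop_transpose: "inner x (mop (transpose M) y) = inner (mop M x) y"
  using inner_mop[of x "transpose M" y] by simp

lemma has_kform_AE_zero:
  assumes "has_kform K x y r" "AE (u, v) in LII. K u v = 0"
  shows "r = 0"
proof -
  have "(\<integral>(u, v). inner (fn x u) (K u v *v fn y v) \<partial>LII) = 0"
    by (rule integral_eq_zero_AE) (use assms(2) in \<open>auto elim!: eventually_mono\<close>)
  then show ?thesis using assms(1) by (simp add: has_kform_def has_bochner_integral_iff)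
qed

lemma psd_mat_sym: "psd_mat M \<Longrightarrow> transpose M = M"
  by (simp add: psd_mat_def sym_mat_def)

type_synonym 'n l2_op = "(real^'n) l2 \<Rightarrow>\<^sub>L (real^'n) l2"

definition opG :: "('d::finite, 'm::finite) lq_data \<Rightarrow> 'd l2_op" where
  "opG c = kop (\<lambda>u v. cG c u v *\<^sub>R mat 1)"

definition opA :: "('d::finite, 'm::finite) lq_data \<Rightarrow> 'd l2_op" where
  "opA c = mop (cA c + cAb c) + (mop (cAt c) o\<^sub>L opG c)"

definition opC :: "('d::finite, 'm::finite) lq_data \<Rightarrow> 'd l2_op" where
  "opC c = mop (cC c + cCb c) + (mop (cCt c) o\<^sub>L opG c)"

definition opX :: "real^'d^'d \<Rightarrow> (real \<Rightarrow> real \<Rightarrow> real^'d^'d) \<Rightarrow> 'd l2_op" where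
  "opX Pib L = mop Pib + kop L"

text \<open>The operator counterpart of M-hat, with the graphon part \<open>Upsilon_map\<close>
  included (see \<open>opN_split\<close>). The optimal feedback is minus the inverse of R(P) applied
  to it.\<close>

definition opN :: "('d::finite, 'm::finite) lq_data \<Rightarrow> real^'d^'d \<Rightarrow> 'd l2_op
    \<Rightarrow> (real^'d) l2 \<Rightarrow> (real^'m) l2" where
  "opN c P X x = mop (transpose (cB c)) (X x) + mop (transpose (cD c)) (mop P (opC c x)) + mop (cS c) x"

definition state_cost :: "('d::finite, 'm::finite) lq_data \<Rightarrow> (real^'d) l2 \<Rightarrow> (real^'d) l2 \<Rightarrow> real" where
  "state_cost c x y = inner x (mop (cQ c + cQb c) y) + inner x (mop (cQt c) (opG c y))
     + inner (opG c x) (mop (cQc c) (opG c y))"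

text \<open>The Riccati right-hand side of the whole graphon system: \<open>opA\<close> and
  \<open>opC\<close> merge the local coefficients with those carried by the graphon. No symmetry of
  \<open>X\<close> is built in, because it has to be proved from this form.\<close>

definition ric_bilinear :: "('d::finite, 'm::finite) lq_data \<Rightarrow> real^'d^'d \<Rightarrow> 'd l2_op
    \<Rightarrow> (real^'d) l2 \<Rightarrow> (real^'d) l2 \<Rightarrow> real" where
  "ric_bilinear c P X x y = inner (opA c x) (X y) + inner (X x) (opA c y)
     + inner (opC c x) (mop P (opC c y)) + state_cost c x y
     - inner (opN c P X x) (mop (matrix_inv (R_map c P)) (opN c P X y))"

text \<open>The added term \<open>D\<^sup>T P D\<close> is nonnegative, so a lower bound of R
  persists with the same constant for every P \<ge> 0.\<close>

lemma R_map_coercive: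
  assumes "psd_mat P" "\<epsilon> * (norm v)\<^sup>2 \<le> inner v (cR c *v v)"
  shows "\<epsilon> * (norm v)\<^sup>2 \<le> inner v (R_map c P *v v)"
proof -
  have "inner v (transpose (cD c) ** P ** cD c *v v) = inner (cD c *v v) (P *v (cD c *v v))"
    using inner_matrix[of v "transpose (cD c)" "P *v (cD c *v v)"]
    by (simp add: matrix_vector_mul_assoc[symmetric] del: transpose_matrix_vector)
  also have "\<dots> \<ge> 0" using assms(1) by (simp add: psd_mat_def)
  finally show ?thesis
    using assms by (simp add: R_map_def matrix_vector_mult_add_rdistrib inner_add_right)
qed

lemma pd_R_map:
  assumes "psd_mat P" "pd_mat (cR c)"
  shows "pd_mat (R_map c P)"
proof -
  obtain \<epsilon> where \<epsilon>: "\<epsilon> > 0" "\<And>v. \<epsilon> * (norm v)\<^sup>2 \<le> inner v (cR c *v v)"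
    using pd_mat_coercive[OF assms(2)] by blast
  have "transpose (R_map c P) = R_map c P"
    using assms by (simp add: R_map_def transpose_add matrix_transpose_mul psd_mat_def pd_mat_def
        sym_mat_def matrix_mul_assoc)
  moreover have "0 < inner v (R_map c P *v v)" if "v \<noteq> 0" for v
  proof -
    have "0 < \<epsilon> * (norm v)\<^sup>2" using \<epsilon>(1) that by simp
    then show ?thesis using R_map_coercive[OF assms(1) \<epsilon>(2), of v] by linarith
  qed
  ultimately show ?thesis by (simp add: pd_mat_def sym_mat_def)
qed

locale graphon_lq =
  fixes c :: "('d::finite, 'm::finite) lq_data"
  assumes adm: "admissible_data c"
begin

lemma G_L2: "case_prod (cG c) \<in> L2 LII"
  using adm by (simp add: admissible_data_def)

lemma pd_R: "pd_mat (cR c)"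
  using adm by (simp add: admissible_data_def)

lemma G_matrix_L2: "(\<lambda>(u, v). cG c u v *\<^sub>R (M :: real^'a^'b)) \<in> L2 LII"
  by (rule L2_scaleR_matrix[OF G_L2])

lemma kop_G: "kop (\<lambda>u v. cG c u v *\<^sub>R (M :: real^'d^'b)) x = mop M (opG c x)"
proof -
  have "(\<lambda>u v. cG c u v *\<^sub>R M) = (\<lambda>u v. M ** (cG c u v *\<^sub>R mat 1))"
    by (simp add: matrix_mult_scaleR)
  then show ?thesis using kop_left[OF G_matrix_L2] by (simp add: opG_def)
qed

lemma Upsilon_L2:
  assumes "case_prod L \<in> L2 LII"
  shows "case_prod (Upsilon_map c P L) \<in> L2 LII"
  using L2_add[OF L2_matrix_left[OF assms, of "transpose (cB c)"] G_matrix_L2[of "transpose (cD c) ** P ** cCt c"]]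
  by (simp add: Upsilon_map_def case_prod_beta')

lemma kop_Upsilon:
  assumes "case_prod L \<in> L2 LII"
  shows "kop (Upsilon_map c P L) x
    = mop (transpose (cB c)) (kop L x) + mop (transpose (cD c)) (mop P (mop (cCt c) (opG c x)))"
proof -
  have "kop (Upsilon_map c P L) = kop (\<lambda>u v. transpose (cB c) ** L u v + cG c u v *\<^sub>R (transpose (cD c) ** P ** cCt c))"
    by (simp add: Upsilon_map_def[abs_def])
  also have "\<dots> = kop (\<lambda>u v. transpose (cB c) ** L u v) + kop (\<lambda>u v. cG c u v *\<^sub>R (transpose (cD c) ** P ** cCt c))"
    by (rule kop_add[OF L2_matrix_left[OF assms] G_matrix_L2])
  finally show ?thesis by (simp add: blinfun.add_left kop_left[OF assms] kop_G mop_mult)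
qed

lemma opN_split:
  assumes "case_prod L \<in> L2 LII"
  shows "opN c P (opX Pib L) x = mop (Mhat_map c P (Pib - P)) x + kop (Upsilon_map c P L) x"
  by (simp add: opN_def opX_def opC_def Mhat_map_def kop_Upsilon[OF assms] mop_add mop_mult
      blinfun.add_left blinfun.add_right algebra_simps)

text \<open>Expanding \<open>ric_bilinear\<close> at \<open>opX Pib L\<close> separates the products
  of constant matrices, which make up the equation for \<open>\<Pi>\<close>-bar, from fourteen terms
  that contain a kernel. The latter are exactly the terms of F.\<close>

lemma has_kform_F:
  assumes L: "case_prod L \<in> L2 LII" and P: "psd_mat P" and Pib: "psd_mat Pib"
  shows "has_kform (F_map c P (Pib - P) L) x y
    (ric_bilinear c P (opX Pib L) x y - (inner (mop (cA c + cAb c) x) (mop Pib y)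
       + inner (mop Pib x) (mop (cA c + cAb c) y)
       + inner (mop (cC c + cCb c) x) (mop P (mop (cC c + cCb c) y)) + inner x (mop (cQ c + cQb c) y)
       - inner (mop (Mhat_map c P (Pib - P)) x)
           (mop (matrix_inv (R_map c P)) (mop (Mhat_map c P (Pib - P)) y))))"
proof -
  let ?G = "opG c" and ?Mh = "Mhat_map c P (Pib - P)" and ?U = "Upsilon_map c P L"
    and ?Ri = "matrix_inv (R_map c P)"
  note sP = psd_mat_sym[OF P] and sPib = psd_mat_sym[OF Pib]
  have sR: "transpose ?Ri = ?Ri"
    by (rule pd_mat_inverse[OF pd_R_map[OF P pd_R]])
  note U = Upsilon_L2[OF L, of P]
  have kG: "has_kform (\<lambda>u v. cG c u v *\<^sub>R M) x y (inner x (mop M (?G y)))" for M :: "real^'d^'d" and x y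
    using has_kform_kop[OF G_matrix_L2[of M], of x y] by (simp add: kop_G)
  have kGt: "has_kform (\<lambda>u v. cG c v u *\<^sub>R M) x y (inner (mop (transpose M) (?G x)) y)" for M :: "real^'d^'d"
    using has_kform_transpose[OF kG[of "transpose M" y x]]
    by (simp add: transpose_scaleR inner_commute)
  have comp: "has_kform (\<lambda>u v. \<integral>w. f w u v \<partial>LI) x y (inner (kop K x) (kop J y))"
    if "case_prod K \<in> L2 LII" "case_prod J \<in> L2 LII" "\<And>w u v. f w u v = transpose (K w u) ** (J w v :: real^'d^'k)"
    for f and K :: "real \<Rightarrow> real \<Rightarrow> real^'d^'k::finite" and J
    using has_kform_comp[OF that(1,2), of x y] by (simp add: that(3))
  \<comment> \<open>From here on, one summand of \<open>F_map\<close> at a time; the term with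
    Q-tilde is an instance of \<open>kG\<close>. The sum P + (Pib - P) collapses to Pib.\<close>
  have p1: "has_kform (\<lambda>u v. cG c u v *\<^sub>R ((P + (Pib - P)) ** cAt c)) x y (inner (mop Pib x) (mop (cAt c) (?G y)))"
    using kG[of "Pib ** cAt c" x y] by (simp add: mop_mult mop_sym[OF sPib])
  have p2: "has_kform (\<lambda>u v. cG c v u *\<^sub>R (transpose (cAt c) ** (P + (Pib - P)))) x y
      (inner (mop (cAt c) (?G x)) (mop Pib y))"
    using kGt[of "transpose (cAt c) ** Pib"] by (simp add: matrix_transpose_mul sPib mop_mult mop_sym[OF sPib])
  have p3: "has_kform (\<lambda>u v. cG c u v *\<^sub>R (transpose (cC c + cCb c) ** P ** cCt c)) x y
      (inner (mop (cC c + cCb c) x) (mop P (mop (cCt c) (?G y))))"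
    using kG[of "transpose (cC c + cCb c) ** P ** cCt c" x y] by (simp add: mop_mult inner_mop_transpose)
  have p4: "has_kform (\<lambda>u v. cG c v u *\<^sub>R (transpose (cCt c) ** P ** (cC c + cCb c))) x y
      (inner (mop (cCt c) (?G x)) (mop P (mop (cC c + cCb c) y)))"
    using kGt[of "transpose (cCt c) ** P ** (cC c + cCb c)"]
    by (simp add: matrix_transpose_mul sP mop_mult inner_mop[symmetric] mop_sym[OF sP, symmetric])
  have p5: "has_kform (\<lambda>u v. \<integral>w. (cG c w u * cG c w v) *\<^sub>R (transpose (cCt c) ** P ** cCt c) \<partial>LI) x y
      (inner (mop (cCt c) (?G x)) (mop P (mop (cCt c) (?G y))))"
    using comp[OF G_matrix_L2 G_matrix_L2,
        of "\<lambda>w u v. (cG c w u * cG c w v) *\<^sub>R (transpose (cCt c) ** P ** cCt c)" "cCt c" "P ** cCt c"]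
    by (simp add: transpose_scaleR scaleR_matrix_mult matrix_mult_scaleR matrix_mul_assoc kop_G mop_mult)
  have p6: "has_kform (\<lambda>u v. transpose (cA c + cAb c) ** L u v) x y
      (inner (mop (cA c + cAb c) x) (kop L y))" for x y
    using has_kform_kop[OF L2_matrix_left[OF L], of "transpose (cA c + cAb c)" x y]
    by (simp add: kop_left[OF L] inner_mop_transpose)
  have p7: "has_kform (\<lambda>u v. transpose (L v u) ** (cA c + cAb c)) x y
      (inner (kop L x) (mop (cA c + cAb c) y))"
    using has_kform_transpose[OF p6[of y x]] by (simp add: matrix_transpose_mul inner_commute)
  have p8: "has_kform (\<lambda>u v. \<integral>w. cG c w v *\<^sub>R (transpose (L w u) ** cAt c) \<partial>LI) x y
      (inner (kop L x) (mop (cAt c) (?G y)))"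
    using comp[OF L G_matrix_L2, of "\<lambda>w u v. cG c w v *\<^sub>R (transpose (L w u) ** cAt c)" "cAt c"]
    by (simp add: matrix_mult_scaleR kop_G)
  have p9: "has_kform (\<lambda>u v. \<integral>w. cG c w u *\<^sub>R (transpose (cAt c) ** L w v) \<partial>LI) x y
      (inner (mop (cAt c) (?G x)) (kop L y))"
    using comp[OF G_matrix_L2 L, of "\<lambda>w u v. cG c w u *\<^sub>R (transpose (cAt c) ** L w v)" "cAt c"]
    by (simp add: scaleR_matrix_mult transpose_scaleR kop_G)
  have p11: "has_kform (\<lambda>u v. \<integral>w. (cG c w u * cG c w v) *\<^sub>R cQc c \<partial>LI) x y
      (inner (?G x) (mop (cQc c) (?G y)))"
    using comp[OF G_matrix_L2 G_matrix_L2, of "\<lambda>w u v. (cG c w u * cG c w v) *\<^sub>R cQc c" "mat 1" "cQc c"]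
    by (simp add: transpose_scaleR scaleR_matrix_mult matrix_mult_scaleR kop_G mop_one)
  have m1: "has_kform (\<lambda>u v. transpose ?Mh ** ?Ri ** ?U u v) x y (inner (mop ?Mh x) (mop ?Ri (kop ?U y)))" for x y
    using has_kform_kop[OF L2_matrix_left[OF U], of "transpose ?Mh ** ?Ri" x y]
    by (simp add: kop_left[OF U] mop_mult inner_mop_transpose)
  have m2: "has_kform (\<lambda>u v. transpose (?U v u) ** ?Ri ** ?Mh) x y (inner (kop ?U x) (mop ?Ri (mop ?Mh y)))"
  proof -
    have "inner (mop ?Mh y) (mop ?Ri (kop ?U x)) = inner (kop ?U x) (mop ?Ri (mop ?Mh y))"
      using mop_sym[OF sR, of "mop ?Mh y" "kop ?U x"] by (simp add: inner_commute)
    then show ?thesis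
      using has_kform_transpose[OF m1[of y x]] by (simp add: matrix_transpose_mul sR matrix_mul_assoc)
  qed
  have m3: "has_kform (\<lambda>u v. \<integral>w. transpose (?U w u) ** ?Ri ** ?U w v \<partial>LI) x y
      (inner (kop ?U x) (mop ?Ri (kop ?U y)))"
    using comp[OF U L2_matrix_left[OF U], of "\<lambda>w u v. transpose (?U w u) ** ?Ri ** ?U w v" ?Ri]
    by (simp add: matrix_mul_assoc kop_left[OF U])
  note F = has_kform_diff[OF has_kform_diff[OF has_kform_diff[OF
      has_kform_add[OF has_kform_add[OF has_kform_add[OF has_kform_add[OF has_kform_add[OF
      has_kform_add[OF has_kform_add[OF has_kform_add[OF has_kform_add[OF has_kform_add[OF
      p1 p2] p3] p4] p5] p6] p7] p8] p9] kG[of "cQt c"]] p11] m1] m2] m3]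
  show ?thesis
    unfolding F_map_def[abs_def] Psi1_map_def
    by (rule F[THEN back_subst[of "has_kform _ x y"]])
      (simp add: ric_bilinear_def opN_split[OF L, unfolded opX_def] opA_def opC_def opX_def state_cost_def
        blinfun.add_left blinfun.add_right inner_add_left inner_add_right)
qed

text \<open>The matrix equation accounts for the part subtracted in \<open>has_kform_F\<close>, the
  kernel equation for the rest; added together they leave the complete Riccati form.\<close>

lemma operator_riccati:
  assumes L: "case_prod L \<in> L2 LII" and L': "case_prod L' \<in> L2 LII"
    and P: "psd_mat P" and Pib: "psd_mat Pib"
    and Pib_eq: "Pib' + Qhat_map c P (Pib - P)
       - transpose (Mhat_map c P (Pib - P)) ** matrix_inv (R_map c P) ** Mhat_map c P (Pib - P) = 0"
    and L_eq: "AE (u, v) in LII. L' u v + F_map c P (Pib - P) L u v = 0"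
  shows "inner x (opX Pib' L' y) + ric_bilinear c P (opX Pib L) x y = 0"
proof -
  let ?Mh = "Mhat_map c P (Pib - P)" and ?Ri = "matrix_inv (R_map c P)"
  note sPib = psd_mat_sym[OF Pib]
  define r where "r = inner (mop (cA c + cAb c) x) (mop Pib y)
       + inner (mop Pib x) (mop (cA c + cAb c) y)
       + inner (mop (cC c + cCb c) x) (mop P (mop (cC c + cCb c) y)) + inner x (mop (cQ c + cQb c) y)
       - inner (mop ?Mh x) (mop ?Ri (mop ?Mh y))"
  have "inner x (mop (Pib' + Qhat_map c P (Pib - P) - transpose ?Mh ** ?Ri ** ?Mh) y) = 0"
    unfolding Pib_eq by simp
  then have 1: "inner x (mop Pib' y) + r = 0"
    unfolding Qhat_map_def r_def
    by (simp add: mop_diff mop_add[of _ "cQb c"] mop_add[of _ "cQ c"] mop_add[of _ "_ ** _"] mop_add[of Pib']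
        blinfun.diff_left blinfun.add_left mop_mult inner_mop_transpose inner_diff_right inner_add_right
        mop_sym[OF sPib])
  have "inner x (kop L' y) + (ric_bilinear c P (opX Pib L) x y - r) = 0"
    using has_kform_AE_zero[OF has_kform_add[OF has_kform_kop[OF L'] has_kform_F[OF L P Pib]] L_eq, of x y]
    unfolding r_def by simp
  with 1 show ?thesis by (simp add: opX_def blinfun.add_left inner_add_right)
qed

end

section \<open>The equation for \<open>p\<close>\<close>

text \<open>Couples a function with its class, so that an equation between functions is carried over
  term by term. Membership in \<open>L2 LI\<close> travels along, since the class is meaningful only
  with it.\<close>

definition has_l2 :: "(real \<Rightarrow> 'b::euclidean_space) \<Rightarrow> 'b l2 \<Rightarrow> bool" where
  "has_l2 f a \<longleftrightarrow> f \<in> L2 LI \<and> l2 f = a"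

lemma has_l2_add: "has_l2 f a \<Longrightarrow> has_l2 g b \<Longrightarrow> has_l2 (\<lambda>u. f u + g u) (a + b)"
  by (auto simp: has_l2_def L2_add l2_add)

lemma has_l2_diff: "has_l2 f a \<Longrightarrow> has_l2 g b \<Longrightarrow> has_l2 (\<lambda>u. f u - g u) (a - b)"
  by (auto simp: has_l2_def L2_diff l2_diff)

lemma has_l2_mop: "has_l2 f a \<Longrightarrow> has_l2 (\<lambda>u. M *v f u) (mop M a)"
  by (auto simp: has_l2_def L2_matrix mop_l2)

lemma has_l2_kop:
  "case_prod K \<in> L2 LII \<Longrightarrow> has_l2 f a \<Longrightarrow> has_l2 (\<lambda>u. \<integral>v. K u v *v f v \<partial>LI) (kop K a)"
  by (auto simp: has_l2_def kernel_apply_L2(1) kop_l2)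

lemma has_l2_const: "has_l2 (\<lambda>_. v) (l2 (\<lambda>_. v))"
  by (simp add: has_l2_def L2_const)

lemma mop_const: "mop M (l2 (\<lambda>_. v)) = l2 (\<lambda>_. M *v v)"
  by (rule mop_l2[OF L2_const])

context graphon_lq
begin

definition gam :: "real^'d^'d \<Rightarrow> (real^'d) l2 \<Rightarrow> (real^'m) l2" where
  "gam P q = mop (transpose (cD c)) (mop P (l2 (\<lambda>_. csigma c))) + mop (transpose (cB c)) q"

lemma has_l2_Gamma:
  assumes "has_l2 p q"
  shows "has_l2 (Gamma_map c P p) (gam P q)"
  using has_l2_add[OF has_l2_const[of "(transpose (cD c) ** P) *v csigma c"] has_l2_mop[OF assms, of "transpose (cB c)"]]
  by (simp add: Gamma_map_def[abs_def] gam_def mop_const matrix_vector_mul_assoc)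

text \<open>The graphon is scalar-valued, so its operator commutes with constant matrices. This is
  needed to recognize \<open>opA\<close> and \<open>opC\<close> after adjoints have been moved to
  the test vector.\<close>

lemma opG_mop: "opG c (mop M x) = mop M (opG c x)"
proof -
  have "opG c (mop M x) = l2 (\<lambda>u. \<integral>v. (cG c u v *\<^sub>R mat 1) *v (M *v fn x v) \<partial>LI)"
    by (simp only: opG_def mop_apply[of M] kop_l2[OF G_matrix_L2 L2_matrix[OF fn_L2]])
  also have "\<dots> = kop (\<lambda>u v. cG c u v *\<^sub>R M) x"
    by (simp add: kop_apply[OF G_matrix_L2] scaleR_matrix_vector_assoc[symmetric])
  finally show ?thesis by (simp add: kop_G)
qed

text \<open>Testing with \<open>x\<close> moves all coefficients onto \<open>x\<close>, where they
  combine to \<open>opA\<close>, \<open>opC\<close>, \<open>opX\<close> and \<open>opN\<close>.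
  Symmetry of \<open>kop L\<close> identifies the symmetrized kernel in front of \<open>b\<close>
  with \<open>L\<close>.\<close>

lemma weak_p_equation:
  assumes L: "case_prod L \<in> L2 LII" and P: "psd_mat P" and Pib: "psd_mat Pib"
    and symL: "\<And>x y. inner x (kop L y) = inner (kop L x) y"
    and p: "has_l2 p q" and p': "has_l2 p' q'"
    and eq: "AE u in LI. p' u + Ft_map c P (Pib - P) L p u = 0"
  shows "inner x q' + inner (opA c x) q + inner (opX Pib L x) (l2 (\<lambda>_. cb c))
    + inner (opC c x) (mop P (l2 (\<lambda>_. csigma c)))
    - inner (opN c P (opX Pib L) x) (mop (matrix_inv (R_map c P)) (gam P q)) = 0"
proof -
  let ?Mh = "Mhat_map c P (Pib - P)" and ?U = "Upsilon_map c P L" and ?Ri = "matrix_inv (R_map c P)"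
  let ?K = "\<lambda>u v. transpose (cG c v u *\<^sub>R (mat 1 :: real^'d^'d))"
  note sPib = psd_mat_sym[OF Pib]
  have sR: "transpose ?Ri = ?Ri" by (rule pd_mat_inverse[OF pd_R_map[OF P pd_R]])
  note U = Upsilon_L2[OF L, of P]
  note K = L2_transpose[OF G_matrix_L2[of "mat 1 :: real^'d^'d"]]
  note \<Gamma> = has_l2_Gamma[OF p, of P]
  have Keq: "?K u v *v w = cG c v u *\<^sub>R w" for u v w
    by (simp add: transpose_scaleR scaleR_matrix_vector_assoc[symmetric] del: transpose_matrix_vector)
  have q2: "has_l2 (\<lambda>u. transpose (cAt c) *v (\<integral>v. cG c v u *\<^sub>R p v \<partial>LI)) (mop (transpose (cAt c)) (kop ?K q))"
    using has_l2_mop[OF has_l2_kop[OF K p]] unfolding Keq .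
  have q3: "has_l2 (\<lambda>u. (P + (Pib - P)) *v cb c) (mop Pib (l2 (\<lambda>_. cb c)))"
    using has_l2_const[of "Pib *v cb c"] by (simp add: mop_const)
  have q4: "has_l2 (\<lambda>u. (transpose (cC c + cCb c) ** P) *v csigma c)
      (mop (transpose (cC c + cCb c)) (mop P (l2 (\<lambda>_. csigma c))))"
    using has_l2_const[of "(transpose (cC c + cCb c) ** P) *v csigma c"]
    by (simp add: mop_const matrix_vector_mul_assoc)
  have q5: "has_l2 (\<lambda>u. transpose (cCt c) *v (\<integral>v. cG c v u *\<^sub>R (P *v csigma c) \<partial>LI))
      (mop (transpose (cCt c)) (kop ?K (mop P (l2 (\<lambda>_. csigma c)))))"
    using has_l2_mop[OF has_l2_kop[OF K has_l2_const]] unfolding Keq mop_const .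
  let ?L = "\<lambda>u v. (1/2) *\<^sub>R (L u v + transpose (L v u))"
  have Lt: "case_prod (\<lambda>u v. transpose (L v u)) \<in> L2 LII"
    using L2_transpose[OF L] by simp
  note Ls = L2_kernel_add[OF L Lt] and L2s = L2_kernel_scaleR[OF L2_kernel_add[OF L Lt], of "1/2"]
  have q6: "has_l2 (\<lambda>u. \<integral>v. ?L u v *v cb c \<partial>LI) (kop ?L (l2 (\<lambda>_. cb c)))"
    by (rule has_l2_kop[OF L2s has_l2_const])
  have kL: "kop ?L z = (1/2) *\<^sub>R (kop L z + kop (\<lambda>u v. transpose (L v u)) z)" for z
    by (simp only: kop_scaleR[OF Ls] kop_add[OF L Lt] blinfun.scaleR_left blinfun.add_left)
  have ikL: "inner x (kop ?L z) = inner (kop L x) z" for z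
    unfolding kL by (simp add: inner_add_right inner_kop_transpose[OF L] symL)
  have q7: "has_l2 (\<lambda>u. (transpose ?Mh ** ?Ri) *v Gamma_map c P p u) (mop (transpose ?Mh) (mop ?Ri (gam P q)))"
    using has_l2_mop[OF \<Gamma>, of "transpose ?Mh ** ?Ri"] by (simp add: mop_mult)
  have Ueq: "transpose (?U v u) ** ?Ri = transpose (?Ri ** ?U v u)" for u v
    by (simp add: matrix_transpose_mul sR)
  note RU = L2_matrix_left[OF U, of ?Ri]
  have q8: "has_l2 (\<lambda>u. \<integral>v. (transpose (?U v u) ** ?Ri) *v Gamma_map c P p v \<partial>LI)
      (kop (\<lambda>u v. transpose (?Ri ** ?U v u)) (gam P q))"
    unfolding Ueq by (rule has_l2_kop[OF L2_transpose[OF RU] \<Gamma>])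
  have F: "has_l2 (Ft_map c P (Pib - P) L p)
      (mop (transpose (cA c + cAb c)) q + mop (transpose (cAt c)) (kop ?K q)
       + mop Pib (l2 (\<lambda>_. cb c)) + mop (transpose (cC c + cCb c)) (mop P (l2 (\<lambda>_. csigma c)))
       + mop (transpose (cCt c)) (kop ?K (mop P (l2 (\<lambda>_. csigma c)))) + kop ?L (l2 (\<lambda>_. cb c))
       - mop (transpose ?Mh) (mop ?Ri (gam P q))
       - kop (\<lambda>u v. transpose (?Ri ** ?U v u)) (gam P q))" (is "has_l2 _ ?F")
    unfolding Ft_map_def[abs_def] Psi2_map_def
    by (intro has_l2_diff has_l2_add q2 q3 q4 q5 q6 q7 q8 has_l2_mop p)
  have "l2 (\<lambda>u. p' u + Ft_map c P (Pib - P) L p u) = 0"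
    using has_l2_add[OF p' F] by (intro l2_zero[OF eq]) (simp add: has_l2_def)
  then have "q' + ?F = 0" using has_l2_add[OF p' F] by (simp add: has_l2_def)
  then have "inner x (q' + ?F) = 0" by simp
  moreover have "inner x (kop ?K z) = inner (opG c x) z" for x z
    unfolding opG_def by (rule inner_kop_transpose[OF G_matrix_L2])
  moreover have "inner x (kop (\<lambda>u v. transpose (?Ri ** ?U v u)) (gam P q)) = inner (kop ?U x) (mop ?Ri (gam P q))"
    using inner_kop_transpose[OF RU, of x "gam P q"]
    by (simp add: kop_left[OF U] mop_sym[OF sR])
  ultimately show ?thesis
    by (simp add: opG_mop inner_add_right inner_diff_right inner_mop_transpose ikL mop_sym[OF sPib]
        opN_split[OF L, unfolded opX_def] opA_def opC_def opX_def blinfun.add_left inner_add_left)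
qed

end

section \<open>Derivatives in \<open>L\<^sup>2\<close>\<close>

text \<open>The difference quotient with a norm majorant is the form in which \<open>C1_L2\<close>
  provides differentiability; norm bounds for \<open>l2\<close> and \<open>kop\<close> then transfer
  it to classes and operators.\<close>

lemma has_vector_derivative_quotientI:
  fixes f :: "real \<Rightarrow> 'a::real_normed_vector"
  assumes lim: "(\<epsilon> \<longlongrightarrow> 0) (at t within S)"
    and le: "\<And>s. s \<in> S \<Longrightarrow> s \<noteq> t \<Longrightarrow> norm ((f s - f t) /\<^sub>R (s - t) - f') \<le> \<epsilon> s"
  shows "(f has_vector_derivative f') (at t within S)"
proof -
  have ev: "\<forall>\<^sub>F s in at t within S. s \<in> S \<and> s \<noteq> t"
    by (simp add: eventually_at_filter)
  have "((\<lambda>s. (1 / norm (s - t)) *\<^sub>R (f s - (f t + (s - t) *\<^sub>R f'))) \<longlongrightarrow> 0) (at t within S)"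
  proof (rule Lim_null_comparison[OF _ lim])
    show "\<forall>\<^sub>F s in at t within S. norm ((1 / norm (s - t)) *\<^sub>R (f s - (f t + (s - t) *\<^sub>R f'))) \<le> \<epsilon> s"
      using ev
    proof eventually_elim
      case (elim s)
      have "f s - (f t + (s - t) *\<^sub>R f') = (s - t) *\<^sub>R ((f s - f t) /\<^sub>R (s - t) - f')"
        using elim by (simp add: scaleR_diff_right)
      then have "norm ((1 / norm (s - t)) *\<^sub>R (f s - (f t + (s - t) *\<^sub>R f')))
          = norm ((f s - f t) /\<^sub>R (s - t) - f')"
        using elim by simp
      with le elim show ?case by simp
    qed
  qed
  then show ?thesis
    by (simp add: has_vector_derivative_def has_derivative_within bounded_linear_scaleR_left)
qed

lemma C1_L2_l2:
  assumes "C1_L2 LI S f f'" "t \<in> S"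
  shows "((\<lambda>s. l2 (f s)) has_vector_derivative l2 (f' t)) (at t within S)"
proof (rule has_vector_derivative_quotientI)
  show "((\<lambda>s. L2norm LI (\<lambda>x. (f s x - f t x) /\<^sub>R (s - t) - f' t x)) \<longlongrightarrow> 0) (at t within S)"
    using assms by (auto simp: C1_L2_def)
  fix s assume s: "s \<in> S" "s \<noteq> t"
  have m: "f s \<in> L2 LI" "f t \<in> L2 LI" "f' t \<in> L2 LI" using assms s by (auto simp: C1_L2_def)
  show "norm ((l2 (f s) - l2 (f t)) /\<^sub>R (s - t) - l2 (f' t)) \<le> L2norm LI (\<lambda>x. (f s x - f t x) /\<^sub>R (s - t) - f' t x)"
    using m by (simp add: l2_diff[symmetric] l2_scaleR[symmetric] L2_diff L2_scaleR norm_l2)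
qed

lemma C1_L2_kop:
  assumes "C1_L2 LII S (\<lambda>t. case_prod (L t)) (\<lambda>t. case_prod (L' t))" "t \<in> S"
  shows "((\<lambda>s. kop (L s)) has_vector_derivative kop (L' t)) (at t within S)"
proof (rule has_vector_derivative_quotientI)
  show "((\<lambda>s. L2norm LII (\<lambda>x. (case_prod (L s) x - case_prod (L t) x) /\<^sub>R (s - t) - case_prod (L' t) x)) \<longlongrightarrow> 0) (at t within S)"
    using assms by (auto simp: C1_L2_def)
  fix s assume s: "s \<in> S" "s \<noteq> t"
  have m: "case_prod (L s) \<in> L2 LII" "case_prod (L t) \<in> L2 LII" "case_prod (L' t) \<in> L2 LII"
    using assms s by (auto simp: C1_L2_def)
  note m1 = L2_kernel_diff[OF m(1,2)]
  note m2 = L2_kernel_scaleR[OF m1, of "inverse (s - t)"]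
  note m3 = L2_kernel_diff[OF m2 m(3)]
  have "(kop (L s) - kop (L t)) /\<^sub>R (s - t) - kop (L' t) = kop (\<lambda>u v. (L s u v - L t u v) /\<^sub>R (s - t) - L' t u v)"
    by (simp only: kop_diff[OF m2 m(3)] kop_scaleR[OF m1] kop_diff[OF m(1,2)])
  then show "norm ((kop (L s) - kop (L t)) /\<^sub>R (s - t) - kop (L' t))
      \<le> L2norm LII (\<lambda>x. (case_prod (L s) x - case_prod (L t) x) /\<^sub>R (s - t) - case_prod (L' t) x)"
    using norm_kop_le[OF m3] by (simp add: case_prod_beta')
qed

lemma has_vector_derivative_reverse:
  assumes "(f has_vector_derivative f') (at (T - s) within {0..T})" "s \<in> {0..T}"
  shows "((\<lambda>s. f (T - s)) has_vector_derivative - f') (at s within {0..T})"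
proof -
  have 1: "((\<lambda>s. T - s) has_vector_derivative - 1) (at s within {0..T})"
    by (auto intro!: derivative_eq_intros simp: has_real_derivative_iff_has_vector_derivative[symmetric])
  have "(\<lambda>s. T - s) ` {0..T} = {0..T}" by simp
  then have 2: "(f has_vector_derivative f') (at (T - s) within (\<lambda>s. T - s) ` {0..T})"
    using assms(1) by simp
  from vector_diff_chain_within[OF 1 2] show ?thesis by (simp add: o_def)
qed

lemma has_vector_derivative_mop:
  "(f has_vector_derivative f') (at t within S) \<Longrightarrow> ((\<lambda>s. mop (f s)) has_vector_derivative mop f') (at t within S)"
  by (rule bounded_linear.has_vector_derivative[OF bounded_linear_mop])

section \<open>Exponential convergence of the Riccati equations\<close>

lemma mop_nonneg: "psd_mat M \<Longrightarrow> 0 \<le> inner x (mop M x)"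
  using mop_coercive[of 0 M x] by (simp add: psd_mat_def)

lemma pd_imp_psd: "pd_mat M \<Longrightarrow> psd_mat M"
  unfolding pd_mat_def psd_mat_def by (metis inner_zero_left less_eq_real_def)

lemma pd_complete_square:
  assumes "pd_mat M"
  shows "2 * inner \<theta> n + inner \<theta> (mop M \<theta>)
    = inner (\<theta> + mop (matrix_inv M) n) (mop M (\<theta> + mop (matrix_inv M) n)) - inner n (mop (matrix_inv M) n)"
proof -
  have "mop M (mop (matrix_inv M) n) = n"
    by (simp add: mop_mult[symmetric] pd_mat_inverse(1)[OF assms] mop_one)
  moreover have "inner (mop (matrix_inv M) n) (mop M \<theta>) = inner n \<theta>"
    using inner_mop[of "mop (matrix_inv M) n" M \<theta>] assms calculation by (simp add: pd_mat_def sym_mat_def)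
  ultimately show ?thesis
    by (simp add: blinfun.add_right inner_add_left inner_add_right inner_commute)
qed

text \<open>Polarization at y and at the multiple of Z y that has the same norm as y; equal norms
  are the reason why the constant is \<open>m\<close> without loss.\<close>

lemma psd_form_norm_le:
  fixes Z :: "'h::real_inner \<Rightarrow>\<^sub>L 'h"
  assumes sym: "\<And>x y. inner x (Z y) = inner (Z x) y" and nn: "\<And>x. 0 \<le> inner x (Z x)"
    and le: "\<And>x. inner x (Z x) \<le> m * (norm x)\<^sup>2" and m: "m \<ge> 0"
  shows "norm Z \<le> m"
proof (rule norm_blinfun_bound[OF m])
  fix y
  show "norm (Z y) \<le> m * norm y"
  proof (cases "y = 0 \<or> Z y = 0")
    case False
    define x where "x = (norm y / norm (Z y)) *\<^sub>R Z y"
    have nx: "norm x = norm y" using False by (simp add: x_def)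
    have "4 * inner x (Z y) = inner (x + y) (Z (x + y)) - inner (x - y) (Z (x - y))"
      using sym[of x y]
      by (simp add: blinfun.add_right blinfun.diff_right inner_add_left inner_add_right inner_diff_left
          inner_diff_right inner_commute)
    also have "\<dots> \<le> m * (norm (x + y))\<^sup>2" using le[of "x + y"] nn[of "x - y"] by linarith
    also have "\<dots> \<le> m * (2 * norm y)\<^sup>2"
      using norm_triangle_ineq[of x y] nx m by (intro mult_left_mono power_mono) auto
    finally have "inner x (Z y) \<le> m * (norm y)\<^sup>2" by (simp add: power2_eq_square)
    moreover have "inner x (Z y) = norm y * norm (Z y)"
      using False by (simp add: x_def dot_square_norm power2_eq_square)
    ultimately show ?thesis using False by (simp add: power2_eq_square)
  qed (use m in auto)
qed

section \<open>Completing the square in the control\<close>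

context graphon_lq
begin

abbreviation Ri :: "real^'d^'d \<Rightarrow> 'm l2_op" where "Ri Q \<equiv> mop (matrix_inv (R_map c Q))"

definition quad_cost :: "((real^'d) l2 \<Rightarrow> real) \<Rightarrow> (real^'m) l2 \<Rightarrow> (real^'d) l2 \<Rightarrow> real" where
  "quad_cost q \<theta> z = q z + 2 * inner \<theta> (mop (cS c) z) + inner \<theta> (mop (cR c) \<theta>)"

text \<open>Half the coefficient of the part of \<open>form\<close> that is linear in the control.
  The operator \<open>K\<close> is a parameter so that the same lemmas serve the equation for
  \<open>P\<close>, with C, and the one for \<open>X\<close>, with \<open>opC\<close>.\<close>

definition lin_op :: "'d l2_op \<Rightarrow> real^'d^'d \<Rightarrow> 'd l2_op \<Rightarrow> (real^'d) l2 \<Rightarrow> (real^'m) l2" where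
  "lin_op K P X z = mop (transpose (cB c)) (X z) + mop (transpose (cD c)) (mop P (K z)) + mop (cS c) z"

definition feedback :: "'d l2_op \<Rightarrow> real^'d^'d \<Rightarrow> 'd l2_op \<Rightarrow> (real^'d) l2 \<Rightarrow> (real^'m) l2" where
  "feedback K P X z = - Ri P (lin_op K P X z)"

text \<open>The minimum of \<open>form\<close> over controls, attained at \<open>feedback\<close>;
  \<open>ric_form_complete_square\<close> shows this.\<close>

definition ric_value :: "'d l2_op \<Rightarrow> 'd l2_op
    \<Rightarrow> ((real^'d) l2 \<Rightarrow> real) \<Rightarrow> real^'d^'d \<Rightarrow> 'd l2_op \<Rightarrow> (real^'d) l2 \<Rightarrow> real" where
  "ric_value A K q P X z = 2 * inner (A z) (X z) + inner (K z) (mop P (K z)) + q z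
     - inner (lin_op K P X z) (Ri P (lin_op K P X z))"

abbreviation form :: "'d l2_op \<Rightarrow> 'd l2_op \<Rightarrow> ((real^'d) l2 \<Rightarrow> real) \<Rightarrow> 'd l2_op \<Rightarrow> 'd l2_op
    \<Rightarrow> (real^'m) l2 \<Rightarrow> (real^'d) l2 \<Rightarrow> real" where
  "form A K q \<equiv> ric_form A K (mop (cB c)) (mop (cD c)) (quad_cost q)"

lemma ric_form_complete_square:
  assumes P: "psd_mat P"
  shows "form A K q X (mop P) \<theta> z = ric_value A K q P X z
    + inner (\<theta> - feedback K P X z) (mop (R_map c P) (\<theta> - feedback K P X z))"
proof -
  note sP = psd_mat_sym[OF P]
  have a: "inner (mop M x) y = inner x (mop (transpose M) y)" for M :: "real^'a^'b" and x y
    by (simp add: inner_mop_transpose)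
  have c1: "inner (K z) (mop P (mop (cD c) \<theta>)) = inner \<theta> (mop (transpose (cD c)) (mop P (K z)))"
    unfolding inner_mop_transpose
    using mop_sym[OF sP, of "K z" "mop (cD c) \<theta>"] by (simp add: inner_commute)
  have "form A K q X (mop P) \<theta> z = 2 * inner (A z) (X z) + inner (K z) (mop P (K z)) + q z
      + (2 * inner \<theta> (lin_op K P X z) + inner \<theta> (mop (R_map c P) \<theta>))"
    by (simp add: ric_form_def quad_cost_def lin_op_def R_map_def mop_add mop_mult blinfun.add_left blinfun.add_right
        inner_add_left inner_add_right a[of "cB c"] a[of "cD c"] c1)
  then show ?thesis
    unfolding pd_complete_square[OF pd_R_map[OF P pd_R]] by (simp add: ric_value_def feedback_def)
qed

lemma R_map_nonneg: "psd_mat P \<Longrightarrow> 0 \<le> inner \<theta> (mop (R_map c P) \<theta>)"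
  by (rule mop_nonneg[OF pd_imp_psd[OF pd_R_map[OF _ pd_R]]])

lemma ric_form_feedback:
  "psd_mat P \<Longrightarrow> form A K q X (mop P) (feedback K P X z) z = ric_value A K q P X z"
  by (simp add: ric_form_complete_square)

lemma ric_value_le: "psd_mat P \<Longrightarrow> ric_value A K q P X z \<le> form A K q X (mop P) \<theta> z"
  using R_map_nonneg by (simp add: ric_form_complete_square)

text \<open>Minimizing over the control leaves a Schur complement: this is how
  \<open>S\<^sup>T R\<^sup>-\<^sup>1 S\<close> from the positivity condition enters.\<close>

lemma quad_cost_ge: "q z - inner z (mop (transpose (cS c) ** matrix_inv (cR c) ** cS c) z) \<le> quad_cost q \<theta> z"
proof -
  have "inner z (mop (transpose (cS c) ** matrix_inv (cR c) ** cS c) z)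
      = inner (mop (cS c) z) (mop (matrix_inv (cR c)) (mop (cS c) z))"
    by (simp add: mop_mult inner_mop_transpose)
  then show ?thesis
    using pd_complete_square[OF pd_R, of \<theta> "mop (cS c) z"] mop_nonneg[OF pd_imp_psd[OF pd_R]]
    by (simp add: quad_cost_def)
qed

text \<open>R(P) is at least R for every P \<ge> 0, so one bound serves all times and all
  horizons.\<close>

lemma R_inv_bound:
  obtains \<rho> where "\<rho> > 0" "\<And>P x. psd_mat P \<Longrightarrow> norm (Ri P x) \<le> \<rho> * norm x"
proof -
  obtain \<epsilon> where \<epsilon>: "\<epsilon> > 0" "\<And>v. \<epsilon> * (norm v)\<^sup>2 \<le> inner v (cR c *v v)"
    using pd_mat_coercive[OF pd_R] by blast
  have "norm (Ri P x) \<le> (1 / \<epsilon>) * norm x" if P: "psd_mat P" for P x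
  proof -
    define y where "y = Ri P x"
    have "mop (R_map c P) y = x"
      by (simp add: y_def mop_mult[symmetric] pd_mat_inverse(1)[OF pd_R_map[OF P pd_R]] mop_one)
    then have "\<epsilon> * (norm y)\<^sup>2 \<le> inner y x"
      using mop_coercive[of \<epsilon> "R_map c P" y] R_map_coercive[OF P \<epsilon>(2)] by auto
    also have "\<dots> \<le> norm y * norm x" by (rule norm_cauchy_schwarz)
    finally have "norm y * (\<epsilon> * norm y) \<le> norm y * norm x" by (simp add: power2_eq_square mult_ac)
    then have "\<epsilon> * norm y \<le> norm x" by (cases "y = 0") auto
    then show ?thesis using \<epsilon>(1) by (simp add: y_def field_simps)
  qed
  with \<epsilon>(1) show ?thesis by (intro that[of "1 / \<epsilon>"]) auto
qed

lemma norm_lin_op_le: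
  "norm (lin_op K P X z) \<le> (norm (mop (transpose (cB c))) * norm X
     + norm (mop (transpose (cD c))) * (norm (mop P) * norm K) + norm (mop (cS c))) * norm z"
proof -
  have "norm (lin_op K P X z) \<le> norm (mop (transpose (cB c)) (X z))
      + norm (mop (transpose (cD c)) (mop P (K z))) + norm (mop (cS c) z)"
    unfolding lin_op_def by (intro order_trans[OF norm_triangle_ineq] add_right_mono norm_triangle_ineq)
  also have "\<dots> \<le> norm (mop (transpose (cB c))) * (norm X * norm z)
      + norm (mop (transpose (cD c))) * (norm (mop P) * (norm K * norm z)) + norm (mop (cS c)) * norm z"
    by (intro add_mono order_trans[OF norm_blinfun] mult_left_mono norm_blinfun) auto
  finally show ?thesis by (simp add: algebra_simps)
qed

lemma riccati_sandwich_mop: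
  fixes X X' :: "real \<Rightarrow> 'd l2_op" and Xb :: "'d l2_op" and Ps :: "real \<Rightarrow> real^'d^'d"
  assumes Ps: "\<And>s. s \<in> {0..T} \<Longrightarrow> psd_mat (Ps s)" and contP: "continuous_on {0..T} Ps" and Pb: "psd_mat Pb"
    and deriv: "\<And>s. s \<in> {0..T} \<Longrightarrow> (X has_vector_derivative X' s) (at s within {0..T})"
    and X0: "X 0 = 0"
    and symX: "\<And>s x y. s \<in> {0..T} \<Longrightarrow> inner x (X s y) = inner (X s x) y"
    and symXb: "\<And>x y. inner x (Xb y) = inner (Xb x) y"
    and Xb: "\<And>x. 0 \<le> inner x (Xb x)"
    and ric: "\<And>s z. s \<in> {0..T} \<Longrightarrow> inner z (X' s z) = ric_value A K q (Ps s) (X s) z"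
    and alg: "\<And>z. ric_value A K q Pb Xb z = 0"
    and cost: "\<And>\<theta> z. \<delta> * inner z (Xb z) \<le> quad_cost q \<theta> z"
    and \<delta>: "\<delta> > 0" and \<kappa>: "\<kappa> \<ge> 0"
    and Plow: "\<And>s \<psi>. s \<in> {0..T} \<Longrightarrow> \<kappa> * inner \<psi> ((X s - (1 - exp (- \<delta> * s)) *\<^sub>R Xb) \<psi>)
                 \<le> inner \<psi> ((mop (Ps s) - (1 - exp (- \<delta> * s)) *\<^sub>R mop Pb) \<psi>)"
    and Pup: "\<And>s \<psi>. s \<in> {0..T} \<Longrightarrow> \<kappa> * inner \<psi> ((Xb - X s) \<psi>) \<le> inner \<psi> ((mop Pb - mop (Ps s)) \<psi>)"
    and t: "t \<in> {0..T}"
  shows "(1 - exp (- \<delta> * t)) * inner x (Xb x) \<le> inner x (X t x) \<and> inner x (X t x) \<le> inner x (Xb x)"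
proof -
  obtain \<rho> where \<rho>: "\<rho> > 0" "\<And>P x. psd_mat P \<Longrightarrow> norm (Ri P x) \<le> \<rho> * norm x"
    by (rule R_inv_bound) blast
  have contX: "continuous_on {0..T} X" using deriv by (rule continuous_on_vector_derivative)
  \<comment> \<open>These compactness bounds may depend on T. They only serve to produce the growth
    constant \<open>k\<close> demanded by \<open>riccati_sandwich\<close>, which does not occur in
    its conclusion.\<close>
  obtain mX where mX: "\<And>s. s \<in> {0..T} \<Longrightarrow> norm (X s) \<le> mX"
    using compact_imp_bounded[OF compact_continuous_image[OF contX compact_Icc]]
    unfolding bounded_iff by blast
  obtain mP where mP: "\<And>s. s \<in> {0..T} \<Longrightarrow> norm (Ps s) \<le> mP"
    using compact_imp_bounded[OF compact_continuous_image[OF contP compact_Icc]]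
    unfolding bounded_iff by blast
  define x1 where "x1 = max mX (norm Xb)"
  define p1 where "p1 = max mP (norm Pb)"
  define n1 where "n1 = norm (mop (transpose (cB c))) * x1
     + norm (mop (transpose (cD c))) * (p1 * norm K) + norm (mop (cS c))"
  define k where "k = \<rho> * n1"
  have fb: "norm (feedback K P Y z) \<le> k * norm z" if "psd_mat P" "norm Y \<le> x1" "norm P \<le> p1" for P Y z
  proof -
    have "norm (mop P) \<le> p1" using norm_mop_le[of P] that(3) by linarith
    moreover have "0 \<le> x1" "0 \<le> p1" by (auto simp: x1_def p1_def le_max_iff_disj)
    ultimately have "norm (lin_op K P Y z) \<le> n1 * norm z"
      unfolding n1_def using that(2)
      by (intro order_trans[OF norm_lin_op_le] mult_right_mono add_mono mult_left_mono) auto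
    then have "\<rho> * norm (lin_op K P Y z) \<le> k * norm z"
      unfolding k_def mult.assoc using \<rho>(1) by (intro mult_left_mono) auto
    with \<rho>(2)[OF that(1), of "lin_op K P Y z"] show ?thesis by (simp add: feedback_def)
  qed
  have 1: "0 \<le> form A K q Xb (mop Pb) \<theta> z" for \<theta> z
    using ric_value_le[OF Pb, of A K q Xb z \<theta>] alg by simp
  have f1: "inner z (X' s z) = form A K q (X s) (mop (Ps s)) (feedback K (Ps s) (X s) z) z"
    if "s \<in> {0..T}" for s z
    unfolding ric_form_feedback[OF Ps[OF that]] by (rule ric[OF that])
  have f2: "form A K q (X s) (mop (Ps s)) (feedback K (Ps s) (X s) z) z \<le> form A K q (X s) (mop (Ps s)) \<theta> z"
    if "s \<in> {0..T}" for s z \<theta>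
    unfolding ric_form_feedback[OF Ps[OF that]] by (rule ric_value_le[OF Ps[OF that]])
  have f3: "form A K q Xb (mop Pb) (feedback K Pb Xb z) z = 0" for z
    unfolding ric_form_feedback[OF Pb] by (rule alg)
  have f4: "norm (feedback K (Ps s) (X s) z) \<le> k * norm z" if "s \<in> {0..T}" for s z
    by (rule fb[OF Ps[OF that]]) (use mX[OF that] mP[OF that] in \<open>auto simp: x1_def p1_def\<close>)
  have f5: "norm (feedback K Pb Xb z) \<le> k * norm z" for z
    by (rule fb[OF Pb]) (auto simp: x1_def p1_def)
  note * = riccati_sandwich[where P = "\<lambda>s. mop (Ps s)" and \<Theta> = "\<lambda>s. feedback K (Ps s) (X s)",
      OF deriv X0 symX symXb Xb f1 f2 f3 1 cost \<delta> f4 f5 \<kappa> Plow Pup t]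
  show ?thesis by (intro conjI *)
qed

end

lemma kop_zero: "kop (\<lambda>u v. 0 :: real^'a^'b) = 0"
proof (rule blinfun_eqI)
  have z: "case_prod (\<lambda>u v. 0 :: real^'a^'b) \<in> L2 LII" using L2_zero[of LII] by (simp add: case_prod_beta')
  show "kop (\<lambda>u v. 0 :: real^'a^'b) x = (0 :: _ \<Rightarrow>\<^sub>L _) x" for x
    by (simp add: kop_apply[OF z] zero_l2_def)
qed

lemma inner_kop_iterated:
  assumes K: "case_prod K \<in> L2 LII"
  shows "inner x (kop K y) = (\<integral>u. (\<integral>v. inner (fn x u) (K u v *v fn y v) \<partial>LI) \<partial>LI)"
  using has_kform_kop[OF K, of x y] LII.integral_fst'[OF integrable_kform[OF K, of x y]]
  by (simp add: has_kform_def has_bochner_integral_iff)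

section \<open>Symmetry, coercivity and the sandwich for the actual solutions\<close>

locale lq_turnpike = graphon_lq c for c :: "('d::finite, 'm::finite) lq_data" +
  fixes PT PibT :: "real \<Rightarrow> real \<Rightarrow> real^'d^'d"
    and LamT :: "real \<Rightarrow> real \<Rightarrow> real \<Rightarrow> real \<Rightarrow> real^'d^'d"
    and pT :: "real \<Rightarrow> real \<Rightarrow> real \<Rightarrow> real^'d"
    and P Pib :: "real^'d^'d"
    and L :: "real \<Rightarrow> real \<Rightarrow> real^'d^'d"
    and p :: "real \<Rightarrow> real^'d"
  assumes pos: "positivity_cond c"
    and P_eq: "\<And>T. T > 0 \<Longrightarrow> solves_P_eq c T (PT T)"
    and Pib_eq: "\<And>T. T > 0 \<Longrightarrow> solves_Pib_eq c T (PT T) (PibT T)"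
    and Lam_eq: "\<And>T. T > 0 \<Longrightarrow> solves_Lam_eq c T (PT T) (PibT T) (LamT T)"
    and p_eq: "\<And>T. T > 0 \<Longrightarrow> solves_p_eq c T (PT T) (PibT T) (LamT T) (pT T)"
    and alg_ric: "solves_alg_riccati c P Pib"
    and alg_solv: "algebraic_solvability c P Pib LamT"
    and alg_Lp: "solves_alg_Lam_p c P Pib L p"
begin

abbreviation P_cost :: "(real^'d) l2 \<Rightarrow> real" where "P_cost \<equiv> \<lambda>x. inner x (mop (cQ c) x)"
abbreviation X_cost :: "(real^'d) l2 \<Rightarrow> real" where "X_cost \<equiv> \<lambda>x. state_cost c x x"

definition Xb :: "'d l2_op" where "Xb = opX Pib L"
definition X :: "real \<Rightarrow> real \<Rightarrow> 'd l2_op" where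
  "X T t = opX (PibT T t) (LamT T t)"

lemma psd_P: "psd_mat P" and psd_Pib: "psd_mat Pib" and pd_Pib: "pd_mat Pib"
  using alg_ric pd_imp_psd by (auto simp: solves_alg_riccati_def)

lemma psd_PT: "T > 0 \<Longrightarrow> t \<in> {0..T} \<Longrightarrow> psd_mat (PT T t)"
  using P_eq by (auto simp: solves_P_eq_def)

lemma psd_PibT: "T > 0 \<Longrightarrow> t \<in> {0..T} \<Longrightarrow> psd_mat (PibT T t)"
  using Pib_eq by (auto simp: solves_Pib_eq_def)

lemma L_L2: "case_prod L \<in> L2 LII"
  using alg_Lp by (simp add: solves_alg_Lam_p_def)

lemma LamT_L2: "T > 0 \<Longrightarrow> t \<in> {0..T} \<Longrightarrow> case_prod (LamT T t) \<in> L2 LII"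
  using Lam_eq by (fastforce simp: solves_Lam_eq_def C1_L2_def)

lemma algebraic_operator_riccati: "ric_bilinear c P Xb x y = 0"
proof -
  have "inner x (opX 0 (\<lambda>u v. 0) y) + ric_bilinear c P (opX Pib L) x y = 0"
  proof (rule operator_riccati[OF L_L2 _ psd_P psd_Pib])
    show "case_prod (\<lambda>u v. 0 :: real^'d^'d) \<in> L2 LII" using L2_zero[of LII] by (simp add: case_prod_beta')
    show "AE (u, v) in LII. 0 + F_map c P (Pib - P) L u v = 0"
      using alg_Lp by (simp add: solves_alg_Lam_p_def)
  qed (use alg_ric in \<open>simp add: solves_alg_riccati_def\<close>)
  then show ?thesis by (simp add: Xb_def opX_def kop_zero)
qed

text \<open>Makes the derivative a function of T and t in place of an existential witness;
  derivatives on the nondegenerate interval \<open>{0..T}\<close> are unique, which identifies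
  it.\<close>

definition dX :: "real \<Rightarrow> real \<Rightarrow> 'd l2_op" where
  "dX T t = vector_derivative (X T) (at t within {0..T})"

lemma finite_horizon_operator_riccati:
  assumes T: "T > 0" and t: "t \<in> {0..T}"
  shows X_deriv: "(X T has_vector_derivative dX T t) (at t within {0..T})"
    and dX_form: "inner x (dX T t y) = - ric_bilinear c (PT T t) (X T t) x y"
proof -
  obtain Pib' where Pib': "(PibT T has_vector_derivative Pib') (at t within {0..T})"
    "Pib' + Qhat_map c (PT T t) (PibT T t - PT T t)
       - transpose (Mhat_map c (PT T t) (PibT T t - PT T t)) ** matrix_inv (R_map c (PT T t))
           ** Mhat_map c (PT T t) (PibT T t - PT T t) = 0"
    using Pib_eq[OF T] t unfolding solves_Pib_eq_def by blast
  obtain L' where L': "C1_L2 LII {0..T} (\<lambda>t. case_prod (LamT T t)) (\<lambda>t. case_prod (L' t))"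
    "AE (u, v) in LII. L' t u v + F_map c (PT T t) (PibT T t - PT T t) (LamT T t) u v = 0"
    using Lam_eq[OF T] t unfolding solves_Lam_eq_def by blast
  have d: "(X T has_vector_derivative opX Pib' (L' t)) (at t within {0..T})"
    unfolding X_def[abs_def] opX_def
    by (intro has_vector_derivative_add has_vector_derivative_mop Pib'(1) C1_L2_kop[OF L'(1) t])
  then have dX: "dX T t = opX Pib' (L' t)"
    unfolding dX_def using vector_derivative_within_cbox[OF T, of t "X T"] t by simp
  with d show "(X T has_vector_derivative dX T t) (at t within {0..T})" by simp
  have "case_prod (L' t) \<in> L2 LII" using L'(1) t by (auto simp: C1_L2_def)
  from operator_riccati[OF LamT_L2[OF T t] this psd_PT[OF T t] psd_PibT[OF T t] Pib'(2) L'(2), of x y]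
  show "inner x (dX T t y) = - ric_bilinear c (PT T t) (X T t) x y"
    by (simp add: X_def dX)
qed

lemma X_terminal:
  assumes T: "T > 0"
  shows "X T T = 0"
proof -
  have "AE (u, v) in LII. LamT T T u v = 0" using Lam_eq[OF T] by (simp add: solves_Lam_eq_def)
  then have "L2norm LII (case_prod (LamT T T)) = 0"
    by (auto simp: L2norm_def intro!: integral_eq_zero_AE elim!: eventually_mono)
  then have "kop (LamT T T) = 0" using norm_kop_le[OF LamT_L2[OF T], of T] T by simp
  moreover have "PibT T T = 0" using Pib_eq[OF T] by (simp add: solves_Pib_eq_def)
  ultimately show ?thesis by (simp add: X_def opX_def)
qed

text \<open>Exchanging x and y merely swaps the two terms with \<open>opA\<close>, whether or not
  \<open>Y\<close> is symmetric, and the quadratic terms contain symmetric matrices. Only the cost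
  is left.\<close>

lemma ric_bilinear_antisym:
  assumes "psd_mat Q"
  shows "ric_bilinear c Q Y x y - ric_bilinear c Q Y y x = state_cost c x y - state_cost c y x"
proof -
  note sQ = psd_mat_sym[OF assms]
  have sR: "transpose (matrix_inv (R_map c Q)) = matrix_inv (R_map c Q)"
    by (rule pd_mat_inverse[OF pd_R_map[OF assms pd_R]])
  have "inner (opC c x) (mop Q (opC c y)) = inner (opC c y) (mop Q (opC c x))"
    using mop_sym[OF sQ, of "opC c x" "opC c y"] by (simp add: inner_commute)
  moreover have "inner (opN c Q Y x) (mop (matrix_inv (R_map c Q)) (opN c Q Y y))
      = inner (opN c Q Y y) (mop (matrix_inv (R_map c Q)) (opN c Q Y x))"
    using mop_sym[OF sR, of "opN c Q Y x" "opN c Q Y y"] by (simp add: inner_commute)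
  ultimately show ?thesis
    using inner_commute[of "opA c x" "Y y"] inner_commute[of "Y x" "opA c y"] by (simp add: ric_bilinear_def)
qed

text \<open>The algebraic equation forces the kernel \<open>Q\<close>-tilde \<open>G\<close> to be symmetric.\<close>

lemma state_cost_sym: "state_cost c x y = state_cost c y x"
  using ric_bilinear_antisym[OF psd_P, of Xb x y] by (simp add: algebraic_operator_riccati)

text \<open>By \<open>ric_bilinear_antisym\<close> and the symmetry of the cost, the antisymmetric
  part of X has derivative zero; it vanishes at the terminal time.\<close>

lemma X_sym:
  assumes T: "T > 0" and t: "t \<in> {0..T}"
  shows "inner x (X T t y) = inner (X T t x) y"
proof -
  have bl: "bounded_linear (\<lambda>Z :: 'd l2_op. inner x (Z y))" for x y
    by (intro bounded_linear_compose[OF bounded_linear_inner_right] blinfun.bounded_linear_left)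
  have "((\<lambda>t. inner x (X T t y) - inner y (X T t x)) has_vector_derivative 0) (at s within {0..T})"
    if s: "s \<in> {0..T}" for s
  proof -
    have "((\<lambda>t. inner x (X T t y) - inner y (X T t x)) has_vector_derivative
        inner x (dX T s y) - inner y (dX T s x)) (at s within {0..T})"
      by (intro has_vector_derivative_diff bounded_linear.has_vector_derivative[OF bl] X_deriv T s)
    moreover have "inner x (dX T s y) - inner y (dX T s x) = 0"
      using ric_bilinear_antisym[OF psd_PT[OF T s], of "X T s" x y] state_cost_sym[of x y] by (simp add: dX_form[OF T s])
    ultimately show ?thesis by simp
  qed
  from has_vector_derivative_zero_constant[OF convex_closed_interval(1) this]
  obtain k where "\<And>t. t \<in> {0..T} \<Longrightarrow> inner x (X T t y) - inner y (X T t x) = k" by blast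
  from this[OF t] this[of T] show ?thesis using T by (simp add: X_terminal inner_commute)
qed

text \<open>Nonnegativity of the form of \<open>L\<close> says nothing about its antisymmetric part.
  Symmetry is inherited from \<open>LamT T 0\<close> in the limit of long horizons, and uniqueness
  identifies \<open>L\<close> with that limit.\<close>

lemma kop_L_sym: "inner x (kop L y) = inner (kop L x) y"
proof -
  obtain L0 p0 where sol: "solves_alg_Lam_p c P Pib L0 p0"
    and L0: "\<forall>L1 p1. solves_alg_Lam_p c P Pib L1 p1 \<longrightarrow>
           (AE (u, v) in LII. L1 u v = L0 u v) \<and> (AE u in LI. p1 u = p0 u)"
    and lim0: "\<forall>t\<ge>0. ((\<lambda>T. L2norm LII (\<lambda>(u, v). LamT T t u v - L0 u v)) \<longlongrightarrow> 0) at_top"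
    using alg_solv unfolding algebraic_solvability_def by (elim exE conjE)
  note lim = lim0[rule_format, OF order_refl]
  have L0_L2: "case_prod L0 \<in> L2 LII" using sol by (simp add: solves_alg_Lam_p_def)
  have ev: "\<forall>\<^sub>F T in at_top. (0::real) < T" by (rule eventually_gt_at_top)
  have "((\<lambda>T. kop (LamT T 0) - kop L0) \<longlongrightarrow> 0) at_top"
  proof (rule Lim_null_comparison[OF _ lim])
    show "\<forall>\<^sub>F T in at_top. norm (kop (LamT T 0) - kop L0) \<le> L2norm LII (\<lambda>(u, v). LamT T 0 u v - L0 u v)"
      using ev
    proof eventually_elim
      case (elim T)
      have l: "case_prod (LamT T 0) \<in> L2 LII" using LamT_L2[of T 0] elim by simp
      show ?case using norm_kop_le[OF L2_kernel_diff[OF l L0_L2]] by (simp add: kop_diff[OF l L0_L2])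
    qed
  qed
  then have "((\<lambda>T. kop (LamT T 0)) \<longlongrightarrow> kop L0) at_top" by (simp add: LIM_zero_iff)
  then have lim1: "((\<lambda>T. inner x (kop (LamT T 0) y) - inner (kop (LamT T 0) x) y)
      \<longlongrightarrow> inner x (kop L0 y) - inner (kop L0 x) y) at_top"
    by (intro tendsto_intros)
  have ev0: "\<forall>\<^sub>F T in at_top. inner x (kop (LamT T 0) y) - inner (kop (LamT T 0) x) y = 0"
    using ev
  proof eventually_elim
    case (elim T)
    from mop_sym[OF psd_mat_sym[OF psd_PibT[of T 0]], of x y] X_sym[of T 0 x y] elim show ?case
      by (simp add: X_def opX_def blinfun.add_left inner_add_left inner_add_right)
  qed
  have "inner x (kop L0 y) - inner (kop L0 x) y = 0"
    by (rule tendsto_unique[OF trivial_limit_at_top_linorder lim1 tendsto_eventually[OF ev0]])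
  moreover have "kop L = kop L0"
  proof -
    have "L2norm LII (case_prod (\<lambda>u v. L u v - L0 u v)) = 0"
      using L0[rule_format, OF alg_Lp] by (auto simp: L2norm_def intro!: integral_eq_zero_AE elim!: eventually_mono)
    then show ?thesis using norm_kop_le[OF L2_kernel_diff[OF L_L2 L0_L2]] by (simp add: kop_diff[OF L_L2 L0_L2])
  qed
  ultimately show ?thesis by simp
qed

lemma Xb_sym: "inner x (Xb y) = inner (Xb x) y"
  using mop_sym[OF psd_mat_sym[OF psd_Pib], of x y] kop_L_sym[of x y]
  by (simp add: Xb_def opX_def blinfun.add_left inner_add_left inner_add_right)

text \<open>Nonnegativity of the form of \<open>L\<close> transfers the coercivity of
  \<open>Pib\<close> to \<open>Xb\<close>, which is what makes the energy of \<open>Xb\<close> a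
  norm.\<close>

lemma Xb_ge: "inner x (mop Pib x) \<le> inner x (Xb x)"
proof -
  have "0 \<le> inner x (kop L x)"
    unfolding inner_kop_iterated[OF L_L2] using alg_Lp by (simp add: solves_alg_Lam_p_def)
  then show ?thesis by (simp add: Xb_def opX_def blinfun.add_left inner_add_right)
qed

lemma Xb_nonneg: "0 \<le> inner x (Xb x)"
  using Xb_ge[of x] mop_nonneg[OF psd_Pib, of x] by linarith

lemma P_cost_coercive:
  obtains \<epsilon> where "\<epsilon> > 0"
    "\<And>\<theta> z. \<epsilon> * (norm z)\<^sup>2 \<le> quad_cost P_cost \<theta> z"
proof -
  obtain \<epsilon> where \<epsilon>: "\<epsilon> > 0" "\<And>v. \<epsilon> * (norm v)\<^sup>2
      \<le> inner v ((cQ c - transpose (cS c) ** matrix_inv (cR c) ** cS c) *v v)"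
    using pd_mat_coercive pos unfolding positivity_cond_def by blast
  have "\<epsilon> * (norm z)\<^sup>2 \<le> quad_cost P_cost \<theta> z" for \<theta> z
    using order_trans[OF _ quad_cost_ge[of P_cost z \<theta>]] mop_coercive[OF \<epsilon>(2), of z]
    by (simp add: mop_diff blinfun.diff_left inner_diff_right)
  with \<epsilon>(1) show ?thesis by (rule that)
qed

text \<open>Both graphon terms of the cost are nonnegative by the positivity condition, so the local
  Schur complement alone provides the constant.\<close>

lemma state_cost_coercive:
  obtains \<epsilon> where "\<epsilon> > 0" "\<And>\<theta> z. \<epsilon> * (norm z)\<^sup>2 \<le> quad_cost X_cost \<theta> z"
proof -
  obtain \<epsilon> where \<epsilon>: "\<epsilon> > 0" "\<And>v. \<epsilon> * (norm v)\<^sup>2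
      \<le> inner v ((cQ c + cQb c - transpose (cS c) ** matrix_inv (cR c) ** cS c) *v v)"
    using pd_mat_coercive pos unfolding positivity_cond_def by blast
  have "\<epsilon> * (norm z)\<^sup>2 \<le> quad_cost X_cost \<theta> z" for \<theta> z
  proof -
    have "inner z (mop (cQt c) (opG c z)) = (\<integral>u. (\<integral>v. inner (fn z u) ((cG c u v *\<^sub>R cQt c) *v fn z v) \<partial>LI) \<partial>LI)"
      using inner_kop_iterated[OF G_matrix_L2, of z "cQt c" z] by (simp add: kop_G)
    also have "\<dots> \<ge> 0" using pos by (simp add: positivity_cond_def)
    finally have "0 \<le> inner z (mop (cQt c) (opG c z))" .
    moreover have "0 \<le> inner (opG c z) (mop (cQc c) (opG c z))"
      using pos by (intro mop_nonneg) (simp add: positivity_cond_def)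
    ultimately show ?thesis
      using quad_cost_ge[of X_cost z \<theta>] mop_coercive[OF \<epsilon>(2), of z]
      by (simp add: state_cost_def mop_diff blinfun.diff_left inner_diff_right)
  qed
  with \<epsilon>(1) show ?thesis by (rule that)
qed

lemma ric_value_P:
  assumes Q: "psd_mat Q"
    and eq: "Q' + Q_map c Q - transpose (M_map c Q) ** matrix_inv (R_map c Q) ** M_map c Q = 0"
  shows "ric_value (mop (cA c)) (mop (cC c)) P_cost Q (mop Q) z = inner z (mop (- Q') z)"
proof -
  note sQ = psd_mat_sym[OF Q]
  have lin: "lin_op (mop (cC c)) Q (mop Q) z = mop (M_map c Q) z"
    by (simp add: lin_op_def M_map_def mop_add mop_mult blinfun.add_left)
  have "inner z (mop (Q' + Q_map c Q - transpose (M_map c Q) ** matrix_inv (R_map c Q) ** M_map c Q) z) = 0"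
    unfolding eq by simp
  moreover have "inner z (mop Q (mop (cA c) z)) = inner (mop (cA c) z) (mop Q z)"
    by (simp add: mop_sym[OF sQ] inner_commute)
  ultimately show ?thesis
    unfolding ric_value_def lin Q_map_def
    by (simp add: mop_diff mop_add mop_minus blinfun.diff_left blinfun.add_left blinfun.minus_left mop_mult
        inner_mop_transpose inner_diff_right inner_add_right)
qed

lemma ric_value_bilinear: "ric_value (opA c) (opC c) X_cost Q Y z = ric_bilinear c Q Y z z"
  by (simp add: ric_value_def ric_bilinear_def lin_op_def opN_def inner_commute)

lemma operator_convergence:
  obtains \<delta> where "\<delta> > 0"
    "\<And>T s. T > 0 \<Longrightarrow> s \<in> {0..T} \<Longrightarrow> norm (mop P - mop (PT T (T - s))) \<le> norm (mop P) * exp (- \<delta> * s)"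
    "\<And>T s. T > 0 \<Longrightarrow> s \<in> {0..T} \<Longrightarrow> norm (Xb - X T (T - s)) \<le> norm Xb * exp (- \<delta> * s)"
proof -
  obtain \<epsilon>1 where \<epsilon>1: "\<epsilon>1 > 0"
    "\<And>\<theta> z. \<epsilon>1 * (norm z)\<^sup>2 \<le> quad_cost P_cost \<theta> z"
    using P_cost_coercive by blast
  obtain \<epsilon>2 where \<epsilon>2: "\<epsilon>2 > 0" "\<And>\<theta> z. \<epsilon>2 * (norm z)\<^sup>2 \<le> quad_cost X_cost \<theta> z"
    using state_cost_coercive by blast
  \<comment> \<open>Chosen so that \<delta> P and \<delta> Xb both lie below the respective costs.
    One common value is needed, since the enclosure of P with factor 1 - e^(-\<delta> s) is an input
    to that of X. The added 1 avoids division by zero.\<close>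
  define \<delta> where "\<delta> = min (\<epsilon>1 / (norm (mop P) + 1)) (\<epsilon>2 / (norm Xb + 1))"
  have \<delta>: "\<delta> > 0" using \<epsilon>1(1) \<epsilon>2(1) by (auto simp: \<delta>_def add_nonneg_pos)
  have bnd: "\<delta> * inner z (Z z) \<le> \<epsilon> * (norm z)\<^sup>2" if "\<delta> \<le> \<epsilon> / (norm Z + 1)"
    for Z :: "'d l2_op" and \<epsilon> z
  proof -
    have d: "\<delta> * (norm Z + 1) \<le> \<epsilon>" using that by (simp add: pos_le_divide_eq add_nonneg_pos)
    have "inner z (Z z) \<le> norm Z * norm z * norm z + (norm z)\<^sup>2"
      using inner_blinfun_le[of z Z z] zero_le_power2[of "norm z"] by linarith
    then have "inner z (Z z) \<le> (norm Z + 1) * (norm z)\<^sup>2"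
      by (simp add: distrib_right power2_eq_square)
    then have "\<delta> * inner z (Z z) \<le> \<delta> * ((norm Z + 1) * (norm z)\<^sup>2)"
      using \<delta> by (intro mult_left_mono) auto
    also have "\<dots> \<le> \<epsilon> * (norm z)\<^sup>2" using mult_right_mono[OF d, of "(norm z)\<^sup>2"] by (simp add: mult.assoc)
    finally show ?thesis .
  qed
  have cost1: "\<delta> * inner z (mop P z) \<le> quad_cost P_cost \<theta> z" for \<theta> z
    by (rule order_trans[OF bnd \<epsilon>1(2)]) (simp add: \<delta>_def)
  have cost2: "\<delta> * inner z (Xb z) \<le> quad_cost X_cost \<theta> z" for \<theta> z
    by (rule order_trans[OF bnd \<epsilon>2(2)]) (simp add: \<delta>_def)
  note sP = psd_mat_sym[OF psd_P]
  \<comment> \<open>The sandwich traps \<open>Zb - Z\<close> between 0 and e^(-\<delta> s)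
    \<open>Zb\<close> as a form; symmetry turns this into an operator norm bound.\<close>
  have to_norm: "norm (Zb - Z) \<le> norm Zb * exp (- \<delta> * s)"
    if "\<And>x y. inner x (Zb y) = inner (Zb x) y" "\<And>x y. inner x (Z y) = inner (Z x) y"
      "\<And>x. (1 - exp (- \<delta> * s)) * inner x (Zb x) \<le> inner x (Z x) \<and> inner x (Z x) \<le> inner x (Zb x)"
    for Z Zb :: "'d l2_op" and s
  proof (rule psd_form_norm_le)
    show "inner x ((Zb - Z) y) = inner ((Zb - Z) x) y" for x y
      by (simp add: blinfun.diff_left inner_diff_left inner_diff_right that(1,2))
    show "0 \<le> inner x ((Zb - Z) x)" for x
      using that(3)[of x] by (simp add: blinfun.diff_left inner_diff_right)
    fix x
    have "inner x ((Zb - Z) x) \<le> exp (- \<delta> * s) * inner x (Zb x)"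
      using that(3)[of x] by (simp add: blinfun.diff_left inner_diff_right algebra_simps)
    also have "\<dots> \<le> exp (- \<delta> * s) * (norm Zb * norm x * norm x)"
      using inner_blinfun_le[of x Zb x] by (intro mult_left_mono) auto
    finally show "inner x ((Zb - Z) x) \<le> norm Zb * exp (- \<delta> * s) * (norm x)\<^sup>2"
      by (simp add: power2_eq_square mult_ac)
  qed simp
  have sandP: "(1 - exp (- \<delta> * s)) * inner x (mop P x) \<le> inner x (mop (PT T (T - s)) x)
      \<and> inner x (mop (PT T (T - s)) x) \<le> inner x (mop P x)"
    if T: "T > 0" and s: "s \<in> {0..T}" for T s x
  proof -
    obtain P' where P': "\<And>t. t \<in> {0..T} \<Longrightarrow> (PT T has_vector_derivative P' t) (at t within {0..T})"
      "\<And>t. t \<in> {0..T} \<Longrightarrow> P' t + Q_map c (PT T t)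
            - transpose (M_map c (PT T t)) ** matrix_inv (R_map c (PT T t)) ** M_map c (PT T t) = 0"
      and PTT: "PT T T = 0"
      using P_eq[OF T] unfolding solves_P_eq_def by blast
    have rev: "((\<lambda>s. PT T (T - s)) has_vector_derivative - P' (T - s)) (at s within {0..T})"
      if "s \<in> {0..T}" for s
      by (rule has_vector_derivative_reverse[OF P'(1) that]) (use that in auto)
    have sPT: "transpose (PT T (T - s)) = PT T (T - s)" if "s \<in> {0..T}" for s
      by (rule psd_mat_sym[OF psd_PT[OF T]]) (use that in auto)
    \<comment> \<open>Here the noise term contains the unknown itself: with \<kappa> = 1 both
      coupling conditions hold with equality.\<close>
    show ?thesis
    proof (rule riccati_sandwich_mop[where Ps = "\<lambda>s. PT T (T - s)" and X = "\<lambda>s. mop (PT T (T - s))"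
          and X' = "\<lambda>s. mop (- P' (T - s))" and \<kappa> = 1, OF _ _ psd_P _ _ _ _ _ _ _ cost1 \<delta> _ _ _ s])
      show "continuous_on {0..T} (\<lambda>s. PT T (T - s))" using rev by (rule continuous_on_vector_derivative)
      show "ric_value (mop (cA c)) (mop (cC c)) P_cost P (mop P) z = 0" for z
        using ric_value_P[OF psd_P, of 0 z] alg_ric by (simp add: solves_alg_riccati_def)
      show "inner z (mop (- P' (T - s)) z)
          = ric_value (mop (cA c)) (mop (cC c)) P_cost (PT T (T - s)) (mop (PT T (T - s))) z"
        if "s \<in> {0..T}" for s z
        by (rule ric_value_P[symmetric]) (use psd_PT[OF T] P'(2) that in auto)
    qed (use psd_PT[OF T] PTT mop_nonneg[OF psd_P] mop_sym[OF sP] mop_sym[OF sPT] rev in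
        \<open>auto intro!: has_vector_derivative_mop\<close>)
  qed
  have sandX: "(1 - exp (- \<delta> * s)) * inner x (Xb x) \<le> inner x (X T (T - s) x)
      \<and> inner x (X T (T - s) x) \<le> inner x (Xb x)"
    if T: "T > 0" and s: "s \<in> {0..T}" for T s x
  proof -
    have mem: "T - s \<in> {0..T}" if "s \<in> {0..T}" for s using that by auto
    obtain P' where P': "\<And>t. t \<in> {0..T} \<Longrightarrow> (PT T has_vector_derivative P' t) (at t within {0..T})"
      using P_eq[OF T] unfolding solves_P_eq_def by blast
    \<comment> \<open>Now P is a given coefficient: with \<kappa> = 0 the coupling conditions reduce
      to the two halves of \<open>sandP\<close>.\<close>
    show ?thesis
    proof (rule riccati_sandwich_mop[where Ps = "\<lambda>s. PT T (T - s)" and X = "\<lambda>s. X T (T - s)"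
          and X' = "\<lambda>s. - dX T (T - s)" and \<kappa> = 0, OF _ _ psd_P _ _ _ Xb_sym Xb_nonneg _ _ cost2 \<delta> _ _ _ s])
      show "continuous_on {0..T} (\<lambda>s. PT T (T - s))"
        by (rule continuous_on_vector_derivative[OF has_vector_derivative_reverse[OF P'[OF mem]]]) auto
      show "((\<lambda>s. X T (T - s)) has_vector_derivative - dX T (T - s)) (at s within {0..T})" if "s \<in> {0..T}" for s
        by (rule has_vector_derivative_reverse[OF X_deriv[OF T mem[OF that]] that])
      show "ric_value (opA c) (opC c) X_cost P Xb z = 0" for z
        by (simp add: ric_value_bilinear algebraic_operator_riccati)
      show "inner z ((- dX T (T - s)) z)
          = ric_value (opA c) (opC c) X_cost (PT T (T - s)) (X T (T - s)) z"
        if "s \<in> {0..T}" for s z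
        using dX_form[OF T mem[OF that], of z z] by (simp add: ric_value_bilinear blinfun.minus_left)
      fix s \<psi> assume s: "s \<in> {0..T}"
      show "0 * inner \<psi> ((X T (T - s) - (1 - exp (- \<delta> * s)) *\<^sub>R Xb) \<psi>)
          \<le> inner \<psi> ((mop (PT T (T - s)) - (1 - exp (- \<delta> * s)) *\<^sub>R mop P) \<psi>)"
        using sandP[OF T s, of \<psi>] by (simp add: blinfun.diff_left blinfun.scaleR_left inner_diff_right)
      show "0 * inner \<psi> ((Xb - X T (T - s)) \<psi>) \<le> inner \<psi> ((mop P - mop (PT T (T - s))) \<psi>)"
        using sandP[OF T s, of \<psi>] by (simp add: blinfun.diff_left inner_diff_right)
    qed (use psd_PT[OF T] X_terminal[OF T] X_sym[OF T] in auto)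
  qed
  show ?thesis
  proof (rule that[OF \<delta>])
    fix T s :: real assume T: "T > 0" and s: "s \<in> {0..T}"
    then have mem: "T - s \<in> {0..T}" by auto
    show "norm (mop P - mop (PT T (T - s))) \<le> norm (mop P) * exp (- \<delta> * s)"
      by (intro to_norm sandP T s mop_sym sP psd_mat_sym[OF psd_PT[OF T mem]])
    show "norm (Xb - X T (T - s)) \<le> norm Xb * exp (- \<delta> * s)"
      by (intro to_norm sandX T s Xb_sym X_sym[OF T mem])
  qed
qed

end

section \<open>Convergence of \<open>p\<^sub>T\<close> and of the feedback\<close>

context lq_turnpike
begin

lemma R_map_Ri: "psd_mat Q \<Longrightarrow> mop (R_map c Q) (Ri Q z) = z"
  by (simp add: mop_mult[symmetric] pd_mat_inverse(1)[OF pd_R_map[OF _ pd_R]] mop_one)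

lemma Ri_R_map: "psd_mat Q \<Longrightarrow> Ri Q (mop (R_map c Q) z) = z"
  by (simp add: mop_mult[symmetric] pd_mat_inverse(2)[OF pd_R_map[OF _ pd_R]] mop_one)

lemma Ri_sym: "psd_mat Q \<Longrightarrow> inner x (Ri Q y) = inner (Ri Q x) y"
  by (rule mop_sym[OF pd_mat_inverse(3)[OF pd_R_map[OF _ pd_R]]])

text \<open>Collects under one rate and one constant, both independent of T, every coefficient of
  the equation for p that differs between the finite and the infinite horizon.\<close>

definition perturbation_bound :: "real \<Rightarrow> real \<Rightarrow> bool" where
  "perturbation_bound \<delta> k \<longleftrightarrow> \<delta> > 0 \<and> k > 0 \<and>
    (\<forall>Q z. psd_mat Q \<longrightarrow> norm (Ri Q z) \<le> k * norm z) \<and>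
    (\<forall>x. norm (opN c P Xb x) \<le> k * norm x) \<and>
    (\<forall>T>0. \<forall>s\<in>{0..T}.
       norm (mop P - mop (PT T (T - s))) \<le> k * exp (- \<delta> * s) \<and>
       norm (Xb - X T (T - s)) \<le> k * exp (- \<delta> * s) \<and>
       (\<forall>z. norm (Ri (PT T (T - s)) z - Ri P z) \<le> k * exp (- \<delta> * s) * norm z) \<and>
       (\<forall>x. norm (opN c P Xb x - opN c (PT T (T - s)) (X T (T - s)) x) \<le> k * exp (- \<delta> * s) * norm x))"

lemma perturbation_bounds:
  obtains \<delta> k where "perturbation_bound \<delta> k"
proof -
  obtain \<delta> where \<delta>: "\<delta> > 0"
    "\<And>T s. T > 0 \<Longrightarrow> s \<in> {0..T} \<Longrightarrow> norm (mop P - mop (PT T (T - s))) \<le> norm (mop P) * exp (- \<delta> * s)"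
    "\<And>T s. T > 0 \<Longrightarrow> s \<in> {0..T} \<Longrightarrow> norm (Xb - X T (T - s)) \<le> norm Xb * exp (- \<delta> * s)"
    using operator_convergence by blast
  obtain \<rho> where \<rho>: "\<rho> > 0" "\<And>P x. psd_mat P \<Longrightarrow> norm (Ri P x) \<le> \<rho> * norm x"
    by (rule R_inv_bound) blast
  define dD where "dD = norm (mop (transpose (cD c)))"
  define dB where "dB = norm (mop (transpose (cB c)))"
  define n0 where "n0 = dB * norm Xb + dD * (norm (mop P) * norm (opC c)) + norm (mop (cS c))"
  define k1 where "k1 = dB * norm Xb + dD * (norm (mop P) * norm (opC c))"
  define k2 where "k2 = \<rho> * (dD * (norm (mop P) * (norm (mop (cD c)) * \<rho>)))"
  have nn: "0 \<le> n0" "0 \<le> k1" "0 \<le> k2"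
    using \<rho>(1) by (auto simp: n0_def k1_def k2_def dD_def dB_def)
  have Nb: "norm (opN c P Xb x) \<le> n0 * norm x" for x
    using norm_lin_op_le[of "opC c" P Xb x] by (simp add: lin_op_def opN_def n0_def dD_def dB_def)
  have Nd: "norm (opN c P Xb x - opN c (PT T (T - s)) (X T (T - s)) x) \<le> k1 * exp (- \<delta> * s) * norm x"
    if "T > 0" "s \<in> {0..T}" for T s x
  proof -
    let ?e = "exp (- \<delta> * s)"
    have "opN c P Xb x - opN c (PT T (T - s)) (X T (T - s)) x = mop (transpose (cB c)) ((Xb - X T (T - s)) x)
        + mop (transpose (cD c)) ((mop P - mop (PT T (T - s))) (opC c x))"
      by (simp add: opN_def blinfun.diff_left blinfun.diff_right)
    also have "norm \<dots> \<le> norm (mop (transpose (cB c)) ((Xb - X T (T - s)) x))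
        + norm (mop (transpose (cD c)) ((mop P - mop (PT T (T - s))) (opC c x)))"
      by (rule norm_triangle_ineq)
    also have "\<dots> \<le> dB * ((norm Xb * ?e) * norm x) + dD * ((norm (mop P) * ?e) * (norm (opC c) * norm x))"
      unfolding dB_def dD_def
      by (intro add_mono order_trans[OF norm_blinfun] mult_mono mult_left_mono \<delta>(2,3) that norm_blinfun) auto
    finally show ?thesis by (simp add: k1_def algebra_simps)
  qed
  have Rd: "norm (Ri (PT T (T - s)) z - Ri P z) \<le> k2 * exp (- \<delta> * s) * norm z"
    if T: "T > 0" and s: "s \<in> {0..T}" for T s z
  proof -
    let ?e = "exp (- \<delta> * s)" and ?Q = "PT T (T - s)"
    have psd: "psd_mat ?Q" using psd_PT[OF T, of "T - s"] s by auto
    define y where "y = Ri P z"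
    have z: "mop (R_map c P) y = z" by (simp add: y_def R_map_Ri[OF psd_P])
    \<comment> \<open>The resolvent identity: a difference of inverses equals one inverse applied to
      the difference of the R maps at the other.\<close>
    have "Ri ?Q z - y = Ri ?Q (mop (R_map c P) y - mop (R_map c ?Q) y)"
      by (simp add: blinfun.diff_right z Ri_R_map[OF psd])
    also have "mop (R_map c P) y - mop (R_map c ?Q) y
        = mop (transpose (cD c)) ((mop P - mop ?Q) (mop (cD c) y))"
      by (simp add: R_map_def mop_add mop_mult blinfun.add_left blinfun.diff_left blinfun.diff_right)
    finally have "norm (Ri ?Q z - y) \<le> \<rho> * norm (mop (transpose (cD c)) ((mop P - mop ?Q) (mop (cD c) y)))"
      using \<rho>(2)[OF psd] by simp
    also have "\<dots> \<le> \<rho> * (dD * ((norm (mop P) * ?e) * (norm (mop (cD c)) * (\<rho> * norm z))))"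
      unfolding dD_def y_def
      by (intro mult_left_mono order_trans[OF norm_blinfun] mult_mono \<delta>(2) T s \<rho>(2) psd_P) (use \<rho>(1) in auto)
    finally show ?thesis by (simp add: k2_def y_def mult_ac)
  qed
  define k where "k = \<rho> + n0 + k1 + k2 + norm (mop P) + norm Xb"
  have "k > 0" using \<rho>(1) nn by (simp add: k_def add_pos_nonneg)
  have le: "a * b \<le> k * b" if "a \<le> k" "0 \<le> b" for a b :: real using that by (rule mult_right_mono)
  show ?thesis
  proof (rule that[of \<delta> k], unfold perturbation_bound_def, intro conjI allI ballI impI \<delta>(1) \<open>k > 0\<close>)
    show "norm (Ri Q z) \<le> k * norm z" if "psd_mat Q" for Q z
      by (rule order_trans[OF \<rho>(2)[OF that] le]) (use nn in \<open>auto simp: k_def\<close>)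
    show "norm (opN c P Xb x) \<le> k * norm x" for x
      by (rule order_trans[OF Nb le]) (use nn \<rho>(1) in \<open>auto simp: k_def\<close>)
    fix T s :: real assume T: "T > 0" and s: "s \<in> {0..T}"
    show "norm (mop P - mop (PT T (T - s))) \<le> k * exp (- \<delta> * s)"
      by (rule order_trans[OF \<delta>(2)[OF T s] le]) (use nn \<rho>(1) in \<open>auto simp: k_def\<close>)
    show "norm (Xb - X T (T - s)) \<le> k * exp (- \<delta> * s)"
      by (rule order_trans[OF \<delta>(3)[OF T s] le]) (use nn \<rho>(1) in \<open>auto simp: k_def\<close>)
    show "norm (Ri (PT T (T - s)) z - Ri P z) \<le> k * exp (- \<delta> * s) * norm z" for z
      by (rule order_trans[OF Rd[OF T s] mult_right_mono[OF le]]) (use nn \<rho>(1) in \<open>auto simp: k_def\<close>)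
    show "norm (opN c P Xb x - opN c (PT T (T - s)) (X T (T - s)) x) \<le> k * exp (- \<delta> * s) * norm x" for x
      by (rule order_trans[OF Nd[OF T s] mult_right_mono[OF le]]) (use nn \<rho>(1) in \<open>auto simp: k_def\<close>)
  qed
qed

definition closed_loop :: "(real^'d) l2 \<Rightarrow> (real^'d) l2" where
  "closed_loop x = opA c x - mop (cB c) (Ri P (opN c P Xb x))"

text \<open>At the optimal feedback the Riccati form vanishes, so the derivative of the energy is
  minus the sum of the noise term, which is nonnegative, and the coercive cost.\<close>

lemma closed_loop_lyapunov:
  obtains \<epsilon> where "\<epsilon> > 0" "\<And>x. 2 * inner (closed_loop x) (Xb x) \<le> - \<epsilon> * (norm x)\<^sup>2"
proof -
  obtain \<epsilon> where \<epsilon>: "\<epsilon> > 0" "\<And>\<theta> z. \<epsilon> * (norm z)\<^sup>2 \<le> quad_cost X_cost \<theta> z"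
    using state_cost_coercive by blast
  have "2 * inner (closed_loop x) (Xb x) \<le> - \<epsilon> * (norm x)\<^sup>2" for x
  proof -
    define \<theta> where "\<theta> = feedback (opC c) P Xb x"
    have cl: "closed_loop x = opA c x + mop (cB c) \<theta>"
      by (simp add: closed_loop_def \<theta>_def feedback_def lin_op_def opN_def blinfun.minus_right)
    have "form (opA c) (opC c) X_cost Xb (mop P) \<theta> x = 0"
      unfolding \<theta>_def ric_form_feedback[OF psd_P] by (simp add: ric_value_bilinear algebraic_operator_riccati)
    then have "2 * inner (closed_loop x) (Xb x) + inner (opC c x + mop (cD c) \<theta>) (mop P (opC c x + mop (cD c) \<theta>))
        + quad_cost X_cost \<theta> x = 0"
      by (simp add: ric_form_def cl)
    with mop_nonneg[OF psd_P, of "opC c x + mop (cD c) \<theta>"] \<epsilon>(2)[of x \<theta>] show ?thesis by linarith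
  qed
  with \<epsilon>(1) show ?thesis by (rule that)
qed

lemma p_L2: "p \<in> L2 LI"
  using alg_Lp by (simp add: solves_alg_Lam_p_def)

lemma has_l2I: "f \<in> L2 LI \<Longrightarrow> has_l2 f (l2 f)"
  by (simp add: has_l2_def)

definition b0 :: "(real^'d) l2" where "b0 = l2 (\<lambda>_. cb c)"
definition \<sigma>0 :: "(real^'d) l2" where "\<sigma>0 = l2 (\<lambda>_. csigma c)"

lemma gam_eq: "gam Q q = mop (transpose (cD c)) (mop Q \<sigma>0) + mop (transpose (cB c)) q"
  by (simp add: gam_def \<sigma>0_def)

lemma algebraic_p_weak:
  "inner (opA c x) (l2 p) + inner (Xb x) b0 + inner (opC c x) (mop P \<sigma>0)
    - inner (opN c P Xb x) (Ri P (gam P (l2 p))) = 0"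
  using weak_p_equation[OF L_L2 psd_P psd_Pib kop_L_sym has_l2I[OF p_L2] has_l2I[OF L2_zero], of x] alg_Lp
  by (simp add: Xb_def b0_def \<sigma>0_def solves_alg_Lam_p_def zero_l2_def[symmetric])

lemma finite_horizon_p_weak:
  assumes T: "T > 0"
  obtains q' where
    "\<And>t. t \<in> {0..T} \<Longrightarrow> ((\<lambda>t. l2 (pT T t)) has_vector_derivative q' t) (at t within {0..T})"
    "\<And>t x. t \<in> {0..T} \<Longrightarrow> inner x (q' t) + inner (opA c x) (l2 (pT T t)) + inner (X T t x) b0
       + inner (opC c x) (mop (PT T t) \<sigma>0)
       - inner (opN c (PT T t) (X T t) x) (Ri (PT T t) (gam (PT T t) (l2 (pT T t)))) = 0"
proof -
  obtain p' where p': "C1_L2 LI {0..T} (pT T) p'"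
    "\<And>t. t \<in> {0..T} \<Longrightarrow> AE u in LI. p' t u + Ft_map c (PT T t) (PibT T t - PT T t) (LamT T t) (pT T t) u = 0"
    using p_eq[OF T] unfolding solves_p_eq_def by blast
  show ?thesis
  proof (rule that[of "\<lambda>t. l2 (p' t)"])
    fix t assume t: "t \<in> {0..T}"
    show "((\<lambda>t. l2 (pT T t)) has_vector_derivative l2 (p' t)) (at t within {0..T})"
      by (rule C1_L2_l2[OF p'(1) t])
    have m: "pT T t \<in> L2 LI" "p' t \<in> L2 LI" using p'(1) t by (auto simp: C1_L2_def)
    have symL: "inner x (kop (LamT T t) y) = inner (kop (LamT T t) x) y" for x y
      using X_sym[OF T t, of x y] mop_sym[OF psd_mat_sym[OF psd_PibT[OF T t]], of x y]
      by (simp add: X_def opX_def blinfun.add_left inner_add_left inner_add_right)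
    fix x
    show "inner x (l2 (p' t)) + inner (opA c x) (l2 (pT T t)) + inner (X T t x) b0
       + inner (opC c x) (mop (PT T t) \<sigma>0)
       - inner (opN c (PT T t) (X T t) x) (Ri (PT T t) (gam (PT T t) (l2 (pT T t)))) = 0"
      unfolding X_def b0_def \<sigma>0_def
      by (rule weak_p_equation[OF LamT_L2[OF T t] psd_PT[OF T t] psd_PibT[OF T t] symL
            has_l2I[OF m(1)] has_l2I[OF m(2)] p'(2)[OF t]])
  qed
qed

lemma pT_L2: "T > 0 \<Longrightarrow> t \<in> {0..T} \<Longrightarrow> pT T t \<in> L2 LI"
  using p_eq by (fastforce simp: solves_p_eq_def C1_L2_def)

lemma pT_terminal: "T > 0 \<Longrightarrow> l2 (pT T T) = 0"
  using p_eq[of T] pT_L2[of T T] by (intro l2_zero) (auto simp: solves_p_eq_def)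

lemma gam_diff:
  "gam P (l2 p) - gam Q q = mop (transpose (cD c)) ((mop P - mop Q) \<sigma>0) + mop (transpose (cB c)) (l2 p - q)"
  by (simp add: gam_eq blinfun.diff_left blinfun.diff_right)

lemma p_convergence:
  obtains K r where "K > 0" "r > 0"
    "\<And>T s. T > 0 \<Longrightarrow> s \<in> {0..T} \<Longrightarrow> norm (l2 p - l2 (pT T (T - s))) \<le> K * exp (- r * s)"
proof -
  obtain \<delta> k where pert: "perturbation_bound \<delta> k" by (rule perturbation_bounds)
  then have \<delta>: "\<delta> > 0" and k: "k > 0" and Ri_le: "\<And>Q z. psd_mat Q \<Longrightarrow> norm (Ri Q z) \<le> k * norm z"
    and Nb_le: "\<And>x. norm (opN c P Xb x) \<le> k * norm x"
    by (auto simp: perturbation_bound_def)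
  obtain \<epsilon> where \<epsilon>: "\<epsilon> > 0" "\<And>x. 2 * inner (closed_loop x) (Xb x) \<le> - \<epsilon> * (norm x)\<^sup>2"
    using closed_loop_lyapunov by blast
  obtain \<kappa> where \<kappa>: "\<kappa> > 0" "\<And>v. \<kappa> * (norm v)\<^sup>2 \<le> inner v (Pib *v v)"
    using pd_mat_coercive[OF pd_Pib] by blast
  have Xb_coercive: "\<kappa> * (norm x)\<^sup>2 \<le> inner x (Xb x)" for x
    by (rule order_trans[OF mop_coercive[OF \<kappa>(2)] Xb_ge])
  define gb where "gb = gam P (l2 p)"
  define dD where "dD = norm (mop (transpose (cD c)))"
  define dB where "dB = norm (mop (transpose (cB c)))"
  have A_le: "norm (closed_loop x) \<le> (norm (opA c) + norm (mop (cB c)) * (k * k)) * norm x" for x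
  proof -
    have "norm (mop (cB c) (Ri P (opN c P Xb x))) \<le> norm (mop (cB c)) * (k * (k * norm x))"
      by (intro order_trans[OF norm_blinfun] mult_left_mono order_trans[OF Ri_le[OF psd_P]] Nb_le) (use k in auto)
    then show ?thesis
      using norm_triangle_ineq4[of "opA c x" "mop (cB c) (Ri P (opN c P Xb x))"] norm_blinfun[of "opA c" x]
      by (simp add: closed_loop_def algebra_simps)
  qed
  \<comment> \<open>Bounds the change of the feedback term between finite and infinite horizon: the
    first product comes from the change of the inverse of R, with |opN| \<le> (k + k)|x|, the second
    from the change of \<open>opN\<close>.\<close>
  define kE where "kE = (k + k) * k + k * k"
  \<comment> \<open>One summand for each of the five error terms estimated below. The last one
    multiplies |e|, which is why \<open>dual_exponential_stability\<close> admits a perturbation of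
    size 1 + |e|.\<close>
  define C where "C = k * norm b0 + norm (opC c) * (k * norm \<sigma>0) + kE * norm gb
     + (k + k) * (k * (dD * (k * norm \<sigma>0))) + kE * dB"
  have C: "C \<ge> 0" using k by (auto simp: C_def kE_def dD_def dB_def)
  obtain K r where K: "K > 0" and r: "r > 0" and stab: "\<And>T e e'.
    (\<forall>s\<in>{0..T}. (e has_vector_derivative e' s) (at s within {0..T})) \<Longrightarrow>
    norm (e 0) \<le> norm (l2 p) \<Longrightarrow>
    (\<forall>s\<in>{0..T}. \<forall>x. \<bar>inner x (e' s) - inner (closed_loop x) (e s)\<bar>
       \<le> C * exp (- \<delta> * s) * (1 + norm (e s)) * norm x) \<Longrightarrow>
    (\<forall>s\<in>{0..T}. norm (e s) \<le> K * exp (- r * s))"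
    using dual_exponential_stability[OF Xb_sym \<kappa>(1) Xb_coercive \<epsilon> A_le C \<delta> norm_ge_zero[of "l2 p"]] by blast
  show ?thesis
  proof (rule that[OF K r])
    fix T s :: real assume T: "T > 0" and s: "s \<in> {0..T}"
    obtain q' where q': "\<And>t. t \<in> {0..T} \<Longrightarrow> ((\<lambda>t. l2 (pT T t)) has_vector_derivative q' t) (at t within {0..T})"
      "\<And>t x. t \<in> {0..T} \<Longrightarrow> inner x (q' t) + inner (opA c x) (l2 (pT T t)) + inner (X T t x) b0
       + inner (opC c x) (mop (PT T t) \<sigma>0)
       - inner (opN c (PT T t) (X T t) x) (Ri (PT T t) (gam (PT T t) (l2 (pT T t)))) = 0"
      using finite_horizon_p_weak[OF T] by blast
    have mem: "T - s \<in> {0..T}" if "s \<in> {0..T}" for s using that by auto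
    \<comment> \<open>The signs of the time reversal and of the subtraction cancel, so the error has
      derivative q'(T - s). At s = 0 the terminal condition leaves only p.\<close>
    have "\<forall>s\<in>{0..T}. norm (l2 p - l2 (pT T (T - s))) \<le> K * exp (- r * s)"
    proof (rule stab[where e = "\<lambda>s. l2 p - l2 (pT T (T - s))" and e' = "\<lambda>s. q' (T - s)"], intro ballI)
      fix s assume s: "s \<in> {0..T}"
      show "((\<lambda>s. l2 p - l2 (pT T (T - s))) has_vector_derivative q' (T - s)) (at s within {0..T})"
        using has_vector_derivative_diff[OF has_vector_derivative_const has_vector_derivative_reverse[OF q'(1)[OF mem[OF s]] s]]
        by simp
    next
      show "norm (l2 p - l2 (pT T (T - 0))) \<le> norm (l2 p)" using T by (simp add: pT_terminal)
    next
      show "\<forall>s\<in>{0..T}. \<forall>x. \<bar>inner x (q' (T - s)) - inner (closed_loop x) (l2 p - l2 (pT T (T - s)))\<bar>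
          \<le> C * exp (- \<delta> * s) * (1 + norm (l2 p - l2 (pT T (T - s)))) * norm x"
      proof (intro ballI allI)
        fix s x assume s: "s \<in> {0..T}"
        define \<eta> where "\<eta> = exp (- \<delta> * s)"
        define Q where "Q = PT T (T - s)"
        define Y where "Y = X T (T - s)"
        define q where "q = l2 (pT T (T - s))"
        define e where "e = l2 p - q"
        define Ns where "Ns = opN c Q Y x"
        define Nb where "Nb = opN c P Xb x"
        define Be where "Be = mop (transpose (cB c)) e"
        define Ds where "Ds = mop (transpose (cD c)) ((mop P - mop Q) \<sigma>0)"
        \<comment> \<open>The mismatch of the two feedback terms on the same input. On
          \<open>gb\<close> it is a source independent of the error; on \<open>Be\<close> it is
          proportional to the error.\<close>
        define E where "E g = inner Ns (Ri Q g) - inner Nb (Ri P g)" for g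
        have psdQ: "psd_mat Q" using psd_PT[OF T mem[OF s]] by (simp add: Q_def)
        have \<eta>: "0 \<le> \<eta>" "\<eta> \<le> 1" using \<delta> s by (auto simp: \<eta>_def)
        have P\<eta>: "norm (mop P - mop Q) \<le> k * \<eta>" and X\<eta>: "norm (Xb - Y) \<le> k * \<eta>"
          and R\<eta>: "norm (Ri Q z - Ri P z) \<le> k * \<eta> * norm z" and N\<eta>: "norm (Nb - Ns) \<le> k * \<eta> * norm x" for z
          using pert T s by (simp_all add: perturbation_bound_def Q_def Y_def \<eta>_def Nb_def Ns_def)
        have Ns_le: "norm Ns \<le> (k + k) * norm x"
        proof -
          have "k * \<eta> * norm x \<le> k * 1 * norm x" using \<eta> k by (intro mult_right_mono mult_left_mono) auto
          then show ?thesis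
            using N\<eta> Nb_le[of x] norm_triangle_ineq4[of Nb "Nb - Ns"] by (simp add: Nb_def distrib_right)
        qed
        have E_le: "\<bar>E g\<bar> \<le> kE * \<eta> * norm x * norm g" for g
        proof -
          have "E g = inner Ns (Ri Q g - Ri P g) - inner (Nb - Ns) (Ri P g)"
            by (simp add: E_def inner_diff_left inner_diff_right)
          then have "\<bar>E g\<bar> \<le> \<bar>inner Ns (Ri Q g - Ri P g)\<bar> + \<bar>inner (Nb - Ns) (Ri P g)\<bar>" by simp
          also have "\<dots> \<le> norm Ns * norm (Ri Q g - Ri P g) + norm (Nb - Ns) * norm (Ri P g)"
            by (intro add_mono Cauchy_Schwarz_ineq2)
          also have "\<dots> \<le> ((k + k) * norm x) * (k * \<eta> * norm g) + (k * \<eta> * norm x) * (k * norm g)"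
            using k \<eta> by (intro add_mono mult_mono Ns_le R\<eta> N\<eta> Ri_le psd_P mult_nonneg_nonneg) auto
          finally show ?thesis by (simp add: kE_def algebra_simps)
        qed
        have gs: "gam Q q = gb - Ds - Be"
          using gam_diff[of Q q] by (simp add: gb_def Ds_def Be_def e_def algebra_simps)
        \<comment> \<open>This part of the feedback, taken with the limit coefficients, completes
          \<open>opA\<close> to \<open>closed_loop\<close>; everything else is perturbation.\<close>
        have Be_adj: "inner (mop (cB c) (Ri P Nb)) e = inner Nb (Ri P Be)"
          by (simp add: Be_def Ri_sym[OF psd_P] inner_mop_transpose)
        have w1: "inner x (q' (T - s)) + inner (opA c x) q + inner (Y x) b0
           + inner (opC c x) (mop Q \<sigma>0) - inner Ns (Ri Q (gb - Ds - Be)) = 0"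
          using q'(2)[OF mem[OF s], of x] unfolding gs[symmetric] Q_def q_def Y_def Ns_def .
        have w2: "inner (opA c x) (l2 p) + inner (Xb x) b0 + inner (opC c x) (mop P \<sigma>0) - inner Nb (Ri P gb) = 0"
          unfolding Nb_def gb_def by (rule algebraic_p_weak)
        have "inner x (q' (T - s)) - inner (closed_loop x) e = inner ((Xb - Y) x) b0
            + inner (opC c x) ((mop P - mop Q) \<sigma>0) + E gb - inner Ns (Ri Q Ds) - E Be"
          using w1 w2 Be_adj
          by (simp add: closed_loop_def Nb_def[symmetric] E_def e_def inner_diff_left inner_diff_right
              blinfun.diff_left blinfun.diff_right)
        then have "\<bar>inner x (q' (T - s)) - inner (closed_loop x) e\<bar> \<le> \<bar>inner ((Xb - Y) x) b0\<bar>
            + \<bar>inner (opC c x) ((mop P - mop Q) \<sigma>0)\<bar> + \<bar>E gb\<bar> + \<bar>inner Ns (Ri Q Ds)\<bar> + \<bar>E Be\<bar>"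
          by linarith
        also have "\<dots> \<le> (k * \<eta> * norm x) * norm b0 + (norm (opC c) * norm x) * (k * \<eta> * norm \<sigma>0)
            + kE * \<eta> * norm x * norm gb + ((k + k) * norm x) * (k * (dD * (k * \<eta> * norm \<sigma>0)))
            + kE * \<eta> * norm x * (dB * norm e)"
        proof (intro add_mono)
          have PQ: "norm ((mop P - mop Q) \<sigma>0) \<le> k * \<eta> * norm \<sigma>0"
            by (rule order_trans[OF norm_blinfun mult_right_mono[OF P\<eta>]]) simp
          have "norm ((Xb - Y) x) \<le> k * \<eta> * norm x"
            by (rule order_trans[OF norm_blinfun mult_right_mono[OF X\<eta>]]) simp
          then show "\<bar>inner ((Xb - Y) x) b0\<bar> \<le> (k * \<eta> * norm x) * norm b0"
            by (intro order_trans[OF Cauchy_Schwarz_ineq2] mult_right_mono) auto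
          show "\<bar>inner (opC c x) ((mop P - mop Q) \<sigma>0)\<bar> \<le> (norm (opC c) * norm x) * (k * \<eta> * norm \<sigma>0)"
            by (intro order_trans[OF Cauchy_Schwarz_ineq2] mult_mono norm_blinfun PQ) auto
          have "norm Ds \<le> dD * (k * \<eta> * norm \<sigma>0)"
            unfolding Ds_def dD_def by (intro order_trans[OF norm_blinfun] mult_left_mono PQ) auto
          then have "norm (Ri Q Ds) \<le> k * (dD * (k * \<eta> * norm \<sigma>0))"
            by (intro order_trans[OF Ri_le[OF psdQ]] mult_left_mono) (use k in auto)
          then show "\<bar>inner Ns (Ri Q Ds)\<bar> \<le> ((k + k) * norm x) * (k * (dD * (k * \<eta> * norm \<sigma>0)))"
            by (intro order_trans[OF Cauchy_Schwarz_ineq2] mult_mono Ns_le) (use k in auto)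
          have "norm Be \<le> dB * norm e" unfolding Be_def dB_def by (rule norm_blinfun)
          then show "\<bar>E Be\<bar> \<le> kE * \<eta> * norm x * (dB * norm e)"
            by (intro order_trans[OF E_le] mult_left_mono) (use k \<eta> in \<open>auto simp: kE_def\<close>)
        qed (rule E_le)
        also have "\<dots> \<le> C * \<eta> * (1 + norm e) * norm x"
        proof -
          have "0 \<le> (C - kE * dB) * \<eta> * norm e * norm x + kE * dB * \<eta> * norm x"
            using k \<eta> by (intro add_nonneg_nonneg mult_nonneg_nonneg) (auto simp: C_def kE_def dD_def dB_def)
          then show ?thesis by (simp add: C_def algebra_simps)
        qed
        finally show "\<bar>inner x (q' (T - s)) - inner (closed_loop x) (l2 p - l2 (pT T (T - s)))\<bar>
          \<le> C * exp (- \<delta> * s) * (1 + norm (l2 p - l2 (pT T (T - s)))) * norm x"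
          by (simp add: e_def q_def \<eta>_def)
      qed
    qed
    with s show "norm (l2 p - l2 (pT T (T - s))) \<le> K * exp (- r * s)" by blast
  qed
qed

lemma has_l2_theta:
  assumes "has_l2 f q"
  shows "has_l2 (theta_map c Q f) (- Ri Q (gam Q q))"
  using has_l2_diff[OF has_l2_const[of 0] has_l2_mop[OF has_l2_Gamma[OF assms, of Q], of "matrix_inv (R_map c Q)"]]
  by (simp add: theta_map_def[abs_def] zero_l2_def[symmetric])

lemma theta_convergence:
  obtains K r where "K > 0" "r > 0"
    "\<And>T s. T > 0 \<Longrightarrow> s \<in> {0..T} \<Longrightarrow>
      norm (Ri (PT T (T - s)) (gam (PT T (T - s)) (l2 (pT T (T - s)))) - Ri P (gam P (l2 p))) \<le> K * exp (- r * s)"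
proof -
  obtain K r where K: "K > 0" and r: "r > 0"
    and p_le: "\<And>T s. T > 0 \<Longrightarrow> s \<in> {0..T} \<Longrightarrow> norm (l2 p - l2 (pT T (T - s))) \<le> K * exp (- r * s)"
    using p_convergence by blast
  obtain \<delta> k where pert: "perturbation_bound \<delta> k" by (rule perturbation_bounds)
  then have \<delta>: "\<delta> > 0" and k: "k > 0" and Ri_le: "\<And>Q z. psd_mat Q \<Longrightarrow> norm (Ri Q z) \<le> k * norm z"
    by (auto simp: perturbation_bound_def)
  define gb where "gb = gam P (l2 p)"
  define dD where "dD = norm (mop (transpose (cD c)))"
  define dB where "dB = norm (mop (transpose (cB c)))"
  define K' where "K' = k * norm gb + k * (dD * (k * norm \<sigma>0) + dB * K) + 1"
  \<comment> \<open>The feedback depends on the Riccati solution and on p, so the slower of the two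
    rates survives.\<close>
  define r' where "r' = min \<delta> r"
  show ?thesis
  proof (rule that[of K' r'])
    show "K' > 0" using k K by (auto simp: K'_def dD_def dB_def intro!: add_nonneg_pos)
    show "r' > 0" using \<delta> r by (simp add: r'_def)
    fix T s :: real assume T: "T > 0" and s: "s \<in> {0..T}"
    define Q where "Q = PT T (T - s)"
    define q where "q = l2 (pT T (T - s))"
    define \<eta> where "\<eta> = exp (- r' * s)"
    have "T - s \<in> {0..T}" using s by auto
    then have psdQ: "psd_mat Q" using psd_PT[OF T] by (simp add: Q_def)
    have e1: "exp (- \<delta> * s) \<le> \<eta>" and e2: "exp (- r * s) \<le> \<eta>"
      using s by (auto simp: \<eta>_def r'_def mult_right_mono)
    have P\<eta>: "norm (mop P - mop Q) \<le> k * \<eta>"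
      using pert T s k order_trans[OF _ mult_left_mono[OF e1, of k]] by (auto simp: perturbation_bound_def Q_def)
    have R\<eta>: "norm (Ri Q z - Ri P z) \<le> k * \<eta> * norm z" for z
      using pert T s k order_trans[OF _ mult_right_mono[OF mult_left_mono[OF e1, of k]]]
      by (auto simp: perturbation_bound_def Q_def)
    have p\<eta>: "norm (l2 p - q) \<le> K * \<eta>"
      using order_trans[OF p_le[OF T s] mult_left_mono[OF e2]] K by (simp add: q_def)
    have g: "norm (gb - gam Q q) \<le> dD * (k * \<eta> * norm \<sigma>0) + dB * (K * \<eta>)"
    proof -
      have PQ: "norm ((mop P - mop Q) \<sigma>0) \<le> k * \<eta> * norm \<sigma>0"
        by (rule order_trans[OF norm_blinfun mult_right_mono[OF P\<eta>]]) simp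
      have "norm (mop (transpose (cD c)) ((mop P - mop Q) \<sigma>0)) \<le> dD * (k * \<eta> * norm \<sigma>0)"
        unfolding dD_def by (rule order_trans[OF norm_blinfun mult_left_mono[OF PQ]]) simp
      moreover have "norm (mop (transpose (cB c)) (l2 p - q)) \<le> dB * (K * \<eta>)"
        unfolding dB_def by (rule order_trans[OF norm_blinfun mult_left_mono[OF p\<eta>]]) simp
      ultimately show ?thesis
        unfolding gb_def gam_diff by (intro order_trans[OF norm_triangle_ineq] add_mono)
    qed
    \<comment> \<open>Splits the difference into the change of the inverse of R at a fixed vector
      and a uniformly bounded inverse applied to the change of that vector.\<close>
    have "Ri Q (gam Q q) - Ri P gb = (Ri Q gb - Ri P gb) - Ri Q (gb - gam Q q)"
      by (simp add: blinfun.diff_right)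
    then have "norm (Ri Q (gam Q q) - Ri P gb) \<le> norm (Ri Q gb - Ri P gb) + norm (Ri Q (gb - gam Q q))"
      using norm_triangle_ineq4 by metis
    also have "\<dots> \<le> k * \<eta> * norm gb + k * (dD * (k * \<eta> * norm \<sigma>0) + dB * (K * \<eta>))"
      by (intro add_mono R\<eta> order_trans[OF Ri_le[OF psdQ]] mult_left_mono g) (use k in auto)
    also have "\<dots> \<le> K' * \<eta>"
      by (simp add: K'_def \<eta>_def algebra_simps)
    finally show "norm (Ri (PT T (T - s)) (gam (PT T (T - s)) (l2 (pT T (T - s)))) - Ri P (gam P (l2 p)))
        \<le> K' * exp (- r' * s)"
      by (simp add: Q_def q_def \<eta>_def gb_def)
  qed
qed

theorem turnpike:
  "(\<exists>K>0. \<exists>r>0. \<forall>T>0. \<forall>t\<in>{0..T}.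
      L2norm LI (\<lambda>u. p u - pT T t u) \<le> K * exp (- r * (T - t))) \<and>
   (\<exists>K>0. \<exists>r>0. \<forall>T>0. \<forall>t\<in>{0..T}.
      L2norm LI (\<lambda>u. theta_map c P p u - theta_map c (PT T t) (pT T t) u) \<le> K * exp (- r * (T - t)))"
proof
  obtain K r where K: "K > 0" "r > 0"
    "\<And>T s. T > 0 \<Longrightarrow> s \<in> {0..T} \<Longrightarrow> norm (l2 p - l2 (pT T (T - s))) \<le> K * exp (- r * s)"
    using p_convergence by blast
  have "L2norm LI (\<lambda>u. p u - pT T t u) \<le> K * exp (- r * (T - t))" if "T > 0" "t \<in> {0..T}" for T t
    using K(3)[of T "T - t"] that norm_l2[OF L2_diff[OF p_L2 pT_L2[OF that]]]
    by (simp add: l2_diff[OF p_L2 pT_L2[OF that]])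
  with K show "\<exists>K>0. \<exists>r>0. \<forall>T>0. \<forall>t\<in>{0..T}. L2norm LI (\<lambda>u. p u - pT T t u) \<le> K * exp (- r * (T - t))"
    by blast
  obtain K' r' where K': "K' > 0" "r' > 0"
    "\<And>T s. T > 0 \<Longrightarrow> s \<in> {0..T} \<Longrightarrow>
      norm (Ri (PT T (T - s)) (gam (PT T (T - s)) (l2 (pT T (T - s)))) - Ri P (gam P (l2 p))) \<le> K' * exp (- r' * s)"
    using theta_convergence by blast
  have "L2norm LI (\<lambda>u. theta_map c P p u - theta_map c (PT T t) (pT T t) u) \<le> K' * exp (- r' * (T - t))"
    if "T > 0" "t \<in> {0..T}" for T t
  proof -
    have h: "has_l2 (\<lambda>u. theta_map c P p u - theta_map c (PT T t) (pT T t) u)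
        (- Ri P (gam P (l2 p)) - (- Ri (PT T t) (gam (PT T t) (l2 (pT T t)))))"
      by (intro has_l2_diff has_l2_theta has_l2I p_L2 pT_L2 that)
    then have "L2norm LI (\<lambda>u. theta_map c P p u - theta_map c (PT T t) (pT T t) u)
        = norm (Ri (PT T t) (gam (PT T t) (l2 (pT T t))) - Ri P (gam P (l2 p)))"
      using norm_l2 by (metis (no_types, lifting) add.commute diff_conv_add_uminus has_l2_def minus_minus)
    then show ?thesis using K'(3)[of T "T - t"] that by simp
  qed
  with K' show "\<exists>K>0. \<exists>r>0. \<forall>T>0. \<forall>t\<in>{0..T}.
      L2norm LI (\<lambda>u. theta_map c P p u - theta_map c (PT T t) (pT T t) u) \<le> K * exp (- r * (T - t))"
    by blast
qed

end

theorem proposition4p3: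
  fixes c :: "('d::finite, 'm::finite) lq_data"
    and M :: "'w measure"
    and W :: "real \<Rightarrow> real \<Rightarrow> 'w \<Rightarrow> real"
    and \<zeta> :: "real \<Rightarrow> 'w \<Rightarrow> real"
    and PT PibT :: "real \<Rightarrow> real \<Rightarrow> real^'d^'d"
    and LamT :: "real \<Rightarrow> real \<Rightarrow> real \<Rightarrow> real \<Rightarrow> real^'d^'d"
    and pT :: "real \<Rightarrow> real \<Rightarrow> real \<Rightarrow> real^'d"
    and P Pib :: "real^'d^'d"
    and L :: "real \<Rightarrow> real \<Rightarrow> real^'d^'d"
    and p :: "real \<Rightarrow> real^'d"
  assumes "admissible_data c"
    and "prob_setup M W \<zeta>"
    and "positivity_cond c"
    and "stabilizability_cond c M W \<zeta>"
    and "\<And>T. T > 0 \<Longrightarrow> solves_P_eq c T (PT T)"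
    and "\<And>T. T > 0 \<Longrightarrow> solves_Pib_eq c T (PT T) (PibT T)"
    and "\<And>T. T > 0 \<Longrightarrow> solves_Lam_eq c T (PT T) (PibT T) (LamT T)"
    and "\<And>T. T > 0 \<Longrightarrow> solves_p_eq c T (PT T) (PibT T) (LamT T) (pT T)"
    and "solves_alg_riccati c P Pib"
    and "algebraic_solvability c P Pib LamT"
    and "solves_alg_Lam_p c P Pib L p"
  shows "(\<exists>K>0. \<exists>r>0. \<forall>T>0. \<forall>t\<in>{0..T}.
            L2norm LI (\<lambda>u. p u - pT T t u) \<le> K * exp (- r * (T - t))) \<and>
         (\<exists>K>0. \<exists>r>0. \<forall>T>0. \<forall>t\<in>{0..T}.
            L2norm LI (\<lambda>u. theta_map c P p u - theta_map c (PT T t) (pT T t) u)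
              \<le> K * exp (- r * (T - t)))"
proof -
  interpret lq_turnpike c PT PibT LamT pT P Pib L p
    using assms by unfold_locales
  show ?thesis by (rule turnpike)
qed

end
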